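(* Let $K$ be a perfectoid field with residue characteristic $p$, $q\in K$ with $0<|q|<1$, and fix an integer $i\ge0$. If $\mathfrak{d}$ is a $q$-periodic divisor with denominator $1/p^i$ (i.e. all multiplicities lie in $p^{-i}\mathbb{Z}$) and $\deg_q(\mathfrak{d})>0$, then $$\ell_K(q\,|\,\mathfrak{d})=\deg_q(\mathfrak{d})\cdot p^i.$$
   Context: Meromorphic functions are quotients of series $\sum_{n\ge0,n\in\mathbb{Z}[1/p]}a_nX^n$ with $a_n\in K$, $|a_n|\to0$ (and analytic functions on $\bar K^\times$ of that type); $\mathrm{ord}_\alpha$ for $\alpha\in\bar K^\times$ is the multiplicity of the minimal polynomial of $\alpha$ over $K$ in the Weierstrass polynomial part, with values in $\mathbb{Z}[1/p]$, and $\mathrm{Div}(f)=\{\mathrm{ord}_\alpha f\}_\alpha$. A divisor is a family $\{m_\alpha\}_{\alpha\in\bar K^\times}$ with $m_\alpha\in\mathbb{Z}[1/p]$, finitely many nonzero in each region $0<r\le|\alpha|\le r'$, constant on $K$-conjugacy classes; it is $q$-periodic if $m_{q\alpha}=m_\alpha$. For a $q$-periodic divisor, $\deg_q\mathfrak{d}=\sum'_{|q|<|\alpha|\le1}[K(\alpha):K]m_\alpha$ (sum over $K$-conjugacy classes). $f$ is $q$-periodic if $f(q^{-1}X)=f(X)$. $L_K(q|\mathfrak{d})$ is the $K$-vector space of $q$-periodic meromorphic functions $f$ with $\mathrm{Div}(f)\ge-\mathfrak{d}$ (together with $0$), and $\ell_K(q|\mathfrak{d})=\dim_K L_K(q|\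mathfrak{d})$.
   Formalization: L_K(q|d) is restricted to functions with exponents in p^{-i}Z (otherwise the formula for i and i+1 would conflict); q is assumed to have a p^i-th root in K, used to define f(q^{-1}X); and if char K = 0 the multiplicities of d are assumed to be integers. *)

theory Defs
  imports "HOL-Analysis.Analysis" "HOL-Algebra.Algebraic_Closure_Type"
begin

section \<open>Perfectoid fields\<close>

class nonarch_field = field + metric_space +
  fixes absv :: "'a \<Rightarrow> real"
  assumes dist_absv: "dist x y = absv (x - y)"
    and absv_mult: "absv (x * y) = absv x * absv y"
    and absv_add_le: "absv (x + y) \<le> max (absv x) (absv y)"

text \<open>The value group is not discrete, and the Frobenius is surjective on the valuation ring
  modulo \<open>p\<close>. As \<open>absv p < 1\<close>, the prime \<open>p\<close> is the residue characteristic; \<open>p = 0\<close> in the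
  field is allowed.\<close>

class perfectoid_field = nonarch_field + complete_space +
  assumes absv_not_discrete: "0 < e \<Longrightarrow> \<exists>x. 1 - e < absv x \<and> absv x < 1"
    and residue_frobenius_surj: "\<exists>p::nat. Factorial_Ring.prime p \<and> absv (of_nat p) < 1 \<and>
          (\<forall>x. absv x \<le> 1 \<longrightarrow> (\<exists>y. absv y \<le> 1 \<and> absv (x - y ^ p) \<le> absv (of_nat p)))"

definition residue_char :: "'a::perfectoid_field itself \<Rightarrow> nat" where
  "residue_char _ = (THE p. Factorial_Ring.prime p \<and> absv (of_nat p :: 'a) < 1)"

lemma absv_0 [simp]: "absv (0::'a::nonarch_field) = 0"
  using dist_absv[of "0::'a" 0] by simp

lemma absv_ge_0 [simp]: "0 \<le> absv (x::'a::nonarch_field)"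
  using dist_absv[of x 0] zero_le_dist[of x 0] by simp

lemma absv_eq_0 [simp]: "absv (x::'a::nonarch_field) = 0 \<longleftrightarrow> x = 0"
  using dist_absv[of x 0] by (metis diff_zero dist_eq_0_iff)

lemma absv_1 [simp]: "absv (1::'a::nonarch_field) = 1"
  using absv_mult[of "1::'a" 1] absv_eq_0[of "1::'a"] by simp

lemma absv_minus [simp]: "absv (- x) = absv (x::'a::nonarch_field)"
  using dist_commute[of x 0] by (simp add: dist_absv)

lemma absv_diff_le: "absv (x - y) \<le> max (absv x) (absv (y::'a::nonarch_field))"
  using absv_add_le[of x "-y"] by simp

lemma absv_sum_le:
  fixes f :: "'b \<Rightarrow> 'a::nonarch_field"
  assumes "\<And>x. x \<in> A \<Longrightarrow> absv (f x) \<le> B" "0 \<le> B"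
  shows "absv (sum f A) \<le> B"
  using assms
proof (induction A rule: infinite_finite_induct)
  case (insert x F)
  have "absv (f x + sum f F) \<le> max (absv (f x)) (absv (sum f F))"
    by (rule absv_add_le)
  with insert show ?case by fastforce
qed auto

lemma absv_power: "absv (x ^ n) = absv (x::'a::nonarch_field) ^ n"
  by (induction n) (auto simp: absv_mult)

lemma absv_inverse: "absv (inverse x) = inverse (absv (x::'a::nonarch_field))"
proof (cases "x = 0")
  case False
  then have "absv x * absv (inverse x) = 1" by (simp flip: absv_mult)
  then show ?thesis by (metis inverse_unique)
qed auto

lemma absv_power_int: "absv (x powi n) = absv (x::'a::nonarch_field) powi n"
  by (auto simp: power_int_def absv_power absv_inverse)

lemma nf_isUCont_plus: "isUCont (\<lambda>(x::'a::nonarch_field,y). x + y)"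
proof (rule isUCont_prod_metric[THEN iffD2], intro allI impI, simp)
  fix e :: real assume e: "0 < e"
  have "dist (x1 + x2) (y1 + y2) < e"
    if "dist x1 y1 < e" "dist x2 y2 < e" for x1 x2 y1 y2 :: 'a
  proof -
    have *: "x1 + x2 - (y1 + y2) = (x1 - y1) + (x2 - y2)" by simp
    show ?thesis
      using that absv_add_le[of "x1 - y1" "x2 - y2"] unfolding dist_absv *
      by (meson le_less_trans max_less_iff_conj)
  qed
  with e show "\<exists>d>0. \<forall>x y :: 'a. dist x y < d \<longrightarrow>
      (\<forall>x' y'. dist x' y' < d \<longrightarrow> dist (x + x') (y + y') < e)" by blast
qed

instance nonarch_field < topological_ab_group_add
proof
  fix a b :: 'a
  have "isCont (\<lambda>x::'a \<times> 'a. fst x + snd x) (a, b)"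
    using isUCont_isCont[OF nf_isUCont_plus] by (simp add: case_prod_unfold)
  then show "((\<lambda>x. fst x + snd x) \<longlongrightarrow> a + b) (nhds a \<times>\<^sub>F nhds b)"
    using tendsto_at_iff_tendsto_nhds[of "\<lambda>x::'a \<times> 'a. fst x + snd x" "(a, b)"]
    by (simp add: isCont_def nhds_prod)
  show "(uminus \<longlongrightarrow> - a) (nhds a)"
  proof (rule tendstoI)
    fix e :: real assume "0 < e"
    have "dist (- x) (- a) = dist x a" for x
      by (simp add: dist_absv) (metis absv_minus minus_diff_eq)
    then show "\<forall>\<^sub>F x in nhds a. dist (- x) (- a) < e"
      using \<open>0 < e\<close> eventually_nhds_metric by auto
  qed
qed

instance nonarch_field < topological_semigroup_mult
proof
  fix a b :: 'a
  show "((\<lambda>x. fst x * snd x) \<longlongrightarrow> a * b) (nhds a \<times>\<^sub>F nhds b)"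
  proof (rule tendstoI)
    fix e :: real assume e: "0 < e"
    define M where "M = absv a + absv b + 1"
    have M: "M > 0" unfolding M_def by (smt (verit) absv_ge_0)
    define d where "d = min 1 (e / M)"
    have d: "d > 0" "d \<le> 1" "d * M \<le> e" using e M by (auto simp: d_def min_def field_simps)
    have "dist (x * y) (a * b) < e" if xy: "dist x a < d" "dist y b < d" for x y :: 'a
    proof -
      have *: "x * y - a * b = (x - a) * y + a * (y - b)" by (simp add: algebra_simps)
      have "absv y \<le> max (absv (y - b)) (absv b)"
        using absv_add_le[of "y - b" b] by simp
      then have "absv y \<le> M" using xy d unfolding M_def dist_absv by (smt (verit) absv_ge_0)
      have 1: "absv ((x - a) * y) < e"
      proof -
        have "absv ((x - a) * y) \<le> absv (x - a) * M"
          using \<open>absv y \<le> M\<close> by (simp add: absv_mult mult_left_mono)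
        also have "\<dots> < d * M" using xy M by (simp add: dist_absv)
        finally show ?thesis using d by simp
      qed
      have 2: "absv (a * (y - b)) < e"
      proof -
        have "absv (a * (y - b)) \<le> M * absv (y - b)"
          by (simp add: absv_mult M_def mult_right_mono)
        also have "\<dots> < M * d" using xy M by (simp add: dist_absv)
        finally show ?thesis using d by (simp add: mult.commute)
      qed
      show ?thesis unfolding dist_absv *
        using 1 2 absv_add_le[of "(x - a) * y" "a * (y - b)"] by linarith
    qed
    moreover have "\<forall>\<^sub>F x in nhds a \<times>\<^sub>F nhds b. dist (fst x) a < d \<and> dist (snd x) b < d"
      using d by (auto simp: eventually_prod_filter eventually_nhds_metric
          intro!: exI[of _ "\<lambda>x. dist x _ < d"])
    ultimately show "\<forall>\<^sub>F x in nhds a \<times>\<^sub>F nhds b. dist (fst x * snd x) (a * b) < e"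
      by (auto elim!: eventually_mono)
  qed
qed

section \<open>Families tending to zero\<close>

definition null_family :: "('b \<Rightarrow> 'a::nonarch_field) \<Rightarrow> bool" where
  "null_family f \<longleftrightarrow> ((\<lambda>x. absv (f x)) \<longlongrightarrow> 0) cofinite"

lemma null_real_iff:
  assumes "\<And>x. 0 \<le> g x"
  shows "(g \<longlongrightarrow> (0::real)) cofinite \<longleftrightarrow> (\<forall>e>0. finite {x. e \<le> g x})"
  using assms by (simp add: tendsto_iff eventually_cofinite not_less)

lemma null_family_iff: "null_family f \<longleftrightarrow> (\<forall>e>0. finite {x. e \<le> absv (f x)})"
  unfolding null_family_def by (rule null_real_iff) simp

lemma null_family_bound:
  assumes "(g \<longlongrightarrow> (0::real)) cofinite" "\<And>x. 0 \<le> g x"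
  obtains M where "M > 0" "\<And>x. g x \<le> M"
proof -
  have fin: "finite {x. 1 \<le> g x}" using assms null_real_iff[of g] by auto
  define M where "M = Max (insert 1 (g ` {x. 1 \<le> g x}))"
  have "1 \<le> M" unfolding M_def using fin by (intro Max_ge) auto
  moreover have "g x \<le> M" for x
  proof (cases "1 \<le> g x")
    case True then show ?thesis unfolding M_def using fin by (intro Max_ge) auto
  qed (use \<open>1 \<le> M\<close> in simp)
  ultimately show ?thesis using that[of M] by simp
qed

lemma null_family_summable:
  fixes f :: "'b \<Rightarrow> 'a::{nonarch_field,complete_space}"
  assumes "null_family f"
  shows "f summable_on A"
proof -
  have "\<exists>P. eventually P (finite_subsets_at_top A) \<and>
              (\<forall>F F'. P F \<and> P F' \<longrightarrow> dist (sum f F) (sum f F') < e)" if "e>0" for e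
  proof -
    define S where "S = {x\<in>A. e/2 \<le> absv (f x)}"
    have "finite {x. e/2 \<le> absv (f x)}"
      using assms \<open>e > 0\<close> unfolding null_family_iff by (metis half_gt_zero)
    then have S: "finite S" "S \<subseteq> A"
      by (auto simp: S_def elim: rev_finite_subset)
    define P where "P = (\<lambda>F. finite F \<and> S \<subseteq> F \<and> F \<subseteq> A)"
    have close: "absv (sum f F - sum f S) \<le> e/2" if "P F" for F
    proof -
      have "sum f F - sum f S = sum f (F - S)"
        using that S by (subst sum_diff) (auto simp: P_def)
      moreover have "absv (sum f (F - S)) \<le> e/2"
        by (rule absv_sum_le) (use that \<open>e>0\<close> in \<open>auto simp: S_def P_def\<close>)
      ultimately show ?thesis by simp
    qed
    have "dist (sum f F) (sum f F') < e" if "P F" "P F'" for F F'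
    proof -
      have "sum f F - sum f F' = (sum f F - sum f S) - (sum f F' - sum f S)" by simp
      then show ?thesis
        using close[OF that(1)] close[OF that(2)] \<open>e>0\<close>
          absv_diff_le[of "sum f F - sum f S" "sum f F' - sum f S"]
        by (simp add: dist_absv)
    qed
    moreover have "eventually P (finite_subsets_at_top A)"
      unfolding eventually_finite_subsets_at_top using S by (auto simp: P_def)
    ultimately show ?thesis by blast
  qed
  then have "cauchy_filter (filtermap (sum f) (finite_subsets_at_top A))"
    by (simp add: cauchy_filter_metric_filtermap)
  moreover have "complete (UNIV::'a set)"
    by (meson Cauchy_convergent UNIV_I complete_def convergent_def)
  ultimately obtain L' where "(sum f \<longlongrightarrow> L') (finite_subsets_at_top A)"
    using complete_uniform[where S="UNIV::'a set"] by (force simp: filterlim_def)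
  then show ?thesis
    using summable_on_def has_sum_def by blast
qed

lemma absv_infsum_le:
  fixes f :: "'b \<Rightarrow> 'a::nonarch_field"
  assumes "\<And>x. x \<in> A \<Longrightarrow> absv (f x) \<le> B" "0 \<le> B"
  shows "absv (infsum f A) \<le> B"
proof (cases "f summable_on A")
  case True
  have "absv (infsum f A) \<le> B + e" if "e > 0" for e
  proof -
    have "(sum f \<longlongrightarrow> infsum f A) (finite_subsets_at_top A)"
      using has_sum_infsum[OF True] by (simp add: has_sum_def)
    then have "\<forall>\<^sub>F F in finite_subsets_at_top A. dist (sum f F) (infsum f A) < e"
      using that by (simp add: tendsto_iff)
    then obtain F where F: "finite F" "F \<subseteq> A" "dist (sum f F) (infsum f A) \<le> e"
      unfolding eventually_finite_subsets_at_top by (meson less_imp_le order_refl)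
    have "absv (infsum f A) \<le> max (absv (infsum f A - sum f F)) (absv (sum f F))"
      using absv_add_le[of "infsum f A - sum f F" "sum f F"] by simp
    moreover have "absv (sum f F) \<le> B" by (rule absv_sum_le) (use F assms in auto)
    moreover have "absv (infsum f A - sum f F) \<le> e" using F by (simp add: dist_absv[symmetric] dist_commute)
    ultimately show ?thesis using that assms by linarith
  qed
  then show ?thesis using field_le_epsilon by blast
qed (simp add: infsum_not_exists assms)

section \<open>Series with exponents in \<open>\<int>[1/p]\<close>\<close>

definition exponents_level :: "nat \<Rightarrow> nat \<Rightarrow> rat set" where
  "exponents_level p i = {of_int k / of_nat (p ^ i) | k. True}"

definition int_adjoin_inverse :: "nat \<Rightarrow> rat set" where
  "int_adjoin_inverse p = (\<Union>i. exponents_level p i)"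

lemma exponents_level_mono:
  assumes "p > 0" "i \<le> j"
  shows "exponents_level p i \<subseteq> exponents_level p j"
proof
  fix x assume "x \<in> exponents_level p i"
  then obtain k where x: "x = of_int k / of_nat (p ^ i)" by (auto simp: exponents_level_def)
  have "x = of_int (k * int (p ^ (j - i))) / of_nat (p ^ j)"
    using assms by (simp add: x field_simps flip: power_add)
  then show "x \<in> exponents_level p j" unfolding exponents_level_def by blast
qed

lemma exponents_level_closed:
  "0 \<in> exponents_level p i"
  "x \<in> exponents_level p i \<Longrightarrow> y \<in> exponents_level p i \<Longrightarrow> x + y \<in> exponents_level p i"
  "x \<in> exponents_level p i \<Longrightarrow> - x \<in> exponents_level p i"
proof -
  show "0 \<in> exponents_level p i" by (auto simp: exponents_level_def intro!: exI[of _ 0])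
  show "x \<in> exponents_level p i \<Longrightarrow> y \<in> exponents_level p i \<Longrightarrow> x + y \<in> exponents_level p i"
    unfolding exponents_level_def by (smt (verit) add_divide_distrib mem_Collect_eq of_int_add)
  show "x \<in> exponents_level p i \<Longrightarrow> - x \<in> exponents_level p i"
    unfolding exponents_level_def by (smt (verit) minus_divide_left mem_Collect_eq of_int_minus)
qed

lemma int_adjoin_inverse_closed:
  assumes "p > 0"
  shows "0 \<in> int_adjoin_inverse p"
    and "x \<in> int_adjoin_inverse p \<Longrightarrow> y \<in> int_adjoin_inverse p \<Longrightarrow> x + y \<in> int_adjoin_inverse p"
    and "x \<in> int_adjoin_inverse p \<Longrightarrow> - x \<in> int_adjoin_inverse p"
proof -
  show "0 \<in> int_adjoin_inverse p"
    using exponents_level_closed(1) by (auto simp: int_adjoin_inverse_def)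
  show "x \<in> int_adjoin_inverse p \<Longrightarrow> - x \<in> int_adjoin_inverse p"
    using exponents_level_closed(3) by (auto simp: int_adjoin_inverse_def)
  assume "x \<in> int_adjoin_inverse p" "y \<in> int_adjoin_inverse p"
  then obtain i j where "x \<in> exponents_level p i" "y \<in> exponents_level p j"
    by (auto simp: int_adjoin_inverse_def)
  then have "x \<in> exponents_level p (max i j)" "y \<in> exponents_level p (max i j)"
    using exponents_level_mono[OF assms] by (meson max.cobounded1 max.cobounded2 subsetD)+
  then show "x + y \<in> int_adjoin_inverse p"
    unfolding int_adjoin_inverse_def using exponents_level_closed(2) by blast
qed

lemma residue_char_eqI:
  assumes "Factorial_Ring.prime p" "absv (of_nat p :: 'a::perfectoid_field) < 1"
  shows "residue_char TYPE('a) = p"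
  unfolding residue_char_def
proof (rule the_equality)
  fix q assume q: "Factorial_Ring.prime q \<and> absv (of_nat q :: 'a) < 1"
  have int_le: "absv (of_int n :: 'a) \<le> 1" for n
  proof -
    have "absv (of_nat n :: 'a) \<le> 1" for n
    proof (induction n)
      case (Suc n)
      then show ?case using absv_add_le[of "1::'a" "of_nat n"] by simp
    qed simp
    then show ?thesis by (cases n rule: int_cases2) auto
  qed
  show "q = p"
  proof (rule ccontr)
    assume "q \<noteq> p"
    then have "coprime (int p) (int q)" using q assms primes_coprime by auto
    then obtain u v where "u * int p + v * int q = 1"
      using bezout_int[of "int p" "int q"] by (auto simp: coprime_iff_gcd_eq_1)
    then have *: "(of_int u * of_nat p + of_int v * of_nat q :: 'a) = 1"
      by (metis of_int_1 of_int_add of_int_mult of_int_of_nat_eq)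
    have "absv (of_int u * of_nat p :: 'a) < 1" "absv (of_int v * of_nat q :: 'a) < 1"
      using assms q int_le[of u] int_le[of v]
      by (smt (verit, best) absv_ge_0 absv_mult mult_left_le_one_le)+
    then show False
      using absv_add_le[of "of_int u * of_nat p :: 'a" "of_int v * of_nat q"] unfolding * by simp
  qed
qed (use assms in auto)

lemma residue_char_prime: "Factorial_Ring.prime (residue_char TYPE('a::perfectoid_field))"
  using residue_frobenius_surj[where 'a='a] residue_char_eqI[where 'a='a] by auto

lemma residue_char_pos: "residue_char TYPE('a::perfectoid_field) > 0"
  using residue_char_prime prime_gt_0_nat by blast

text \<open>A family \<open>a\<close> stands for the formal series \<open>\<Sum> a n X\<^sup>n\<close>. It converges on \<open>|X| = s\<close> iff
  \<open>|a n| s\<^sup>n\<close> tends to zero.\<close>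

definition null_at :: "real \<Rightarrow> (rat \<Rightarrow> 'a::nonarch_field) \<Rightarrow> bool" where
  "null_at s a \<longleftrightarrow> ((\<lambda>n. absv (a n) * s powr of_rat n) \<longlongrightarrow> 0) cofinite"

definition annulus_series :: "real \<Rightarrow> real \<Rightarrow> (rat \<Rightarrow> 'a::perfectoid_field) set" where
  "annulus_series r r' =
     {a. (\<forall>n. a n \<noteq> 0 \<longrightarrow> n \<in> int_adjoin_inverse (residue_char TYPE('a))) \<and>
         (\<forall>s. r \<le> s \<and> s \<le> r' \<longrightarrow> null_at s a)}"

definition cauchy_prod :: "(rat \<Rightarrow> 'a::nonarch_field) \<Rightarrow> (rat \<Rightarrow> 'a) \<Rightarrow> rat \<Rightarrow> 'a" where
  "cauchy_prod a b n = (\<Sum>\<^sub>\<infinity>m. a m * b (n - m))"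

definition const_series :: "'a \<Rightarrow> rat \<Rightarrow> 'a::zero" where
  "const_series c = (\<lambda>n. if n = 0 then c else 0)"

lemma null_at_iff:
  "null_at s a \<longleftrightarrow> (\<forall>e>0. finite {n. e \<le> absv (a n) * s powr of_rat n})"
  unfolding null_at_def by (rule null_real_iff) simp

lemma null_at_cauchy_terms:
  fixes a b :: "rat \<Rightarrow> 'a::nonarch_field"
  assumes s: "s > 0" and a: "null_at s a" and b: "null_at s b"
  shows "null_family (\<lambda>m. a m * b (n - m))"
  unfolding null_family_iff
proof (intro allI impI)
  fix e :: real assume e: "e > 0"
  obtain B where B: "B > 0" "\<And>n. absv (b n) * s powr of_rat n \<le> B"
    by (rule null_family_bound[of "\<lambda>n. absv (b n) * s powr of_rat n"]) (use b in \<open>auto simp: null_at_def\<close>)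
  define e' where "e' = e * s powr of_rat n / B"
  have e': "e' > 0" using e s B by (simp add: e'_def)
  have "{m. e \<le> absv (a m * b (n - m))} \<subseteq> {m. e' \<le> absv (a m) * s powr of_rat m}"
  proof safe
    fix m assume "e \<le> absv (a m * b (n - m))"
    then have "e * s powr of_rat n \<le> absv (a m) * absv (b (n - m)) * s powr of_rat n"
      using s by (intro mult_right_mono) (auto simp: absv_mult)
    also have "\<dots> = (absv (a m) * s powr of_rat m) * (absv (b (n - m)) * s powr of_rat (n - m))"
      using s by (simp add: of_rat_diff powr_diff)
    also have "\<dots> \<le> (absv (a m) * s powr of_rat m) * B"
      by (intro mult_left_mono B) auto
    finally show "e' \<le> absv (a m) * s powr of_rat m"
      using B by (simp add: e'_def field_simps)
  qed
  then show "finite {m. e \<le> absv (a m * b (n - m))}"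
    using a e' null_at_iff finite_subset by blast
qed

lemma null_at_cauchy_prod:
  fixes a b :: "rat \<Rightarrow> 'a::nonarch_field"
  assumes s: "s > 0" and a: "null_at s a" and b: "null_at s b"
  shows "null_at s (cauchy_prod a b)"
  unfolding null_at_iff
proof (intro allI impI)
  fix e :: real assume e: "e > 0"
  obtain B where B: "B > 0" "\<And>n. absv (b n) * s powr of_rat n \<le> B"
    by (rule null_family_bound[of "\<lambda>n. absv (b n) * s powr of_rat n"]) (use b in \<open>auto simp: null_at_def\<close>)
  obtain A where A: "A > 0" "\<And>n. absv (a n) * s powr of_rat n \<le> A"
    by (rule null_family_bound[of "\<lambda>n. absv (a n) * s powr of_rat n"]) (use a in \<open>auto simp: null_at_def\<close>)
  define S where "S = {m. e / 2 / B \<le> absv (a m) * s powr of_rat m}"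
  define T where "T = {m. e / 2 / A \<le> absv (b m) * s powr of_rat m}"
  have fin: "finite S" "finite T"
    unfolding S_def T_def using a b e A B null_at_iff by (metis divide_pos_pos half_gt_zero)+
  have "{n. e \<le> absv (cauchy_prod a b n) * s powr of_rat n} \<subseteq> (\<lambda>(x,y). x + y) ` (S \<times> T)"
  proof
    fix n assume n: "n \<in> {n. e \<le> absv (cauchy_prod a b n) * s powr of_rat n}"
    have sn: "s powr of_rat n > 0" using s by simp
    have "\<exists>m. e / 2 / s powr of_rat n \<le> absv (a m * b (n - m))"
    proof (rule ccontr)
      assume "\<not> ?thesis"
      then have "absv (cauchy_prod a b n) \<le> e / 2 / s powr of_rat n"
        unfolding cauchy_prod_def using e sn by (intro absv_infsum_le) (auto simp: not_le less_imp_le)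
      then have "absv (cauchy_prod a b n) * s powr of_rat n \<le> e / 2"
        using sn by (simp add: pos_le_divide_eq)
      with n e show False by simp
    qed
    then obtain m where "e / 2 / s powr of_rat n \<le> absv (a m * b (n - m))" by blast
    then have "e / 2 \<le> absv (a m * b (n - m)) * s powr of_rat n"
      using sn by (simp add: pos_divide_le_eq)
    also have "\<dots> = (absv (a m) * s powr of_rat m) * (absv (b (n - m)) * s powr of_rat (n - m))"
      using s by (simp add: of_rat_diff powr_diff absv_mult)
    finally have *: "e / 2 \<le> (absv (a m) * s powr of_rat m) * (absv (b (n - m)) * s powr of_rat (n - m))" .
    have "e / 2 \<le> (absv (a m) * s powr of_rat m) * B"
      by (rule order_trans[OF *]) (intro mult_left_mono B, auto)
    then have "m \<in> S" using B by (simp add: S_def pos_divide_le_eq)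
    have "e / 2 \<le> A * (absv (b (n - m)) * s powr of_rat (n - m))"
      by (rule order_trans[OF *]) (intro mult_right_mono A, auto)
    then have "n - m \<in> T" using A by (simp add: T_def pos_divide_le_eq mult.commute)
    with \<open>m \<in> S\<close> show "n \<in> (\<lambda>(x,y). x + y) ` (S \<times> T)"
      by (auto intro!: image_eqI[of _ _ "(m, n - m)"])
  qed
  then show "finite {n. e \<le> absv (cauchy_prod a b n) * s powr of_rat n}"
    using fin finite_subset by blast
qed

lemma cauchy_prod_commute: "cauchy_prod a b = cauchy_prod b a"
proof
  fix n
  have "bij_betw (\<lambda>m. n - m) UNIV (UNIV :: rat set)"
    by (rule bij_betwI[of _ _ _ "\<lambda>m. n - m"]) auto
  from infsum_reindex_bij_betw[OF this, of "\<lambda>m. a m * b (n - m)"]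
  show "cauchy_prod a b n = cauchy_prod b a n"
    by (simp add: cauchy_prod_def mult.commute)
qed

lemma cauchy_prod_const: "cauchy_prod (const_series c) a = (\<lambda>n. c * a n)"
proof
  fix n
  have "cauchy_prod (const_series c) a n = (\<Sum>\<^sub>\<infinity>m\<in>{0}. const_series c m * a (n - m))"
    unfolding cauchy_prod_def by (rule infsum_cong_neutral) (auto simp: const_series_def)
  then show "cauchy_prod (const_series c) a n = c * a n"
    by (simp add: const_series_def)
qed

lemma cauchy_prod_add:
  fixes a b c :: "rat \<Rightarrow> 'a::{nonarch_field,complete_space}"
  assumes "s > 0" "null_at s a" "null_at s b" "null_at s c"
  shows "cauchy_prod (\<lambda>n. a n + b n) c n = cauchy_prod a c n + cauchy_prod b c n"
proof -
  have "(\<lambda>m. a m * c (n - m)) summable_on UNIV" "(\<lambda>m. b m * c (n - m)) summable_on UNIV"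
    using assms by (auto intro!: null_family_summable null_at_cauchy_terms)
  then show ?thesis
    by (simp add: cauchy_prod_def distrib_right infsum_add)
qed

lemma cauchy_prod_assoc:
  fixes a b c :: "rat \<Rightarrow> 'a::{nonarch_field,complete_space}"
  assumes s: "s > 0" and a: "null_at s a" and b: "null_at s b" and c: "null_at s c"
  shows "cauchy_prod (cauchy_prod a b) c n = cauchy_prod a (cauchy_prod b c) n"
proof -
  let ?f = "\<lambda>m k. a k * b (m - k) * c (n - m)"
  define N :: "(rat \<Rightarrow> 'a) \<Rightarrow> rat \<Rightarrow> real" where "N = (\<lambda>a n. absv (a n) * s powr of_rat n)"
  have N0: "0 \<le> N x n" for x n by (simp add: N_def)
  have bound: "\<exists>A>0. \<forall>n. N x n \<le> A" if "null_at s x" for x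
    by (rule null_family_bound[of "N x"]) (use that in \<open>auto simp: null_at_def N_def\<close>)
  obtain A B C where A: "A > 0" "\<And>n. N a n \<le> A" and B: "B > 0" "\<And>n. N b n \<le> B"
    and C: "C > 0" "\<And>n. N c n \<le> C"
    using bound[OF a] bound[OF b] bound[OF c] by metis
  have fin: "finite {n. e \<le> N x n}" if "null_at s x" "e > 0" for x e
    using that by (auto simp: null_at_iff N_def)
  have null2: "null_family (\<lambda>(m,k). ?f m k)"
    unfolding null_family_iff
  proof (intro allI impI)
    fix e :: real assume e: "e > 0"
    define e' where "e' = e * s powr of_rat n"
    have e': "e' > 0" using e s by (simp add: e'_def)
    define S where "S = {k. e' / (B * C) \<le> N a k}"
    define T where "T = {k. e' / (A * C) \<le> N b k}"
    have finST: "finite S" "finite T"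
      unfolding S_def T_def using e' A B C a b by (auto intro!: fin)
    have "{x. e \<le> absv (case x of (m,k) \<Rightarrow> ?f m k)} \<subseteq> (\<lambda>(x,y). (x + y, x)) ` (S \<times> T)"
    proof
      fix x assume "x \<in> {x. e \<le> absv (case x of (m,k) \<Rightarrow> ?f m k)}"
      then obtain m k where x: "x = (m, k)" and "e \<le> absv (?f m k)" by (cases x) auto
      then have "e' \<le> absv (?f m k) * s powr of_rat n"
        using s by (simp add: e'_def)
      also have "\<dots> = N a k * N b (m - k) * N c (n - m)"
        using s by (simp add: N_def of_rat_diff powr_diff absv_mult)
      finally have *: "e' \<le> N a k * N b (m - k) * N c (n - m)" .
      have "e' \<le> N a k * B * C"
        by (rule order_trans[OF *]) (use A B C N0 in \<open>intro mult_mono; auto intro: mult_nonneg_nonneg less_imp_le\<close>)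
      then have "k \<in> S" using B C by (simp add: S_def pos_divide_le_eq mult.assoc)
      have "e' \<le> A * N b (m - k) * C"
        by (rule order_trans[OF *]) (use A B C N0 in \<open>intro mult_mono; auto intro: mult_nonneg_nonneg less_imp_le\<close>)
      then have "m - k \<in> T" using A C by (simp add: T_def pos_divide_le_eq mult_ac)
      with \<open>k \<in> S\<close> show "x \<in> (\<lambda>(x,y). (x + y, x)) ` (S \<times> T)"
        by (auto simp: x intro!: image_eqI[of _ _ "(k, m - k)"])
    qed
    then show "finite {x. e \<le> absv (case x of (m,k) \<Rightarrow> ?f m k)}"
      using finST finite_subset by blast
  qed
  have sub: "null_family (g \<circ> h)" if "null_family g" "inj h" for g :: "rat \<times> rat \<Rightarrow> 'a" and h :: "rat \<Rightarrow> rat \<times> rat"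
    unfolding null_family_iff
  proof (intro allI impI)
    fix e :: real assume "e > 0"
    then have "finite (h -` {x. e \<le> absv (g x)})"
      using that by (intro finite_vimageI) (auto simp: null_family_iff)
    then show "finite {x. e \<le> absv ((g \<circ> h) x)}" by (simp add: vimage_def)
  qed
  have null_m: "null_family (\<lambda>k. ?f m k)" for m
    using sub[OF null2, of "\<lambda>k. (m, k)"] by (simp add: inj_on_def comp_def)
  have null_k: "null_family (\<lambda>m. ?f m k)" for k
    using sub[OF null2, of "\<lambda>m. (m, k)"] by (simp add: inj_on_def comp_def)
  have "cauchy_prod (cauchy_prod a b) c n = (\<Sum>\<^sub>\<infinity>m. \<Sum>\<^sub>\<infinity>k. ?f m k)"
    unfolding cauchy_prod_def by (simp add: infsum_cmult_left')
  also have "\<dots> = (\<Sum>\<^sub>\<infinity>k. \<Sum>\<^sub>\<infinity>m. ?f m k)"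
  proof (rule infsum_swap)
    show "isUCont (\<lambda>(x::'a,y). x + y)" by (rule nf_isUCont_plus)
    show "(\<lambda>(x, y). ?f x y) summable_on UNIV \<times> UNIV"
      by (rule null_family_summable[OF null2])
  qed (auto intro!: null_family_summable null_m null_k)
  also have "\<dots> = (\<Sum>\<^sub>\<infinity>k. a k * (\<Sum>\<^sub>\<infinity>m. b (m - k) * c (n - m)))"
    by (simp add: mult.assoc infsum_cmult_right')
  also have "\<dots> = cauchy_prod a (cauchy_prod b c) n"
  proof -
    have "(\<Sum>\<^sub>\<infinity>m. b (m - k) * c (n - m)) = cauchy_prod b c (n - k)" for k
    proof -
      have "bij_betw (\<lambda>m. m - k) UNIV (UNIV :: rat set)"
        by (rule bij_betwI[of _ _ _ "\<lambda>m. m + k"]) auto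
      from infsum_reindex_bij_betw[OF this, of "\<lambda>m. b m * c (n - k - m)"]
      show ?thesis by (simp add: cauchy_prod_def)
    qed
    then show ?thesis by (simp add: cauchy_prod_def)
  qed
  finally show ?thesis .
qed

lemma cauchy_prod_nonzero:
  fixes a b :: "rat \<Rightarrow> 'a::{nonarch_field,complete_space}"
  assumes a: "null_at 1 a" "a \<noteq> (\<lambda>_. 0)" and b: "null_at 1 b" "b \<noteq> (\<lambda>_. 0)"
  shows "cauchy_prod a b \<noteq> (\<lambda>_. 0)"
proof -
  have top: "\<exists>n. x n \<noteq> 0 \<and> (\<forall>m. absv (x m) \<le> absv (x n)) \<and> (\<forall>m>n. absv (x m) < absv (x n))"
    if x: "null_at 1 x" "x \<noteq> (\<lambda>_. 0)" for x :: "rat \<Rightarrow> 'a"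
  proof -
    obtain k where k: "x k \<noteq> 0" using x by auto
    define S where "S = {n. absv (x k) \<le> absv (x n)}"
    have "absv (x k) > 0" using k absv_ge_0[of "x k"] absv_eq_0[of "x k"] by linarith
    then have S: "finite S" "k \<in> S" using x by (auto simp: S_def null_at_iff)
    define M where "M = Max ((absv \<circ> x) ` S)"
    have M: "absv (x m) \<le> M" if "m \<in> S" for m unfolding M_def using S that by (auto intro!: Max_ge)
    have "M \<in> (absv \<circ> x) ` S" unfolding M_def using S by (intro Max_in) auto
    define U where "U = {n\<in>S. absv (x n) = M}"
    have U: "finite U" "U \<noteq> {}" using S \<open>M \<in> _\<close> by (auto simp: U_def)
    define n where "n = Max U"
    have "n \<in> U" unfolding n_def using U by (rule Max_in)
    then have n: "n \<in> S" "absv (x n) = M" by (auto simp: U_def)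
    have le: "absv (x m) \<le> absv (x n)" for m
      using M[of m] M[OF S(2)] n by (cases "m \<in> S") (auto simp: S_def)
    have "absv (x m) < absv (x n)" if "m > n" for m
    proof (rule ccontr)
      assume "\<not> ?thesis"
      then have "absv (x m) = M" using le[of m] n by simp
      moreover have "absv (x k) \<le> M" using M[OF S(2)] .
      ultimately have "m \<in> U" by (auto simp: U_def S_def)
      then have "m \<le> n" unfolding n_def using U by (intro Max_ge) auto
      with that show False by simp
    qed
    moreover have "x n \<noteq> 0" using n(1) \<open>absv (x k) > 0\<close> by (auto simp: S_def)
    ultimately show ?thesis using le by blast
  qed
  obtain n where n: "a n \<noteq> 0" "\<And>m. absv (a m) \<le> absv (a n)" "\<And>m. m > n \<Longrightarrow> absv (a m) < absv (a n)"
    using top[OF a] by blast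
  obtain n' where n': "b n' \<noteq> 0" "\<And>m. absv (b m) \<le> absv (b n')" "\<And>m. m > n' \<Longrightarrow> absv (b m) < absv (b n')"
    using top[OF b] by blast
  let ?g = "\<lambda>m. a m * b (n + n' - m)"
  define P where "P = absv (a n * b n')"
  have P: "P > 0" using n n' absv_ge_0[of "a n * b n'"] absv_eq_0[of "a n * b n'"]
    unfolding P_def by (metis less_eq_real_def mult_eq_0_iff)
  have pos: "absv (a n) > 0" "absv (b n') > 0"
    using n n' absv_ge_0 absv_eq_0 by (metis less_eq_real_def)+
  have small: "absv (?g m) < P" if "m \<noteq> n" for m
  proof (cases "m > n")
    case True
    have "absv (a m) * absv (b (n + n' - m)) \<le> absv (a m) * absv (b n')"
      by (intro mult_left_mono n') auto
    also have "\<dots> < absv (a n) * absv (b n')" using n(3)[OF True] pos by simp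
    finally show ?thesis by (simp add: P_def absv_mult)
  next
    case False
    then have "n + n' - m > n'" using that by simp
    have "absv (a m) * absv (b (n + n' - m)) \<le> absv (a n) * absv (b (n + n' - m))"
      by (intro mult_right_mono n) auto
    also have "\<dots> < absv (a n) * absv (b n')" using n'(3)[OF \<open>n + n' - m > n'\<close>] pos by simp
    finally show ?thesis by (simp add: P_def absv_mult)
  qed
  have null: "null_family ?g" using a b by (intro null_at_cauchy_terms[of 1]) auto
  have "finite {m. P / 2 \<le> absv (?g m)}" using null P unfolding null_family_iff by (metis half_gt_zero)
  define c where "c = Max (insert (P / 2) ((\<lambda>m. absv (?g m)) ` ({m. P / 2 \<le> absv (?g m)} - {n})))"
  have fin: "finite (insert (P / 2) ((\<lambda>m. absv (?g m)) ` ({m. P / 2 \<le> absv (?g m)} - {n})))"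
    using \<open>finite {m. P / 2 \<le> absv (?g m)}\<close> by auto
  have c: "c < P" unfolding c_def using fin P small by (subst Max_less_iff) auto
  have "P / 2 \<le> c" unfolding c_def using fin by (intro Max_ge) auto
  have le_c: "absv (?g m) \<le> c" if "m \<noteq> n" for m
  proof (cases "P / 2 \<le> absv (?g m)")
    case True then show ?thesis unfolding c_def using fin that by (intro Max_ge) auto
  qed (use \<open>P / 2 \<le> c\<close> in simp)
  have "(\<Sum>\<^sub>\<infinity>m. ?g m) = (\<Sum>\<^sub>\<infinity>m\<in>{n}. ?g m) + (\<Sum>\<^sub>\<infinity>m\<in>-{n}. ?g m)"
    using infsum_Un_disjoint[OF null_family_summable[OF null] null_family_summable[OF null], of "{n}" "-{n}"]
    by simp
  then have split: "cauchy_prod a b (n + n') = a n * b n' + (\<Sum>\<^sub>\<infinity>m\<in>-{n}. ?g m)"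
    by (simp add: cauchy_prod_def)
  have "absv (\<Sum>\<^sub>\<infinity>m\<in>-{n}. ?g m) \<le> c"
    using le_c \<open>P / 2 \<le> c\<close> P by (intro absv_infsum_le) auto
  have "cauchy_prod a b (n + n') \<noteq> 0"
  proof
    assume "cauchy_prod a b (n + n') = 0"
    then have "a n * b n' = - (\<Sum>\<^sub>\<infinity>m\<in>-{n}. ?g m)" using split by (simp add: eq_neg_iff_add_eq_0)
    then have "P \<le> c" using \<open>absv _ \<le> c\<close> unfolding P_def by simp
    with c show False by simp
  qed
  then show ?thesis by auto
qed

section \<open>Analytic and meromorphic functions on the punctured line\<close>

definition punctured_line_series :: "(rat \<Rightarrow> 'a::perfectoid_field) set" where
  "punctured_line_series =
     {a. (\<forall>n. a n \<noteq> 0 \<longrightarrow> n \<in> int_adjoin_inverse (residue_char TYPE('a))) \<and> (\<forall>s>0. null_at s a)}"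

lemma null_at_const: "null_at s (const_series c)"
  unfolding null_at_iff
proof (intro allI impI)
  fix e :: real assume "e > 0"
  then have "{n. e \<le> absv (const_series c n) * s powr of_rat n} \<subseteq> {0}"
    by (auto simp: const_series_def)
  then show "finite {n. e \<le> absv (const_series c n) * s powr of_rat n}"
    using finite_subset by blast
qed

lemma null_at_add:
  assumes "null_at s a" "null_at s b"
  shows "null_at s (\<lambda>n. a n + b n)"
  unfolding null_at_iff
proof (intro allI impI)
  fix e :: real assume "e > 0"
  have "{n. e \<le> absv (a n + b n) * s powr of_rat n} \<subseteq>
        {n. e \<le> absv (a n) * s powr of_rat n} \<union> {n. e \<le> absv (b n) * s powr of_rat n}"
  proof safe
    fix n assume "e \<le> absv (a n + b n) * s powr of_rat n"
      and "\<not> e \<le> absv (b n) * s powr of_rat n"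
    moreover have "absv (a n + b n) * s powr of_rat n
        \<le> max (absv (a n)) (absv (b n)) * s powr of_rat n"
      by (intro mult_right_mono absv_add_le) auto
    ultimately show "e \<le> absv (a n) * s powr of_rat n"
      by (auto simp: max_def split: if_splits)
  qed
  then show "finite {n. e \<le> absv (a n + b n) * s powr of_rat n}"
    using assms \<open>e > 0\<close> by (auto simp: null_at_iff intro: finite_subset)
qed

lemma null_at_uminus: "null_at s a \<Longrightarrow> null_at s (\<lambda>n. - a n)"
  by (simp add: null_at_def)

lemma cauchy_prod_support:
  assumes "p > 0" "\<And>n. a n \<noteq> 0 \<Longrightarrow> n \<in> int_adjoin_inverse p"
    "\<And>n. b n \<noteq> 0 \<Longrightarrow> n \<in> int_adjoin_inverse p" "cauchy_prod a b n \<noteq> 0"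
  shows "n \<in> int_adjoin_inverse p"
proof (rule ccontr)
  assume n: "n \<notin> int_adjoin_inverse p"
  have "a m * b (n - m) = 0" for m
    using n assms int_adjoin_inverse_closed(2)[OF assms(1), of m "n - m"] by force
  then have "cauchy_prod a b n = 0" unfolding cauchy_prod_def by (intro infsum_0) blast
  with assms show False by simp
qed

lemma pls_null_at: "a \<in> punctured_line_series \<Longrightarrow> s > 0 \<Longrightarrow> null_at s a"
  by (simp add: punctured_line_series_def)

lemma pls_const: "const_series c \<in> punctured_line_series"
  using int_adjoin_inverse_closed(1)[OF residue_char_pos[where 'a='a]]
  by (simp add: punctured_line_series_def null_at_const) (simp add: const_series_def)

lemma pls_add:
  assumes "a \<in> punctured_line_series" "b \<in> punctured_line_series"
  shows "(\<lambda>n. a n + b n) \<in> punctured_line_series"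
  unfolding punctured_line_series_def
proof (intro CollectI conjI allI impI)
  fix n assume "a n + b n \<noteq> 0"
  then have "a n \<noteq> 0 \<or> b n \<noteq> 0" by auto
  then show "n \<in> int_adjoin_inverse (residue_char TYPE('a))"
    using assms unfolding punctured_line_series_def by blast
qed (use assms in \<open>auto intro: null_at_add pls_null_at\<close>)

lemma pls_uminus: "a \<in> punctured_line_series \<Longrightarrow> (\<lambda>n. - a n) \<in> punctured_line_series"
  by (simp add: punctured_line_series_def null_at_uminus)

lemma pls_diff:
  assumes "a \<in> punctured_line_series" "b \<in> punctured_line_series"
  shows "(\<lambda>n. a n - b n) \<in> punctured_line_series"
  using pls_add[OF assms(1) pls_uminus[OF assms(2)]] by simp

lemma pls_mult:
  assumes "a \<in> punctured_line_series" "b \<in> punctured_line_series"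
  shows "cauchy_prod a b \<in> punctured_line_series"
  unfolding punctured_line_series_def
proof (intro CollectI conjI allI impI)
  fix n assume "cauchy_prod a b n \<noteq> 0"
  then show "n \<in> int_adjoin_inverse (residue_char TYPE('a))"
    using assms cauchy_prod_support[OF residue_char_pos[where 'a='a], of a b n]
    by (simp add: punctured_line_series_def)
qed (use assms in \<open>auto intro: null_at_cauchy_prod pls_null_at\<close>)

typedef (overloaded) 'a analytic = "punctured_line_series :: (rat \<Rightarrow> 'a::perfectoid_field) set"
  morphisms coef Abs_analytic
  using pls_const by blast

setup_lifting type_definition_analytic

instantiation analytic :: (perfectoid_field) comm_ring_1
begin

lift_definition zero_analytic :: "'a analytic" is "const_series 0" by (rule pls_const)
lift_definition one_analytic :: "'a analytic" is "const_series 1" by (rule pls_const)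
lift_definition plus_analytic :: "'a analytic \<Rightarrow> 'a analytic \<Rightarrow> 'a analytic"
  is "\<lambda>a b n. a n + b n" by (rule pls_add)
lift_definition uminus_analytic :: "'a analytic \<Rightarrow> 'a analytic" is "\<lambda>a n. - a n"
  by (rule pls_uminus)
lift_definition minus_analytic :: "'a analytic \<Rightarrow> 'a analytic \<Rightarrow> 'a analytic"
  is "\<lambda>a b n. a n - b n" by (rule pls_diff)
lift_definition times_analytic :: "'a analytic \<Rightarrow> 'a analytic \<Rightarrow> 'a analytic"
  is cauchy_prod by (rule pls_mult)

instance
proof
  fix a b c :: "'a analytic"
  show "a * b * c = a * (b * c)"
    by transfer (rule ext, rule cauchy_prod_assoc[of 1], simp_all add: pls_null_at)
  show "a * b = b * a"
    by transfer (rule cauchy_prod_commute)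
  show "1 * a = a"
    by transfer (simp add: cauchy_prod_const)
  show "a + b + c = a + (b + c)" by transfer (simp add: add.assoc)
  show "a + b = b + a" by transfer (simp add: add.commute)
  show "0 + a = a" by transfer (simp add: const_series_def)
  show "- a + a = 0" by transfer (simp add: const_series_def)
  show "a - b = a + - b" by transfer simp
  show "(a + b) * c = a * c + b * c"
    by transfer (rule ext, rule cauchy_prod_add[of 1], simp_all add: pls_null_at)
  show "(0::'a analytic) \<noteq> 1"
    by transfer (simp add: const_series_def fun_eq_iff exI[of _ 0])
qed

end

instance analytic :: (perfectoid_field) idom
proof
  fix a b :: "'a analytic"
  assume "a \<noteq> 0" "b \<noteq> 0"
  then show "a * b \<noteq> 0"
  proof transfer
    fix a b :: "rat \<Rightarrow> 'a"
    assume "a \<in> punctured_line_series" "b \<in> punctured_line_series"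
      "a \<noteq> const_series 0" "b \<noteq> const_series 0"
    moreover have "const_series 0 = (\<lambda>_. 0 :: 'a)" by (auto simp: const_series_def)
    ultimately show "cauchy_prod a b \<noteq> const_series 0"
      using cauchy_prod_nonzero[of a b] by (simp add: pls_null_at)
  qed
qed

lift_definition const :: "'a::perfectoid_field \<Rightarrow> 'a analytic" is const_series
  by (rule pls_const)

type_synonym 'a merom = "'a analytic fract"

definition scale_merom :: "'a::perfectoid_field \<Rightarrow> 'a merom \<Rightarrow> 'a merom" where
  "scale_merom c f = Fract (const c) 1 * f"

lemma const_add: "const (a + b) = const a + const b"
  by transfer (simp add: const_series_def fun_eq_iff)

lemma const_mult: "const (a * b) = const a * const b"
  by transfer (simp only: cauchy_prod_const, simp add: const_series_def fun_eq_iff)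

lemma const_1: "const 1 = 1"
  by transfer (rule refl)

lemma Fract_const_hom:
  "Fract (const (a + b)) 1 = Fract (const a) 1 + Fract (const b) 1"
  "Fract (const (a * b)) 1 = Fract (const a) 1 * Fract (const b) 1"
  "Fract (const 1) 1 = 1"
  by (simp_all add: const_add const_mult const_1 One_fract_def)

interpretation merom: vector_space "scale_merom :: 'a::perfectoid_field \<Rightarrow> _"
proof
  fix a b :: 'a and x y :: "'a merom"
  show "scale_merom a (x + y) = scale_merom a x + scale_merom a y"
    unfolding scale_merom_def by (rule distrib_left)
  show "scale_merom (a + b) x = scale_merom a x + scale_merom b x"
    unfolding scale_merom_def Fract_const_hom by (rule distrib_right)
  show "scale_merom a (scale_merom b x) = scale_merom (a * b) x"
    unfolding scale_merom_def Fract_const_hom by (rule mult.assoc[symmetric])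
  show "scale_merom 1 x = x"
    unfolding scale_merom_def Fract_const_hom by (rule mult_1)
qed

definition analytic_level :: "nat \<Rightarrow> 'a::perfectoid_field analytic set" where
  "analytic_level i = {f. \<forall>n. coef f n \<noteq> 0 \<longrightarrow> n \<in> exponents_level (residue_char TYPE('a)) i}"

text \<open>The substitution \<open>X\<^sup>n \<mapsto> c\<^sup>k X\<^sup>n\<close>, where \<open>n = k / p\<^sup>i\<close>, i.e.\ \<open>f \<mapsto> f (c ^ (p ^ i) X)\<close>
  on series with exponents in \<open>p\<^sup>-\<^sup>i \<int>\<close>; all other terms are dropped. The value at
  a fractional power of \<open>X\<close> needs a choice of root, which is why \<open>c\<close> and not its power is the
  argument.\<close>

lift_definition dilate :: "nat \<Rightarrow> 'a::perfectoid_field \<Rightarrow> 'a analytic \<Rightarrow> 'a analytic"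
  is "\<lambda>i c a n. if n \<in> exponents_level (residue_char TYPE('a)) i \<and> c \<noteq> 0
                then c powi \<lfloor>n * of_nat (residue_char TYPE('a) ^ i)\<rfloor> * a n else 0"
  subgoal premises prems for i c a
    unfolding punctured_line_series_def
  proof (intro CollectI conjI allI impI)
    let ?p = "residue_char TYPE('a)"
    fix n assume "(if n \<in> exponents_level ?p i \<and> c \<noteq> 0
                then c powi \<lfloor>n * of_nat (?p ^ i)\<rfloor> * a n else 0) \<noteq> 0"
    then show "n \<in> int_adjoin_inverse ?p"
      using prems by (auto simp: punctured_line_series_def split: if_splits)
  next
    let ?p = "residue_char TYPE('a)"
    let ?b = "\<lambda>n. if n \<in> exponents_level ?p i \<and> c \<noteq> 0
                then c powi \<lfloor>n * of_nat (?p ^ i)\<rfloor> * a n else 0"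
    fix s :: real assume s: "s > 0"
    show "null_at s ?b"
    proof (cases "c = 0")
      case False
      then have c: "absv c > 0" using absv_ge_0[of c] absv_eq_0[of c] by linarith
      define t where "t = s * absv c powr real (?p ^ i)"
      have t: "t > 0" using s c unfolding t_def
        by (intro mult_pos_pos) (auto simp del: of_nat_power)
      have eq: "absv (?b n) * s powr of_rat n \<le> absv (a n) * t powr of_rat n" for n
      proof (cases "n \<in> exponents_level ?p i")
        case True
        then obtain k where k: "n = of_int k / of_nat (?p ^ i)" by (auto simp: exponents_level_def)
        have p0: "of_nat (?p ^ i) \<noteq> (0::rat)" "real (?p ^ i) \<noteq> 0"
          using residue_char_pos[where 'a='a] by auto
        have nk: "n * of_nat (?p ^ i) = of_int k" using p0 k by simp
        have rk: "real (?p ^ i) * of_rat n = of_int k"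
          using p0 by (simp add: k of_rat_divide of_rat_power del: of_nat_power)
        have "t powr of_rat n = s powr of_rat n * absv c powr (real (?p ^ i) * of_rat n)"
          using s c by (simp add: t_def powr_mult powr_powr del: of_nat_power)
        also have "\<dots> = s powr of_rat n * absv c powi k"
          using powr_real_of_int'[of "absv c" k] c unfolding rk by force
        finally have "absv (a n) * t powr of_rat n = absv (c powi k * a n) * s powr of_rat n"
          by (simp add: absv_mult absv_power_int)
        then show ?thesis using True False nk by (simp del: of_nat_power)
      qed auto
      have "finite {n. e \<le> absv (?b n) * s powr of_rat n}" if "e > 0" for e
      proof (rule finite_subset)
        show "{n. e \<le> absv (?b n) * s powr of_rat n} \<subseteq> {n. e \<le> absv (a n) * t powr of_rat n}"
          using eq order_trans by blast
        show "finite {n. e \<le> absv (a n) * t powr of_rat n}"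
          using pls_null_at[OF prems t] that by (simp add: null_at_iff)
      qed
      then show ?thesis by (simp add: null_at_iff)
    next
      case True
      then have "?b = const_series 0" by (auto simp: const_series_def)
      then show ?thesis by (simp only: null_at_const)
    qed
  qed
  done

text \<open>\<open>f (q\<^sup>-\<^sup>1 X) = f X\<close> for a quotient \<open>f\<close> of series with exponents in \<open>p\<^sup>-\<^sup>i \<int>\<close>, where \<open>Q\<close> is
  the chosen \<open>p\<^sup>i\<close>-th root of \<open>q\<close>.\<close>

definition periodic_merom :: "nat \<Rightarrow> 'a::perfectoid_field \<Rightarrow> 'a merom set" where
  "periodic_merom i Q = {f. \<exists>g\<in>analytic_level i. \<exists>h\<in>analytic_level i. h \<noteq> 0 \<and>
      f = Fract g h \<and> Fract (dilate i (inverse Q) g) (dilate i (inverse Q) h) = f}"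

section \<open>Algebraic elements\<close>

text \<open>As the base field is complete, this determines \<open>w\<close> uniquely.\<close>

definition extends_absv :: "('a::perfectoid_field alg_closure \<Rightarrow> real) \<Rightarrow> bool" where
  "extends_absv w \<longleftrightarrow> (\<forall>x. 0 \<le> w x) \<and> (\<forall>x. w x = 0 \<longleftrightarrow> x = 0) \<and>
     (\<forall>x y. w (x * y) = w x * w y) \<and> (\<forall>x y. w (x + y) \<le> max (w x) (w y)) \<and>
     (\<forall>c. w (to_ac c) = absv c)"

definition min_poly :: "'a::field alg_closure \<Rightarrow> 'a poly" where
  "min_poly \<alpha> = (THE P. Polynomial.lead_coeff P = 1 \<and> Factorial_Ring.irreducible P \<and>
                      poly (map_poly to_ac P) \<alpha> = 0)"

definition conj_class :: "'a::field alg_closure \<Rightarrow> 'a alg_closure set" where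
  "conj_class \<alpha> = {\<beta>. min_poly \<beta> = min_poly \<alpha>}"

definition adjoin :: "'a::field alg_closure \<Rightarrow> 'a alg_closure set" where
  "adjoin \<alpha> = {poly (map_poly to_ac g) \<alpha> / poly (map_poly to_ac h) \<alpha> | g h. True}"

interpretation ac: vector_space "\<lambda>(c::'a::field) x. to_ac c * x"
proof
  fix a b :: 'a and x y :: "'a alg_closure"
  show "to_ac a * (x + y) = to_ac a * x + to_ac a * y" by (rule distrib_left)
  show "to_ac (a + b) * x = to_ac a * x + to_ac b * x" unfolding to_ac_add by (rule distrib_right)
  show "to_ac a * (to_ac b * x) = to_ac (a * b) * x" unfolding to_ac_mult by (rule mult.assoc[symmetric])
  show "to_ac 1 * x = x" unfolding to_ac_1 by (rule mult_1)
qed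

definition ext_degree :: "'a::field alg_closure \<Rightarrow> nat" where
  "ext_degree \<alpha> = vector_space.dim (\<lambda>c x. to_ac c * x) (adjoin \<alpha>)"

section \<open>Multiplicities\<close>

text \<open>\<open>poly_series j G\<close> is the series of \<open>G (X\<^sup>1\<^sup>/\<^sup>N)\<close> with \<open>N = p\<^sup>j\<close>.\<close>

definition poly_series :: "nat \<Rightarrow> 'a::perfectoid_field poly \<Rightarrow> rat \<Rightarrow> 'a" where
  "poly_series j G n =
     (if n \<in> exponents_level (residue_char TYPE('a)) j \<and> 0 \<le> n
      then Polynomial.coeff G (nat \<lfloor>n * of_nat (residue_char TYPE('a) ^ j)\<rfloor>) else 0)"

text \<open>\<open>G (X\<^sup>1\<^sup>/\<^sup>N)\<close> is a polynomial part of \<open>g\<close> on \<open>r \<le> |X| \<le> r'\<close>: the two differ by a unit of the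
  ring of series that converge there. This leaves factors of \<open>G\<close> without zeros in the annulus
  free, and these do not influence the multiplicities at points of the annulus.\<close>

definition weierstrass_part ::
    "real \<Rightarrow> real \<Rightarrow> 'a::perfectoid_field analytic \<Rightarrow> nat \<Rightarrow> 'a poly \<Rightarrow> bool" where
  "weierstrass_part r r' g j G \<longleftrightarrow> G \<noteq> 0 \<and>
     (\<exists>u\<in>annulus_series r r'. \<exists>v\<in>annulus_series r r'.
        cauchy_prod u v = const_series 1 \<and> coef g = cauchy_prod (poly_series j G) u)"

text \<open>The multiplicity of \<open>P = min_poly \<alpha>\<close> in the rational function \<open>G / H\<close> of \<open>Y = X\<^sup>1\<^sup>/\<^sup>N\<close>,
  normalised so that it refers to \<open>P (X) = P (Y\<^sup>N)\<close>: it is \<open>k / N\<close> for the largest integer \<open>k\<close>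
  such that \<open>(G / H)\<^sup>N\<close> is \<open>P (X)\<^sup>k\<close> times a fraction whose denominator \<open>B\<close> is prime to \<open>P (X)\<close>.
  Taking \<open>N\<close>-th powers is what makes sense of fractional multiplicities. In characteristic
  \<open>p\<close>, \<open>P (X)\<close> is the \<open>N\<close>-th power of an irreducible polynomial \<open>R\<close> of \<open>Y\<close>, and \<open>k\<close> is the
  \<open>R\<close>-adic valuation of \<open>G / H\<close>. In characteristic \<open>0\<close>, \<open>P (X)\<close> is a square-free polynomial of
  \<open>Y\<close> if \<open>\<alpha> \<noteq> 0\<close>, and \<open>k / N\<close> is the least order of \<open>G / H\<close> at one of its roots, an integer.
  The value does not depend on the level \<open>j\<close> at which \<open>G\<close> and \<open>H\<close> are written down.\<close>

definition multiplicity_at ::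
    "'a::perfectoid_field alg_closure \<Rightarrow> nat \<Rightarrow> 'a poly \<Rightarrow> 'a poly \<Rightarrow> rat" where
  "multiplicity_at \<alpha> j G H =
     (let N = residue_char TYPE('a) ^ j;
          P = pcompose (min_poly \<alpha>) (Polynomial.monom 1 N)
      in of_int (GREATEST k::int. \<exists>A B. coprime B P \<and>
           G ^ N * B * P ^ nat (- k) = A * H ^ N * P ^ nat k) / of_nat N)"

definition ord_at ::
    "('a::perfectoid_field alg_closure \<Rightarrow> real) \<Rightarrow> 'a alg_closure \<Rightarrow> 'a merom \<Rightarrow> rat" where
  "ord_at w \<alpha> f = (THE m. \<exists>g h r r' j G H. g \<noteq> 0 \<and> h \<noteq> 0 \<and> f = Fract g h \<and>
      0 < r \<and> r \<le> w \<alpha> \<and> w \<alpha> \<le> r' \<and>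
      weierstrass_part r r' g j G \<and> weierstrass_part r r' h j H \<and> m = multiplicity_at \<alpha> j G H)"

section \<open>Divisors\<close>

text \<open>Values of \<open>d\<close> at \<open>0\<close> are irrelevant: a divisor lives on the nonzero algebraic elements.\<close>

definition divisor ::
    "('a::perfectoid_field alg_closure \<Rightarrow> real) \<Rightarrow> ('a alg_closure \<Rightarrow> rat) \<Rightarrow> bool" where
  "divisor w d \<longleftrightarrow>
     (\<forall>\<alpha>. \<alpha> \<noteq> 0 \<longrightarrow> d \<alpha> \<in> int_adjoin_inverse (residue_char TYPE('a))) \<and>
     (\<forall>r r'. 0 < r \<longrightarrow> finite {\<alpha>. r \<le> w \<alpha> \<and> w \<alpha> \<le> r' \<and> d \<alpha> \<noteq> 0}) \<and>
     (\<forall>\<alpha> \<beta>. \<alpha> \<noteq> 0 \<longrightarrow> \<beta> \<in> conj_class \<alpha> \<longrightarrow> d \<beta> = d \<alpha>)"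

definition periodic_divisor :: "'a::perfectoid_field \<Rightarrow> ('a alg_closure \<Rightarrow> rat) \<Rightarrow> bool" where
  "periodic_divisor q d \<longleftrightarrow> (\<forall>\<alpha>. \<alpha> \<noteq> 0 \<longrightarrow> d (to_ac q * \<alpha>) = d \<alpha>)"

text \<open>One summand \<open>[K(\<alpha>) : K] d \<alpha>\<close> for each conjugacy class; the classes with \<open>d \<alpha> = 0\<close> are
  left out to make the index set finite.\<close>

definition divisor_degree ::
    "('a::perfectoid_field alg_closure \<Rightarrow> real) \<Rightarrow> 'a \<Rightarrow> ('a alg_closure \<Rightarrow> rat) \<Rightarrow> rat" where
  "divisor_degree w q d =
     (\<Sum>C\<in>conj_class ` {\<alpha>. absv q < w \<alpha> \<and> w \<alpha> \<le> 1 \<and> d \<alpha> \<noteq> 0}.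
        let \<alpha> = (SOME \<alpha>. \<alpha> \<in> C) in of_nat (ext_degree \<alpha>) * d \<alpha>)"

text \<open>The functions are those with exponents in \<open>p\<^sup>-\<^sup>i \<int>\<close>. Without such a bound the space would be
  infinite-dimensional for divisors of positive degree: in characteristic \<open>p\<close> the functions of
  exponent level \<open>j \<ge> i\<close> alone contribute dimension \<open>deg d * p\<^sup>j\<close>.\<close>

definition divisor_space ::
    "('a::perfectoid_field alg_closure \<Rightarrow> real) \<Rightarrow> nat \<Rightarrow> 'a \<Rightarrow> ('a alg_closure \<Rightarrow> rat) \<Rightarrow> 'a merom set"
  where "divisor_space w i Q d =
     {f \<in> periodic_merom i Q. f = 0 \<or> (\<forall>\<alpha>. \<alpha> \<noteq> 0 \<longrightarrow> - d \<alpha> \<le> ord_at w \<alpha> f)}"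

definition divisor_dim ::
    "('a::perfectoid_field alg_closure \<Rightarrow> real) \<Rightarrow> nat \<Rightarrow> 'a \<Rightarrow> ('a alg_closure \<Rightarrow> rat) \<Rightarrow> nat" where
  "divisor_dim w i Q d = vector_space.dim scale_merom (divisor_space w i Q d)"

end

theory Submission
  imports Defs
begin

text \<open>Put \<open>N = p\<^sup>i\<close> and \<open>Y = X\<^sup>1\<^sup>/\<^sup>N\<close>. The functions in question are meromorphic in \<open>Y\<close> and invariant under
  \<open>Y \<mapsto> Q Y\<close>, so they live on the Tate curve with parameter \<open>Q\<close>. The polynomial \<open>P (Y\<^sup>N)\<close> of a point with
  minimal polynomial \<open>P\<close> is squarefree in characteristic \<open>0\<close> and an \<open>N\<close>-th power in characteristic \<open>p\<close>,
  where the base field is perfect; in both cases the hypotheses on the divisor make its positive and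
  negative parts on a fundamental annulus the zeros of polynomials in \<open>Y\<close> whose degrees differ by
  \<open>n = N deg d\<close>. The products of the \<open>Q\<close>-dilates of these polynomials are theta functions \<open>\<theta>\<close> and \<open>\<theta>'\<close>,
  and multiplication by \<open>\<theta> / \<theta>'\<close> identifies the divisor space with the space of analytic functions \<open>g\<close>
  satisfying \<open>g (Y / Q) = \<kappa> Y\<^sup>n g (Y)\<close>. This equation is a recursion for the Laurent coefficients of \<open>g\<close>,
  in which \<open>n\<close> consecutive coefficients can be chosen freely.

  Zeros are controlled by Weierstrass preparation: on a closed annulus a series is a polynomial times a
  unit, and a unit has exactly one dominant term on each circle.\<close>

section \<open>Dominant terms\<close>

text \<open>Analytic functions are never evaluated at a point. Convergence is tested on circles, and
  a zero \<beta> in the \<open>Y\<close>-plane is a root of a polynomial factor that is valid on the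
  circle |X| = |\<beta>|^N. Its order is well defined because the minimal polynomial of a point on
  the circle is not invertible there. The obstacle is that \<open>ord_at\<close> belongs to a
  conjugacy class in the \<open>X\<close>-plane, whereas the zeros live in the
  \<open>Y\<close>-plane. It turns out to be the least difference of orders over all \<beta> with
  \<beta>^N conjugate to \<alpha>, divided by the inseparable degree of Y -> Y^N. A lower bound that
  is constant on classes is therefore the same as a bound at every single \<beta>, and such bounds
  amount to divisibility of analytic functions; no Galois action is involved. In characteristic 0
  the map Y -> Y^N is unramified away from 0, and the values of \<open>ord_at\<close> are integers.
  A fractional bound would act like a rounded one, and the degree would not determine the dimension;
  this is why the divisor is integral there.\<close>

notation cauchy_prod (infixl "\<star>" 70)

lemma absv_pos [simp]: "0 < absv (x::'a::nonarch_field) \<longleftrightarrow> x \<noteq> 0"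
  using absv_ge_0[of x] absv_eq_0[of x] by linarith

lemma absv_add_eq:
  fixes x y :: "'a::nonarch_field"
  assumes "absv y < absv x"
  shows "absv (x + y) = absv x"
  using absv_add_le[of x y] absv_diff_le[of "x + y" y] assms by simp

text \<open>Strictness survives the limit because only finitely many terms reach B/2, so all terms
  are bounded by the maximum of finitely many numbers below B.\<close>

lemma absv_infsum_less:
  fixes g :: "'b \<Rightarrow> 'a::nonarch_field"
  assumes null: "null_family g" and less: "\<And>m. m \<in> A \<Longrightarrow> absv (g m) < B" and B: "0 < B"
  shows "absv (infsum g A) < B"
proof -
  define S where "S = {m \<in> A. B / 2 \<le> absv (g m)}"
  have S: "finite S"
    using null B unfolding null_family_iff S_def by (auto elim!: allE[of _ "B/2"] elim: rev_finite_subset)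
  define c where "c = Max (insert (B / 2) ((\<lambda>m. absv (g m)) ` S))"
  have "c < B" unfolding c_def using S B less by (subst Max_less_iff) (auto simp: S_def)
  have c: "B / 2 \<le> c" unfolding c_def using S by (intro Max_ge) auto
  have "absv (g m) \<le> c" if "m \<in> A" for m
  proof (cases "m \<in> S")
    case True then show ?thesis unfolding c_def using S by (intro Max_ge) auto
  next
    case False then show ?thesis using that c by (simp add: S_def)
  qed
  then have "absv (infsum g A) \<le> c" using c B by (intro absv_infsum_le) auto
  with \<open>c < B\<close> show ?thesis by simp
qed

lemma absv_infsum_dominant:
  fixes g :: "'b \<Rightarrow> 'a::{nonarch_field,complete_space}"
  assumes null: "null_family g" and less: "\<And>m. m \<noteq> n \<Longrightarrow> absv (g m) < absv (g n)" and "g n \<noteq> 0"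
  shows "absv (infsum g UNIV) = absv (g n)"
proof -
  have "infsum g ({n} \<union> -{n}) = infsum g {n} + infsum g (-{n})"
    by (rule infsum_Un_disjoint) (auto intro: null_family_summable null)
  moreover have "{n} \<union> -{n} = UNIV" by auto
  ultimately have "infsum g UNIV = g n + infsum g (-{n})" by simp
  moreover have "absv (infsum g (-{n})) < absv (g n)"
    using null less assms(3) by (intro absv_infsum_less) auto
  ultimately show ?thesis by (simp add: absv_add_eq)
qed

text \<open>The size of the term with exponent \<open>n\<close> on the circle |X| = s. All arguments
  of Newton polygon type are phrased through it.\<close>

definition wabs :: "real \<Rightarrow> (rat \<Rightarrow> 'a::nonarch_field) \<Rightarrow> rat \<Rightarrow> real" where
  "wabs s a n = absv (a n) * s powr of_rat n"

lemma wabs_nonneg [simp]: "0 \<le> wabs s a n"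
  by (simp add: wabs_def)

lemma wabs_pos_iff: "s > 0 \<Longrightarrow> 0 < wabs s a n \<longleftrightarrow> a n \<noteq> 0"
  by (simp add: wabs_def zero_less_mult_iff)

lemma null_at_wabs: "null_at s a \<longleftrightarrow> (\<forall>e>0. finite {n. e \<le> wabs s a n})"
  by (simp add: null_at_iff wabs_def)

lemma wabs_mult:
  assumes "s > 0"
  shows "absv (a m * b (n - m)) * s powr of_rat n = wabs s a m * wabs s b (n - m)"
  using assms by (simp add: wabs_def absv_mult of_rat_diff powr_diff)

lemma wabs_cauchy_prod_le:
  fixes a b :: "rat \<Rightarrow> 'a::nonarch_field"
  assumes s: "s > 0" and le: "\<And>m. wabs s a m * wabs s b (n - m) \<le> B" and "0 \<le> B"
  shows "wabs s (a \<star> b) n \<le> B"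
proof -
  have "absv ((a \<star> b) n) \<le> B / s powr of_rat n"
    unfolding cauchy_prod_def
  proof (rule absv_infsum_le)
    fix m
    show "absv (a m * b (n - m)) \<le> B / s powr of_rat n"
      using le[of m] wabs_mult[OF s, of a m b n] s by (simp add: field_simps)
  qed (use assms in simp)
  then show ?thesis using s by (simp add: wabs_def field_simps)
qed

lemma wabs_cauchy_prod_dominant:
  fixes a b :: "rat \<Rightarrow> 'a::{nonarch_field,complete_space}"
  assumes s: "s > 0" and a: "null_at s a" and b: "null_at s b"
    and "a n \<noteq> 0" "b k \<noteq> 0"
    and less: "\<And>m. m \<noteq> n \<Longrightarrow> wabs s a m * wabs s b (n + k - m) < wabs s a n * wabs s b k"
  shows "wabs s (a \<star> b) (n + k) = wabs s a n * wabs s b k"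
proof -
  have eq: "absv (a m * b (n + k - m)) = wabs s a m * wabs s b (n + k - m) / s powr of_rat (n + k)" for m
    using wabs_mult[OF s, of a m b "n + k"] s by (simp add: field_simps)
  have "absv (infsum (\<lambda>m. a m * b (n + k - m)) UNIV) = absv (a n * b (n + k - n))"
  proof (rule absv_infsum_dominant)
    show "null_family (\<lambda>m. a m * b (n + k - m))"
      by (rule null_at_cauchy_terms[OF s a b])
    fix m assume "m \<noteq> n"
    then show "absv (a m * b (n + k - m)) < absv (a n * b (n + k - n))"
      unfolding eq using less[of m] s by (intro divide_strict_right_mono) auto
  qed (use assms in simp)
  then have "absv ((a \<star> b) (n + k)) = wabs s a n * wabs s b k / s powr of_rat (n + k)"
    unfolding cauchy_prod_def eq by simp
  then show ?thesis using s by (simp add: wabs_def)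
qed

text \<open>\<open>first_term\<close> and \<open>last_term\<close> are the two ends of the side of
  the Newton polygon that belongs to the radius \<open>s\<close>; \<open>sole_term\<close> says that
  this side is a single vertex, so that there are no zeros on the circle.\<close>

definition last_term :: "real \<Rightarrow> (rat \<Rightarrow> 'a::nonarch_field) \<Rightarrow> rat \<Rightarrow> bool" where
  "last_term s a n \<longleftrightarrow> a n \<noteq> 0 \<and> (\<forall>m. wabs s a m \<le> wabs s a n) \<and> (\<forall>m>n. wabs s a m < wabs s a n)"

definition first_term :: "real \<Rightarrow> (rat \<Rightarrow> 'a::nonarch_field) \<Rightarrow> rat \<Rightarrow> bool" where
  "first_term s a n \<longleftrightarrow> a n \<noteq> 0 \<and> (\<forall>m. wabs s a m \<le> wabs s a n) \<and> (\<forall>m<n. wabs s a m < wabs s a n)"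

definition sole_term :: "real \<Rightarrow> (rat \<Rightarrow> 'a::nonarch_field) \<Rightarrow> rat \<Rightarrow> bool" where
  "sole_term s a n \<longleftrightarrow> a n \<noteq> 0 \<and> (\<forall>m. m \<noteq> n \<longrightarrow> wabs s a m < wabs s a n)"

lemma sole_term_imp: "sole_term s a n \<Longrightarrow> last_term s a n \<and> first_term s a n"
  unfolding sole_term_def last_term_def first_term_def by (metis less_le nless_le order_refl)

lemma sole_term_iff: "last_term s a n \<and> first_term s a n \<longleftrightarrow> sole_term s a n"
  using sole_term_imp unfolding sole_term_def last_term_def first_term_def
  by (metis linorder_neqE_linordered_idom)

text \<open>Convergence leaves only finitely many terms at least as large as the nonzero term
  \<open>k\<close>, so the maximal size is attained, and only finitely often.\<close>

lemma dominant_terms_finite: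
  assumes s: "s > 0" and a: "null_at s a" and "a k \<noteq> 0"
  obtains U where "finite U" "U \<noteq> {}"
    "\<And>n. n \<in> U \<longleftrightarrow> a n \<noteq> 0 \<and> (\<forall>m. wabs s a m \<le> wabs s a n)"
proof -
  define S where "S = {n. wabs s a k \<le> wabs s a n}"
  have S: "finite S" "k \<in> S" using a wabs_pos_iff[OF s, of a k] \<open>a k \<noteq> 0\<close> by (auto simp: S_def null_at_wabs)
  define M where "M = Max (wabs s a ` S)"
  have M: "wabs s a m \<le> M" for m
  proof (cases "m \<in> S")
    case True then show ?thesis unfolding M_def using S by simp
  next
    case False
    then have "wabs s a m \<le> wabs s a k" by (simp add: S_def)
    also have "\<dots> \<le> M" unfolding M_def using S by simp
    finally show ?thesis .
  qed
  have "M \<in> wabs s a ` S" unfolding M_def using S by (intro Max_in) auto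
  then obtain n0 where n0: "n0 \<in> S" "wabs s a n0 = M" by auto
  have "M > 0" using M[of k] wabs_pos_iff[OF s, of a k] \<open>a k \<noteq> 0\<close> by linarith
  show ?thesis
  proof (rule that[of "{n \<in> S. wabs s a n = M}"])
    fix n
    show "n \<in> {n \<in> S. wabs s a n = M} \<longleftrightarrow> a n \<noteq> 0 \<and> (\<forall>m. wabs s a m \<le> wabs s a n)"
      using M n0 \<open>M > 0\<close> wabs_pos_iff[OF s, of a n] unfolding S_def
      by (metis (mono_tags, lifting) mem_Collect_eq nle_le)
  qed (use S n0 in auto)
qed

lemma last_term_exists:
  assumes "s > 0" "null_at s a" "a k \<noteq> 0"
  obtains n where "last_term s a n"
proof -
  obtain U where U: "finite U" "U \<noteq> {}"
    "\<And>n. n \<in> U \<longleftrightarrow> a n \<noteq> 0 \<and> (\<forall>m. wabs s a m \<le> wabs s a n)"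
    using dominant_terms_finite[OF assms] by metis
  have M: "Max U \<in> U" using U(1,2) by (rule Max_in)
  have "wabs s a m < wabs s a (Max U)" if "m > Max U" for m
  proof (rule ccontr)
    assume "\<not> ?thesis"
    then have eq: "wabs s a m = wabs s a (Max U)" using M U(3) by (metis less_le)
    moreover have "a m \<noteq> 0"
      using eq wabs_pos_iff[OF assms(1), of a] M U(3) by metis
    ultimately have "m \<in> U" using M U(3) by metis
    then show False using that U(1) by (meson Max_ge leD)
  qed
  then have "last_term s a (Max U)" using M U(3) by (simp add: last_term_def)
  then show ?thesis by (rule that)
qed

lemma first_term_exists:
  assumes "s > 0" "null_at s a" "a k \<noteq> 0"
  obtains n where "first_term s a n"
proof -
  obtain U where U: "finite U" "U \<noteq> {}"
    "\<And>n. n \<in> U \<longleftrightarrow> a n \<noteq> 0 \<and> (\<forall>m. wabs s a m \<le> wabs s a n)"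
    using dominant_terms_finite[OF assms] by metis
  have M: "Min U \<in> U" using U(1,2) by (rule Min_in)
  have "wabs s a m < wabs s a (Min U)" if "m < Min U" for m
  proof (rule ccontr)
    assume "\<not> ?thesis"
    then have eq: "wabs s a m = wabs s a (Min U)" using M U(3) by (metis less_le)
    moreover have "a m \<noteq> 0"
      using eq wabs_pos_iff[OF assms(1), of a] M U(3) by metis
    ultimately have "m \<in> U" using M U(3) by metis
    then show False using that U(1) by (meson Min_le leD)
  qed
  then have "first_term s a (Min U)" using M U(3) by (simp add: first_term_def)
  then show ?thesis by (rule that)
qed

text \<open>Only one product of two terms of exponent \<open>n + k\<close> has maximal size: in any
  other splitting of \<open>n + k\<close> one of the exponents lies beyond \<open>n\<close> or
  \<open>k\<close>. It cannot be cancelled by the others.\<close>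

lemma last_term_mult:
  fixes a b :: "rat \<Rightarrow> 'a::{nonarch_field,complete_space}"
  assumes s: "s > 0" and a: "null_at s a" and b: "null_at s b"
    and n: "last_term s a n" and k: "last_term s b k"
  shows "(a \<star> b) (n + k) \<noteq> 0"
proof -
  have pos: "wabs s a n > 0" "wabs s b k > 0"
    using n k by (auto simp: last_term_def wabs_pos_iff s)
  have "wabs s (a \<star> b) (n + k) = wabs s a n * wabs s b k"
  proof (rule wabs_cauchy_prod_dominant[OF s a b])
    fix m assume "m \<noteq> n"
    then consider "m > n" | "n + k - m > k" by fastforce
    then show "wabs s a m * wabs s b (n + k - m) < wabs s a n * wabs s b k"
    proof cases
      case 1
      then have "wabs s a m < wabs s a n" "wabs s b (n + k - m) \<le> wabs s b k"
        using n k by (auto simp: last_term_def)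
      then show ?thesis using pos by (meson mult_le_less_imp_less mult_less_le_imp_less wabs_nonneg order_refl
            mult_left_mono mult_strict_right_mono order_le_less_trans)
    next
      case 2
      then have "wabs s a m \<le> wabs s a n" "wabs s b (n + k - m) < wabs s b k"
        using n k by (auto simp: last_term_def)
      then show ?thesis using pos by (meson mult_right_mono mult_strict_left_mono wabs_nonneg order_le_less_trans)
    qed
  qed (use n k in \<open>auto simp: last_term_def\<close>)
  then have "wabs s (a \<star> b) (n + k) > 0" using pos by simp
  then show ?thesis using s by (simp add: wabs_pos_iff)
qed

lemma first_term_mult:
  fixes a b :: "rat \<Rightarrow> 'a::{nonarch_field,complete_space}"
  assumes s: "s > 0" and a: "null_at s a" and b: "null_at s b"
    and n: "first_term s a n" and k: "first_term s b k"
  shows "(a \<star> b) (n + k) \<noteq> 0"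
proof -
  have pos: "wabs s a n > 0" "wabs s b k > 0"
    using n k by (auto simp: first_term_def wabs_pos_iff s)
  have "wabs s (a \<star> b) (n + k) = wabs s a n * wabs s b k"
  proof (rule wabs_cauchy_prod_dominant[OF s a b])
    fix m assume "m \<noteq> n"
    then consider "m < n" | "n + k - m < k" by fastforce
    then show "wabs s a m * wabs s b (n + k - m) < wabs s a n * wabs s b k"
    proof cases
      case 1
      then have "wabs s a m < wabs s a n" "wabs s b (n + k - m) \<le> wabs s b k"
        using n k by (auto simp: first_term_def)
      then show ?thesis using pos by (meson wabs_nonneg mult_left_mono mult_strict_right_mono order_le_less_trans)
    next
      case 2
      then have "wabs s a m \<le> wabs s a n" "wabs s b (n + k - m) < wabs s b k"
        using n k by (auto simp: first_term_def)
      then show ?thesis using pos by (meson mult_right_mono mult_strict_left_mono wabs_nonneg order_le_less_trans)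
    qed
  qed (use n k in \<open>auto simp: first_term_def\<close>)
  then have "wabs s (a \<star> b) (n + k) > 0" using pos by simp
  then show ?thesis using s by (simp add: wabs_pos_iff)
qed

lemma cauchy_prod_eq_0D:
  fixes a b :: "rat \<Rightarrow> 'a::{nonarch_field,complete_space}"
  assumes s: "s > 0" and a: "null_at s a" and b: "null_at s b" and "a \<star> b = (\<lambda>_. 0)"
  shows "a = (\<lambda>_. 0) \<or> b = (\<lambda>_. 0)"
proof (rule ccontr)
  assume "\<not> ?thesis"
  then obtain k l where "a k \<noteq> 0" "b l \<noteq> 0" by fast
  then obtain n m where "last_term s a n" "last_term s b m"
    using last_term_exists[OF s a] last_term_exists[OF s b] by metis
  from last_term_mult[OF s a b this] assms(4) show False by simp
qed

lemma cauchy_prod_0 [simp]: "(\<lambda>_. 0) \<star> a = (\<lambda>_. 0)" "a \<star> (\<lambda>_. 0) = (\<lambda>_. 0)"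
  by (auto simp: cauchy_prod_def)

text \<open>First exponents add under multiplication, and so do last exponents. The product 1 has
  only the exponent 0, so both sums vanish; as no first exponent exceeds the corresponding last one,
  they coincide.\<close>

lemma unit_sole_term:
  fixes u v :: "rat \<Rightarrow> 'a::{nonarch_field,complete_space}"
  assumes s: "s > 0" and u: "null_at s u" and v: "null_at s v" and uv: "u \<star> v = const_series 1"
  obtains n where "sole_term s u n"
proof -
  have "const_series 1 \<noteq> (\<lambda>_. 0 :: 'a)" by (auto simp: const_series_def fun_eq_iff)
  then have ne: "u \<noteq> (\<lambda>_. 0)" "v \<noteq> (\<lambda>_. 0)"
    using uv by (metis cauchy_prod_0)+
  then obtain k l where "u k \<noteq> 0" "v l \<noteq> 0" by fast
  then obtain n m n' m' where *: "last_term s u n" "last_term s v m" "first_term s u n'" "first_term s v m'"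
    using last_term_exists[OF s u] last_term_exists[OF s v]
      first_term_exists[OF s u] first_term_exists[OF s v] by metis
  have "n + m = 0" "n' + m' = 0"
    using last_term_mult[OF s u v *(1,2)] first_term_mult[OF s u v *(3,4)] uv
    by (auto simp: const_series_def split: if_splits)
  moreover have "n' \<le> n" "m' \<le> m"
    using * unfolding last_term_def first_term_def by (metis linorder_not_less)+
  ultimately have "n' = n" by linarith
  with * show ?thesis using that sole_term_iff by metis
qed

section \<open>The ring of series converging on a circle\<close>

lemma null_at_0 [simp]: "null_at s (\<lambda>_. 0)"
  by (simp add: null_at_iff)

lemma null_at_diff:
  "null_at s a \<Longrightarrow> null_at s b \<Longrightarrow> null_at s (\<lambda>n. a n - b n)"
  using null_at_add[of s a "\<lambda>n. - b n"] null_at_uminus[of s b] by simp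

lemma null_at_cong: "(\<And>n. wabs s b n \<le> C * wabs s a n) \<Longrightarrow> 0 < C \<Longrightarrow> null_at s a \<Longrightarrow> null_at s b"
  unfolding null_at_wabs
proof (intro allI impI)
  fix e :: real
  assume le: "\<And>n. wabs s b n \<le> C * wabs s a n" and C: "0 < C" and a: "\<forall>e>0. finite {n. e \<le> wabs s a n}" and e: "e > 0"
  have "{n. e \<le> wabs s b n} \<subseteq> {n. e / C \<le> wabs s a n}"
    using le C by (auto simp: divide_le_eq mult.commute intro: order_trans)
  then show "finite {n. e \<le> wabs s b n}" using a e C by (meson divide_pos_pos finite_subset)
qed

lemma null_at_cmult: "null_at s a \<Longrightarrow> null_at s (\<lambda>n. c * a n)"
  by (rule null_at_cong[of _ _ "absv c + 1" a])
    (auto simp: wabs_def absv_mult algebra_simps intro: add_pos_nonneg)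

lemma cauchy_prod_1 [simp]: "const_series 1 \<star> a = a" "a \<star> const_series 1 = a"
  using cauchy_prod_const[of 1 a] cauchy_prod_commute[of a "const_series 1"] by simp_all

lemma cauchy_prod_assoc':
  fixes a b c :: "rat \<Rightarrow> 'a::{nonarch_field,complete_space}"
  shows "s > 0 \<Longrightarrow> null_at s a \<Longrightarrow> null_at s b \<Longrightarrow> null_at s c \<Longrightarrow> a \<star> b \<star> c = a \<star> (b \<star> c)"
  by (rule ext) (rule cauchy_prod_assoc)

lemma cauchy_prod_left_commute:
  fixes a b c :: "rat \<Rightarrow> 'a::{nonarch_field,complete_space}"
  assumes "s > 0" "null_at s a" "null_at s b" "null_at s c"
  shows "a \<star> (b \<star> c) = b \<star> (a \<star> c)"
  using assms cauchy_prod_assoc'[of s a b c] cauchy_prod_assoc'[of s b a c] cauchy_prod_commute[of a b] by simp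

lemma cauchy_prod_distrib:
  fixes a b c :: "rat \<Rightarrow> 'a::{nonarch_field,complete_space}"
  assumes "s > 0" "null_at s a" "null_at s b" "null_at s c"
  shows "(\<lambda>n. a n + b n) \<star> c = (\<lambda>n. (a \<star> c) n + (b \<star> c) n)"
  by (rule ext) (rule cauchy_prod_add[OF assms])

lemma cauchy_prod_diff:
  fixes a b c :: "rat \<Rightarrow> 'a::{nonarch_field,complete_space}"
  assumes "s > 0" "null_at s a" "null_at s b" "null_at s c"
  shows "(\<lambda>n. a n - b n) \<star> c = (\<lambda>n. (a \<star> c) n - (b \<star> c) n)"
proof -
  have "(\<lambda>n. - b n) \<star> c = (\<lambda>n. - (b \<star> c) n)"
    by (auto simp: cauchy_prod_def infsum_uminus)
  then show ?thesis
    using cauchy_prod_distrib[of s a "\<lambda>n. - b n" c] assms by (simp add: null_at_uminus)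
qed

lemma cauchy_prod_cancel:
  fixes a b c :: "rat \<Rightarrow> 'a::{nonarch_field,complete_space}"
  assumes s: "s > 0" "null_at s a" "null_at s b" "null_at s c" and eq: "c \<star> a = c \<star> b" and "c \<noteq> (\<lambda>_. 0)"
  shows "a = b"
proof -
  have "(\<lambda>n. a n - b n) \<star> c = (\<lambda>_. 0)"
    using eq cauchy_prod_diff[OF s] by (simp add: cauchy_prod_commute[of _ c])
  then have "(\<lambda>n. a n - b n) = (\<lambda>_. 0)"
    using cauchy_prod_eq_0D[OF s(1) null_at_diff[OF s(2,3)] s(4)] assms by auto
  then show ?thesis by (metis (no_types) eq_iff_diff_eq_0 ext)
qed

definition mono_series :: "rat \<Rightarrow> 'a::zero \<Rightarrow> rat \<Rightarrow> 'a" where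
  "mono_series m c n = (if n = m then c else 0)"

lemma null_at_mono [simp]: "null_at s (mono_series m c)"
  unfolding null_at_iff
proof (intro allI impI)
  fix e :: real assume "e > 0"
  then have "{n. e \<le> absv (mono_series m c n) * s powr of_rat n} \<subseteq> {m}"
    by (auto simp: mono_series_def split: if_splits)
  then show "finite {n. e \<le> absv (mono_series m c n) * s powr of_rat n}"
    using finite_subset by blast
qed

lemma cauchy_prod_mono: "mono_series m c \<star> a = (\<lambda>n. c * a (n - m))"
proof
  fix n
  have "(mono_series m c \<star> a) n = (\<Sum>\<^sub>\<infinity>k\<in>{m}. mono_series m c k * a (n - k))"
    unfolding cauchy_prod_def by (rule infsum_cong_neutral) (auto simp: mono_series_def)
  then show "(mono_series m c \<star> a) n = c * a (n - m)" by (simp add: mono_series_def)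
qed

lemma mono_series_mult: "mono_series m c \<star> mono_series n d = mono_series (m + n) (c * d :: 'a::nonarch_field)"
  unfolding cauchy_prod_mono by (auto simp: mono_series_def fun_eq_iff)

lemma mono_series_0: "mono_series 0 c = const_series c"
  by (auto simp: mono_series_def const_series_def)

section \<open>Series of bounded exponent level\<close>

text \<open>The condition of \<open>analytic_level\<close> for bare series. It is also imposed on
  the units of an annulus, which need not converge on the whole punctured line.\<close>

definition lev :: "nat \<Rightarrow> (rat \<Rightarrow> 'a::perfectoid_field) \<Rightarrow> bool" where
  "lev i a \<longleftrightarrow> (\<forall>n. a n \<noteq> 0 \<longrightarrow> n \<in> exponents_level (residue_char TYPE('a)) i)"

lemma levD: "lev i a \<Longrightarrow> a n \<noteq> 0 \<Longrightarrow> n \<in> exponents_level (residue_char TYPE('a)) i"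
  for a :: "rat \<Rightarrow> 'a::perfectoid_field"
  by (simp add: lev_def)

lemma levI: "(\<And>n. n \<notin> exponents_level (residue_char TYPE('a)) i \<Longrightarrow> a n = 0) \<Longrightarrow> lev i a"
  for a :: "rat \<Rightarrow> 'a::perfectoid_field"
  by (auto simp: lev_def)

lemma lev_diff: "lev i a \<Longrightarrow> lev i b \<Longrightarrow> lev i (\<lambda>n. a n - b n)"
  unfolding lev_def by (metis diff_self)

lemma lev_cmult: "lev i a \<Longrightarrow> lev i (\<lambda>n. c * a n)"
  unfolding lev_def by auto

lemma lev_mult:
  assumes "lev i a" "lev i b"
  shows "lev i (a \<star> b)"
proof (rule levI)
  fix n assume n: "n \<notin> exponents_level (residue_char TYPE('a)) i"
  have "a m * b (n - m) = 0" for m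
    using n assms levD exponents_level_closed(2)[of m _ i "n - m"] by fastforce
  then show "(a \<star> b) n = 0" unfolding cauchy_prod_def by (intro infsum_0) blast
qed

lemma lev_mono: "m \<in> exponents_level (residue_char TYPE('a)) i \<Longrightarrow> lev i (mono_series m (c::'a::perfectoid_field))"
  by (auto simp: lev_def mono_series_def)

lemma lev_const: "lev i (const_series c)"
  by (auto simp: lev_def const_series_def exponents_level_closed(1))

lemma exponents_level_diff:
  "x \<in> exponents_level p i \<Longrightarrow> y \<in> exponents_level p i \<Longrightarrow> x - y \<in> exponents_level p i"
  using exponents_level_closed(2)[of x p i "- y"] exponents_level_closed(3)[of y p i] by simp

lemma finite_exponents_interval:
  assumes "p > 0"
  shows "finite {n \<in> exponents_level p i. x \<le> n \<and> n \<le> y}"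
proof (rule finite_subset)
  have N: "(of_nat (p ^ i) :: rat) > 0" using assms by simp
  show "{n \<in> exponents_level p i. x \<le> n \<and> n \<le> y} \<subseteq>
      (\<lambda>k. of_int k / of_nat (p ^ i)) ` {\<lfloor>x * of_nat (p ^ i)\<rfloor> .. \<lceil>y * of_nat (p ^ i)\<rceil>}"
  proof
    fix n assume n: "n \<in> {n \<in> exponents_level p i. x \<le> n \<and> n \<le> y}"
    then obtain k where k: "n = of_int k / of_nat (p ^ i)" by (auto simp: exponents_level_def)
    then have "x * of_nat (p ^ i) \<le> of_int k" "of_int k \<le> y * of_nat (p ^ i)"
      using n N by (auto simp: field_simps)
    then have "\<lfloor>x * of_nat (p ^ i)\<rfloor> \<le> k" "k \<le> \<lceil>y * of_nat (p ^ i)\<rceil>"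
      by linarith+
    then show "n \<in> (\<lambda>k. of_int k / of_nat (p ^ i)) ` {\<lfloor>x * of_nat (p ^ i)\<rfloor> .. \<lceil>y * of_nat (p ^ i)\<rceil>}"
      using k by auto
  qed
qed simp

text \<open>Strictly between two radii with bounded terms the sizes decay geometrically in |n| in
  both directions. This leaves a bounded range of exponents, which contains finitely many of level
  \<open>i\<close>.\<close>

lemma null_at_between:
  fixes a :: "rat \<Rightarrow> 'a::perfectoid_field"
  assumes R: "0 < R" "R < s" "s < R'" and a: "lev i a"
    and bd: "\<And>n. wabs R a n \<le> B" "\<And>n. wabs R' a n \<le> B"
  shows "null_at s a"
  unfolding null_at_wabs
proof (intro allI impI)
  fix e :: real assume e: "e > 0"
  have B: "B \<ge> 0" using bd(1)[of 0] wabs_nonneg[of R a 0] by linarith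
  define q where "q = max (R / s) (s / R')"
  have q: "0 < q" "q < 1" using R by (auto simp: q_def less_max_iff_disj)
  have le: "wabs s a n \<le> B * q powr \<bar>of_rat n\<bar>" for n
  proof (cases "0 \<le> n")
    case True
    have "wabs s a n = wabs R' a n * (s / R') powr of_rat n"
      using R by (simp add: wabs_def powr_divide)
    also have "\<dots> \<le> B * q powr of_rat n"
      using True R B bd by (intro mult_mono powr_mono2) (auto simp: q_def)
    finally show ?thesis using True by simp
  next
    case False
    have "wabs s a n = wabs R a n * (R / s) powr (- of_rat n)"
      using R by (simp add: wabs_def powr_divide powr_minus field_simps)
    also have "\<dots> \<le> B * q powr (- of_rat n)"
      using False R B bd by (intro mult_mono powr_mono2) (auto simp: q_def)
    finally show ?thesis using False by (simp add: of_rat_minus)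
  qed
  have "((\<lambda>x. B * q powr x) \<longlongrightarrow> B * 0) at_top"
    using q by (intro tendsto_intros) real_asymp
  then have "eventually (\<lambda>x. B * q powr x < e) at_top"
    using e by (simp add: order_tendsto_iff)
  then obtain x0 where x0: "\<And>x. x \<ge> x0 \<Longrightarrow> B * q powr x < e" by (auto simp: eventually_at_top_linorder)
  obtain r0 :: nat where r0: "of_nat r0 \<ge> x0" using real_arch_simple by blast
  have "{n. e \<le> wabs s a n} \<subseteq> {n \<in> exponents_level (residue_char TYPE('a)) i. - of_nat r0 \<le> n \<and> n \<le> of_nat r0}"
  proof
    fix n assume n: "n \<in> {n. e \<le> wabs s a n}"
    then have "a n \<noteq> 0" using e by (auto simp: wabs_def)
    then have "n \<in> exponents_level (residue_char TYPE('a)) i" using a levD by blast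
    moreover have "\<bar>real_of_rat n\<bar> < of_nat r0"
      using n le[of n] x0[of "\<bar>of_rat n\<bar>"] r0 by force
    then have "real_of_rat \<bar>n\<bar> < real_of_rat (of_nat r0)" by simp
    then have "\<bar>n\<bar> < of_nat r0" unfolding of_rat_less .
    ultimately show "n \<in> {n \<in> exponents_level (residue_char TYPE('a)) i. - of_nat r0 \<le> n \<and> n \<le> of_nat r0}" by auto
  qed
  then show "finite {n. e \<le> wabs s a n}"
    using finite_exponents_interval[OF residue_char_pos[where 'a='a]] finite_subset by blast
qed

section \<open>Weierstrass preparation on an annulus\<close>

lemma wabs_mono_radius: "0 < R \<Longrightarrow> R \<le> R' \<Longrightarrow> 0 \<le> n \<Longrightarrow> wabs R a n \<le> wabs R' a n"
  unfolding wabs_def by (intro mult_left_mono powr_mono2) auto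

lemma wabs_antimono_radius: "0 < R \<Longrightarrow> R \<le> R' \<Longrightarrow> n \<le> 0 \<Longrightarrow> wabs R' a n \<le> wabs R a n"
  unfolding wabs_def by (intro mult_left_mono powr_mono2') auto

lemma wabs_add_le: "wabs s (\<lambda>n. a n + b n) n \<le> max (wabs s a n) (wabs s b n)"
proof -
  have "wabs s (\<lambda>n. a n + b n) n \<le> max (absv (a n)) (absv (b n)) * s powr of_rat n"
    unfolding wabs_def by (intro mult_right_mono absv_add_le) auto
  then show ?thesis by (auto simp: wabs_def max_def split: if_splits)
qed

lemma absv_divide: "absv (x / y) = absv x / absv (y::'a::nonarch_field)"
  by (simp add: divide_inverse absv_mult absv_inverse)

lemma wabs_uminus [simp]: "wabs s (\<lambda>n. - a n) n = wabs s a n"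
  by (simp add: wabs_def)

lemma wabs_diff_le: "wabs s (\<lambda>n. a n - b n) n \<le> max (wabs s a n) (wabs s b n)"
  using wabs_add_le[of s a "\<lambda>n. - b n" n] by simp

lemma wabs_shift: 
  assumes "s > 0" shows "wabs s (\<lambda>n. a (n + m)) n = wabs s a (n + m) / s powr of_rat m"
  using assms by (simp add: wabs_def of_rat_add powr_add)

text \<open>The multiplier \<open>q\<close> solves the linear system expressing that \<open>q a\<close> has no terms outside
  \<open>[0, M]\<close>. Weighted by \<open>R'\<close> for positive and by \<open>R\<close> for negative exponents, this system is
  strictly diagonally dominant, with diagonal entries \<open>a M\<close> and \<open>a 0\<close>.\<close>

lemma truncating_multiplier:
  fixes a :: "rat \<Rightarrow> 'a::perfectoid_field"
  assumes R: "0 < R" "R < R'" and a: "lev i a" and null: "\<And>s. R < s \<Longrightarrow> s < R' \<Longrightarrow> null_at s a"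
    and M: "M \<in> exponents_level (residue_char TYPE('a)) i" and nz: "a 0 \<noteq> 0" "a M \<noteq> 0"
    and th: "0 \<le> \<theta>" "\<theta> < 1"
    and d0: "\<And>n. n \<noteq> 0 \<Longrightarrow> wabs R a n \<le> \<theta> * wabs R a 0"
    and dM: "\<And>n. n \<noteq> M \<Longrightarrow> wabs R' a n \<le> \<theta> * wabs R' a M"
  obtains q where "lev i q" "\<And>s. R < s \<Longrightarrow> s < R' \<Longrightarrow> null_at s q" "q 0 = 1"
    "\<And>n. n \<noteq> 0 \<Longrightarrow> wabs R q n \<le> \<theta>" "\<And>n. n \<noteq> 0 \<Longrightarrow> wabs R' q n \<le> \<theta>"
    "\<And>k. k < 0 \<or> M < k \<Longrightarrow> (q \<star> a) k = 0"
proof -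
  define s where "s = (R + R') / 2"
  have s: "0 < s" "R < s" "s < R'" using R by (auto simp: s_def)
  have R': "R' > 0" using R by simp
  have as: "null_at s a" using null s by simp
  have pos: "wabs R a 0 > 0" "wabs R' a M > 0" using nz R by (auto simp: wabs_pos_iff)
  \<comment> \<open>The linear system for the multiplier: equation j > 0 asks for a zero coefficient
    at j + M, equation j < 0 for one at j. Dividing by \<open>a M\<close> and \<open>a 0\<close>
    makes the diagonal 1. There is no equation for j = 0, since the constant coefficient of the
    multiplier is fixed as 1.\<close>
  define D :: "(rat \<Rightarrow> 'a) \<Rightarrow> rat \<Rightarrow> 'a" where
    "D = (\<lambda>h j. if j > 0 then (h \<star> a) (j + M) / a M else if j < 0 then (h \<star> a) j / a 0 else 0)"
  define bd where "bd = (\<lambda>B (h :: rat \<Rightarrow> 'a). lev i h \<and> (\<forall>n. wabs R h n \<le> B \<and> wabs R' h n \<le> B))"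
  have bd_null: "null_at t h" if "bd B h" "R < t" "t < R'" for B h t
    using that R by (intro null_at_between[of R t R' i h B]) (auto simp: bd_def)
  have bd_pos: "B \<ge> 0" if "bd B h" for B h
    using that wabs_nonneg[of R h 0] unfolding bd_def by (metis order_trans)
  \<comment> \<open>Positive exponents weigh more at \<open>R'\<close> and negative ones at
    \<open>R\<close>, so one radius for each sign controls both.\<close>
  have bdI: "bd B h" if "lev i h" "0 \<le> B" "h 0 = 0"
    "\<And>n. n > 0 \<Longrightarrow> wabs R' h n \<le> B" "\<And>n. n < 0 \<Longrightarrow> wabs R h n \<le> B" for B h
    unfolding bd_def
  proof (intro conjI allI)
    fix n :: rat
    consider "n > 0" | "n < 0" | "n = 0" by linarith
    then have "wabs R h n \<le> B \<and> wabs R' h n \<le> B"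
    proof cases
      case 1
      then show ?thesis using that(4)[of n] wabs_mono_radius[of R R' n h] R by auto
    next
      case 2
      then show ?thesis using that(5)[of n] wabs_antimono_radius[of R R' n h] R by auto
    qed (use that in \<open>simp add: wabs_def\<close>)
    then show "wabs R h n \<le> B" "wabs R' h n \<le> B" by auto
  qed (use that in auto)
  have bd_diff: "bd B (\<lambda>n. g n - h n)" if "bd B g" "bd B h" for B g h
    unfolding bd_def
  proof (intro conjI allI)
    fix n
    show "wabs R (\<lambda>n. g n - h n) n \<le> B" "wabs R' (\<lambda>n. g n - h n) n \<le> B"
      using that wabs_diff_le[of R g h n] wabs_diff_le[of R' g h n] unfolding bd_def by - (meson max.boundedI order_trans)+
  qed (use that in \<open>auto simp: bd_def intro: lev_diff\<close>)
  have D_lev: "lev i (D h)" if "lev i h" for h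
  proof (rule levI)
    fix n assume n: "n \<notin> exponents_level (residue_char TYPE('a)) i"
    then have "n + M \<notin> exponents_level (residue_char TYPE('a)) i"
      using exponents_level_diff[of "n + M" _ i M] M by auto
    with n show "D h n = 0" using lev_mult[OF that a] unfolding D_def lev_def by auto
  qed
  have D_diff: "D (\<lambda>n. g n - h n) = (\<lambda>n. D g n - D h n)" if "null_at s g" "null_at s h" for g h
    using cauchy_prod_diff[OF s(1) that as] by (auto simp: D_def fun_eq_iff diff_divide_distrib)
  have D0: "D h 0 = 0" for h by (simp add: D_def)
  \<comment> \<open>Diagonal dominance: once its diagonal term is removed, the coefficient at n + K
    involves only coefficients of \<open>a\<close> other than \<open>a K\<close>, each smaller by
    the factor \<theta>. Hence 1 - D contracts.\<close>
  have contr: "bd (\<theta> * B) (\<lambda>n. h n - D h n)" if h: "bd B h" "h 0 = 0" for B h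
  proof (rule bdI)
    show "lev i (\<lambda>n. h n - D h n)" using h by (intro lev_diff D_lev) (auto simp: bd_def)
    show "0 \<le> \<theta> * B" using th bd_pos[OF h(1)] by simp
    show "h 0 - D h 0 = 0" using h by (simp add: D0)
    have hs: "null_at s h" using bd_null[OF h(1)] s by simp
    have est: "wabs r (\<lambda>n. h n - (h \<star> a) (n + K) / a K) n \<le> \<theta> * B"
      if r: "r = R \<or> r = R'" and K: "a K \<noteq> 0" "\<And>n. n \<noteq> K \<Longrightarrow> wabs r a n \<le> \<theta> * wabs r a K" for r K n
    proof -
      have r0: "r > 0" using r R by auto
      have wK: "wabs r a K > 0" using K r0 by (simp add: wabs_pos_iff)
      define h' where "h' = (\<lambda>m. h m - mono_series n (h n) m)"
      have "h' \<star> a = (\<lambda>m. (h \<star> a) m - (mono_series n (h n) \<star> a) m)"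
        unfolding h'_def by (rule cauchy_prod_diff[OF s(1) hs _ as]) simp
      then have "(h' \<star> a) (n + K) = (h \<star> a) (n + K) - h n * a K"
        by (simp add: cauchy_prod_mono)
      then have "(h \<star> a) (n + K) = (h' \<star> a) (n + K) + h n * a K" by simp
      then have eq: "h n - (h \<star> a) (n + K) / a K = - ((h' \<star> a) (n + K) / a K)"
        using K(1) by (simp add: add_divide_distrib)
      have "wabs r (h' \<star> a) (n + K) \<le> \<theta> * B * wabs r a K"
      proof (rule wabs_cauchy_prod_le[OF r0])
        fix m
        show "wabs r h' m * wabs r a (n + K - m) \<le> \<theta> * B * wabs r a K"
        proof (cases "m = n")
          case True
          then have "h' m = 0" by (simp add: h'_def mono_series_def)
          then show ?thesis using th bd_pos[OF h(1)] by (simp add: wabs_def)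
        next
          case False
          then have "wabs r h' m = wabs r h m" by (simp add: h'_def mono_series_def wabs_def)
          then have "wabs r h' m \<le> B" using h r by (auto simp: bd_def)
          then have "wabs r h' m * wabs r a (n + K - m) \<le> B * (\<theta> * wabs r a K)"
            using K(2)[of "n + K - m"] False bd_pos[OF h(1)] by (intro mult_mono) auto
          then show ?thesis by (simp add: mult_ac)
        qed
      qed (use th bd_pos[OF h(1)] in auto)
      moreover have "wabs r (\<lambda>n. h n - (h \<star> a) (n + K) / a K) n = wabs r (h' \<star> a) (n + K) / wabs r a K"
        using r0 by (simp add: wabs_def eq absv_divide of_rat_add powr_add)
      ultimately show ?thesis using wK by (simp add: pos_divide_le_eq)
    qed
    show "wabs R' (\<lambda>n. h n - D h n) n \<le> \<theta> * B" if "n > 0" for n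
      using est[of R' M n] that nz dM by (simp add: D_def wabs_def)
    show "wabs R (\<lambda>n. h n - D h n) n \<le> \<theta> * B" if "n < 0" for n
      using est[of R 0 n] that nz d0 by (simp add: D_def wabs_def)
  qed
  \<comment> \<open>The Neumann series: e n = (1 - D)^n D 1, and \<open>q\<close> will be 1 minus
    the sum of all \<open>e n\<close>.\<close>
  define e where "e = rec_nat (D (const_series 1)) (\<lambda>_ h j. h j - D h j)"
  have e0: "e 0 = D (const_series 1)" and eSuc: "e (Suc n) = (\<lambda>j. e n j - D (e n) j)" for n
    by (simp_all add: e_def)
  have e: "bd (\<theta> ^ Suc n) (e n) \<and> e n 0 = 0" for n
  proof (induction n)
    case 0
    have "bd \<theta> (D (const_series 1))"
    proof (rule bdI)
      show "lev i (D (const_series 1))" by (intro D_lev lev_const)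
      fix n :: rat
      show "wabs R' (D (const_series 1)) n \<le> \<theta>" if "n > 0"
        using that dM[of "n + M"] nz R'
        by (simp add: D_def wabs_def absv_divide of_rat_add powr_add pos_divide_le_eq)
      show "wabs R (D (const_series 1)) n \<le> \<theta>" if "n < 0"
        using that d0[of n] nz R by (simp add: D_def wabs_def absv_divide pos_divide_le_eq)
    qed (use th D0 in auto)
    then show ?case by (simp add: e0 D0)
  next
    case (Suc n)
    then have "bd (\<theta> * \<theta> ^ Suc n) (\<lambda>j. e n j - D (e n) j)" by (intro contr) auto
    then show ?case using Suc by (simp only: eSuc power_Suc D0 diff_self)
  qed
  have e_null: "null_at s (e n)" for n using bd_null[OF conjunct1[OF e] s(2,3)] .
  have small: "\<exists>n. C * \<theta> ^ Suc n < x" if "x > 0" for C x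
  proof -
    have "(\<lambda>n. C * \<theta> ^ Suc n) \<longlonglongrightarrow> C * 0"
      using th by (intro tendsto_mult tendsto_const LIMSEQ_Suc LIMSEQ_realpow_zero) auto
    then have "eventually (\<lambda>n. C * \<theta> ^ Suc n < x) sequentially"
      using that by (simp add: order_tendsto_iff)
    then show ?thesis by (auto simp: eventually_sequentially)
  qed
  have nullf: "null_family (\<lambda>m. e m j)" for j
    unfolding null_family_iff
  proof (intro allI impI)
    fix x :: real assume "x > 0"
    then have "0 < x * R powr of_rat j" using R by simp
    from small[OF this, of 1] obtain n where n: "1 * \<theta> ^ Suc n < x * R powr of_rat j" ..
    have "m < n" if "x \<le> absv (e m j)" for m
    proof (rule ccontr)
      assume "\<not> m < n"
      have "x * R powr of_rat j \<le> wabs R (e m) j" using that R by (simp add: wabs_def)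
      also have "\<dots> \<le> \<theta> ^ Suc m" using e[of m] by (simp add: bd_def)
      also have "\<dots> \<le> \<theta> ^ Suc n" using \<open>\<not> m < n\<close> th by (intro power_decreasing) auto
      finally show False using n by simp
    qed
    then have "{m. x \<le> absv (e m j)} \<subseteq> {..<n}" by auto
    then show "finite {m. x \<le> absv (e m j)}" using finite_subset by blast
  qed
  define t where "t = (\<lambda>n j. \<Sum>\<^sub>\<infinity>m\<in>{n..}. e m j)"
  have t: "bd (\<theta> ^ Suc n) (t n) \<and> t n 0 = 0" for n
  proof -
    have "lev i (t n)"
    proof (rule levI)
      fix k assume "k \<notin> exponents_level (residue_char TYPE('a)) i"
      then have "e m k = 0" for m using e[of m] by (auto simp: bd_def lev_def)
      then show "t n k = 0" by (simp add: t_def)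
    qed
    moreover have "wabs r (t n) k \<le> \<theta> ^ Suc n" if r: "r = R \<or> r = R'" for r k
    proof -
      have r0: "r > 0" using r R by auto
      have "absv (t n k) \<le> \<theta> ^ Suc n / r powr of_rat k"
        unfolding t_def
      proof (rule absv_infsum_le)
        fix m assume "m \<in> {n..}"
        have "wabs r (e m) k \<le> \<theta> ^ Suc m" using e[of m] r by (auto simp: bd_def)
        also have "\<dots> \<le> \<theta> ^ Suc n" using \<open>m \<in> {n..}\<close> th by (intro power_decreasing) auto
        finally show "absv (e m k) \<le> \<theta> ^ Suc n / r powr of_rat k"
          using r0 by (simp add: wabs_def field_simps)
      qed (use th in auto)
      then show ?thesis using r0 by (simp add: wabs_def field_simps)
    qed
    moreover have "t n 0 = 0" using e by (simp add: t_def)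
    ultimately show ?thesis by (auto simp: bd_def)
  qed
  have t_Suc: "t n j = e n j + t (Suc n) j" for n j
  proof -
    have "infsum (\<lambda>m. e m j) ({n} \<union> {Suc n..}) = infsum (\<lambda>m. e m j) {n} + infsum (\<lambda>m. e m j) {Suc n..}"
      by (rule infsum_Un_disjoint) (auto intro: null_family_summable nullf)
    moreover have "{n} \<union> {Suc n..} = {n..}" by auto
    ultimately show ?thesis by (simp add: t_def)
  qed
  define q where "q = (\<lambda>j. const_series 1 j - t 0 j)"
  have q_null: "null_at u q" if "R < u" "u < R'" for u
    unfolding q_def using bd_null[OF conjunct1[OF t] that] by (intro null_at_diff null_at_const)
  \<comment> \<open>No exchange of \<open>D\<close> with the infinite sum is needed:
    \<open>D q\<close> equals the same remainder for every \<open>n\<close>, and the remainders tend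
    to 0.\<close>
  have Dq: "D q = (\<lambda>j. e n j - D (t n) j)" for n
  proof (induction n)
    case 0
    have ts: "null_at s (t 0)" using bd_null[OF conjunct1[OF t] s(2,3)] .
    show ?case using D_diff[OF null_at_const ts] by (simp add: e0 q_def)
  next
    case (Suc n)
    have ts: "null_at s (t m)" for m using bd_null[OF conjunct1[OF t] s(2,3)] .
    have "t n = (\<lambda>j. t (Suc n) j - (- e n j))" using t_Suc[of n] by auto
    then have "D (t n) = (\<lambda>j. D (t (Suc n)) j - D (\<lambda>j. - e n j) j)"
      using D_diff[OF ts null_at_uminus[OF e_null]] by metis
    moreover have "D (\<lambda>j. - e n j) = (\<lambda>j. - D (e n) j)"
      using D_diff[of "\<lambda>_. 0" "e n"] e_null by (simp add: D_def fun_eq_iff)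
    ultimately show ?case using Suc by (auto simp: eSuc fun_eq_iff)
  qed
  have "D q j = 0" for j
  proof (rule ccontr)
    assume "D q j \<noteq> 0"
    then have "0 < wabs R (D q) j" using R by (simp add: wabs_pos_iff)
    from small[OF this, of 1] obtain n where n: "1 * \<theta> ^ Suc n < wabs R (D q) j" ..
    let ?B = "\<theta> ^ Suc n"
    have "bd (\<theta> * ?B) (\<lambda>j. t n j - D (t n) j)" using contr[of ?B "t n"] t[of n] by (elim conjE)
    then have "bd ?B (\<lambda>j. t n j - D (t n) j)"
      using th mult_right_mono[of \<theta> 1 ?B] unfolding bd_def by (auto intro: order_trans)
    from bd_diff[OF conjunct1[OF t[of n]] this] have "bd ?B (D (t n))" by simp
    from bd_diff[OF conjunct1[OF e[of n]] this] have "bd ?B (D q)" using Dq[of n] by simp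
    then have "wabs R (D q) j \<le> ?B" by (simp add: bd_def)
    with n show False by simp
  qed
  note Dq0 = this
  show ?thesis
  proof (rule that[of q])
    show "lev i q" unfolding q_def using t[of 0] by (intro lev_diff lev_const) (auto simp: bd_def)
    show "q 0 = 1" using t[of 0] by (simp add: q_def const_series_def)
    show "wabs R q n \<le> \<theta>" "wabs R' q n \<le> \<theta>" if "n \<noteq> 0" for n
      using t[of 0] that by (auto simp: q_def const_series_def bd_def wabs_def)
    show "(q \<star> a) k = 0" if "k < 0 \<or> M < k" for k
      using Dq0[of "k - M"] Dq0[of k] that nz unfolding D_def
      by (cases "M < k") (auto split: if_splits)
  qed (rule q_null)
qed


text \<open>The truncating multiplier with M = 0 leaves only a constant term. This constant is
  nonzero because there are no zero divisors, and dividing by it turns the multiplier into an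
  inverse.\<close>

lemma near_one_unit:
  fixes q :: "rat \<Rightarrow> 'a::perfectoid_field"
  assumes R: "0 < R" "R < R'" and q: "lev i q" and null: "\<And>s. R < s \<Longrightarrow> s < R' \<Longrightarrow> null_at s q"
    and q0: "q 0 = 1" and th: "0 \<le> \<theta>" "\<theta> < 1"
    and le: "\<And>n. n \<noteq> 0 \<Longrightarrow> wabs R q n \<le> \<theta>" "\<And>n. n \<noteq> 0 \<Longrightarrow> wabs R' q n \<le> \<theta>"
  obtains v where "lev i v" "\<And>s. R < s \<Longrightarrow> s < R' \<Longrightarrow> null_at s v" "q \<star> v = const_series 1"
proof -
  have "wabs R q 0 = 1" "wabs R' q 0 = 1" using q0 R by (auto simp: wabs_def)
  then obtain v where v: "lev i v" "\<And>s. R < s \<Longrightarrow> s < R' \<Longrightarrow> null_at s v" "v 0 = 1"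
    "\<And>k. k < 0 \<or> 0 < k \<Longrightarrow> (v \<star> q) k = 0"
    using truncating_multiplier[OF R q null exponents_level_closed(1), of \<theta>] q0 th le
    by (smt (verit, ccfv_SIG) mult_cancel_left1 zero_neq_one)
  define c where "c = (v \<star> q) 0"
  have vq: "v \<star> q = const_series c"
    using v(4) by (auto simp: const_series_def c_def fun_eq_iff linorder_neq_iff)
  define s where "s = (R + R') / 2"
  have s: "0 < s" "R < s" "s < R'" using R by (auto simp: s_def)
  have "c \<noteq> 0"
  proof
    assume "c = 0"
    then have "v \<star> q = (\<lambda>_. 0)" using vq by (auto simp: const_series_def)
    from cauchy_prod_eq_0D[OF s(1) v(2) null this] s
    show False using v(3) q0 by (auto simp: fun_eq_iff)
  qed
  show ?thesis
  proof (rule that[of "\<lambda>n. inverse c * v n"])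
    have "(\<lambda>n. inverse c * v n) = const_series (inverse c) \<star> v" by (simp add: cauchy_prod_const)
    then have "q \<star> (\<lambda>n. inverse c * v n) = const_series (inverse c) \<star> (v \<star> q)"
      using cauchy_prod_left_commute[of s q "const_series (inverse c)" v] s null v(2)
      by (simp add: null_at_const cauchy_prod_commute[of q v])
    also have "\<dots> = const_series 1" using \<open>c \<noteq> 0\<close> by (simp add: vq cauchy_prod_const) (auto simp: const_series_def)
    finally show "q \<star> (\<lambda>n. inverse c * v n) = const_series 1" .
  qed (use v in \<open>auto intro: lev_cmult null_at_cmult\<close>)
qed

section \<open>Isolating a dominant term by moving the circle\<close>

lemma sole_term_beyond:
  fixes a :: "rat \<Rightarrow> 'a::nonarch_field"
  assumes r: "r > 0" and null: "\<And>s. s > 0 \<Longrightarrow> null_at s a" and M: "last_term r a M"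
  obtains R where "r < R" "sole_term R a M"
proof -
  have wM: "wabs r a M > 0" using M r by (simp add: last_term_def wabs_pos_iff)
  \<comment> \<open>A lower bound for the term \<open>M\<close> at all radii in [r, r + 1]. The set
    \<open>F\<close> below collects the exponents whose terms can reach it there; it is finite
    because a term at such a radius is at most the sum of its sizes at both ends.\<close>
  define c where "c = absv (a M) * min (r powr of_rat M) ((r + 1) powr of_rat M)"
  have c: "c > 0" using M r by (auto simp: c_def last_term_def min_def)
  have up: "wabs s a n \<le> wabs r a n + wabs (r + 1) a n" if "r \<le> s" "s \<le> r + 1" for s n
    using wabs_mono_radius[of s "r + 1" n a] wabs_antimono_radius[of r s n a] that r
    by (cases "n \<ge> 0") (auto intro: add_increasing add_increasing2)
  have low: "c \<le> wabs s a M" if "r \<le> s" "s \<le> r + 1" for s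
  proof -
    have "min (r powr of_rat M) ((r + 1) powr of_rat M) \<le> s powr of_rat M"
      using powr_mono2[of "of_rat M" r s] powr_mono2'[of "of_rat M" s "r + 1"] that r
      by (cases "M \<ge> 0") auto
    then show ?thesis unfolding c_def wabs_def by (intro mult_left_mono) auto
  qed
  define F where "F = {n. c \<le> wabs r a n + wabs (r + 1) a n}"
  have "F \<subseteq> {n. c / 2 \<le> wabs r a n} \<union> {n. c / 2 \<le> wabs (r + 1) a n}"
    by (auto simp: F_def)
  then have F: "finite F"
    using null[of r] null[of "r + 1"] r c unfolding null_at_wabs
    by (metis finite_UnI finite_subset half_gt_zero zero_less_one add_pos_pos)
  \<comment> \<open>Larger exponents are strictly smaller at \<open>r\<close> itself and stay so
    nearby by continuity; smaller exponents may tie at \<open>r\<close> but grow more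
    slowly.\<close>
  have ev: "\<forall>\<^sub>F s in at_right r. wabs s a n < wabs s a M" if "n \<noteq> M" for n
  proof (cases "n > M")
    case True
    have lim: "((\<lambda>s. wabs s a k) \<longlongrightarrow> wabs r a k) (at_right r)" for k
      unfolding wabs_def using r by (intro tendsto_intros) auto
    have "((\<lambda>s. wabs s a M - wabs s a n) \<longlongrightarrow> wabs r a M - wabs r a n) (at_right r)"
      by (intro tendsto_diff lim)
    moreover have "wabs r a M - wabs r a n > 0" using M True by (simp add: last_term_def)
    ultimately have "\<forall>\<^sub>F s in at_right r. 0 < wabs s a M - wabs s a n"
      by (rule order_tendstoD)
    then show ?thesis by simp
  next
    case False
    with that have "n < M" by simp
    have "\<forall>\<^sub>F s in at_right r. s > r" by (simp add: eventually_at_right_less)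
    then show ?thesis
    proof eventually_elim
      case (elim s)
      have eq: "wabs s a k = wabs r a k * (s / r) powr of_rat k" for k
        using r elim by (simp add: wabs_def powr_divide)
      have "wabs s a n \<le> wabs r a M * (s / r) powr of_rat n"
        unfolding eq[of n] using M by (intro mult_right_mono) (auto simp: last_term_def)
      also have "\<dots> < wabs r a M * (s / r) powr of_rat M"
        using wM \<open>n < M\<close> elim r by (intro mult_strict_left_mono powr_less_mono) (auto simp: of_rat_less)
      finally show ?case unfolding eq[of M] .
    qed
  qed
  have "\<forall>\<^sub>F s in at_right r. \<forall>n\<in>F - {M}. wabs s a n < wabs s a M"
    using F ev by (intro eventually_ball_finite) auto
  moreover have "\<forall>\<^sub>F s in at_right r. r < s \<and> s < r + 1"
    by (auto simp: eventually_at_right[of r "r + 1"] intro!: exI[of _ "r + 1"])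
  ultimately have "\<forall>\<^sub>F s in at_right r. r < s \<and> sole_term s a M"
  proof eventually_elim
    case (elim s)
    have "wabs s a n < wabs s a M" if "n \<noteq> M" for n
    proof (cases "n \<in> F")
      case True then show ?thesis using elim that by auto
    next
      case False
      then show ?thesis using up[of s n] low[of s] elim by (auto simp: F_def)
    qed
    then show ?case using elim M by (auto simp: sole_term_def last_term_def)
  qed
  then have "\<exists>s. r < s \<and> sole_term s a M"
    using eventually_happens'[OF trivial_limit_at_right_real] by blast
  then show ?thesis using that by blast
qed

text \<open>The substitution X -> 1/X. It exchanges first and last terms, so the inner circle is
  handled by the result for the outer one.\<close>

definition reflect :: "(rat \<Rightarrow> 'a) \<Rightarrow> rat \<Rightarrow> 'a" where
  "reflect a n = a (- n)"

lemma wabs_reflect: "s > 0 \<Longrightarrow> wabs s (reflect a) n = wabs (1 / s) a (- n)"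
  by (simp add: wabs_def reflect_def powr_divide of_rat_minus powr_minus field_simps)

lemma null_at_reflect:
  assumes "s > 0" "null_at (1 / s) a" shows "null_at s (reflect a)"
  unfolding null_at_wabs
proof (intro allI impI)
  fix e :: real assume "e > 0"
  then have "finite (uminus -` {n. e \<le> wabs (1 / s) a n})"
    using assms by (intro finite_vimageI) (auto simp: null_at_wabs)
  then show "finite {n. e \<le> wabs s (reflect a) n}"
    using assms by (simp add: wabs_reflect vimage_def)
qed

lemma sole_term_before:
  fixes a :: "rat \<Rightarrow> 'a::nonarch_field"
  assumes r: "r > 0" and null: "\<And>s. s > 0 \<Longrightarrow> null_at s a" and m: "first_term r a m"
  obtains R where "0 < R" "R < r" "sole_term R a m"
proof -
  have "last_term (1 / r) (reflect a) (- m)"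
    using m r unfolding last_term_def first_term_def
    by (auto simp: wabs_reflect) (auto simp: reflect_def)
  then obtain R where R: "1 / r < R" "sole_term R (reflect a) (- m)"
    using sole_term_beyond[of "1 / r" "reflect a" "- m"] r null by (metis null_at_reflect zero_less_divide_1_iff)
  have R0: "R > 0" using R(1) r by (meson less_trans zero_less_divide_1_iff)
  show ?thesis
  proof (rule that[of "1 / R"])
    show "0 < 1 / R" using R0 by simp
    show "1 / R < r" using R r R0 by (simp add: field_simps)
    show "sole_term (1 / R) a m"
      unfolding sole_term_def
    proof (intro conjI allI impI)
      show "a m \<noteq> 0" using m by (simp add: first_term_def)
      fix n assume "n \<noteq> m"
      then have "wabs R (reflect a) (- n) < wabs R (reflect a) (- m)"
        using R(2) by (simp add: sole_term_def)
      then show "wabs (1 / R) a n < wabs (1 / R) a m" using R0 by (simp add: wabs_reflect)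
    qed
  qed
qed

text \<open>The contraction argument needs a uniform factor below 1 and not merely strict
  inequalities; again only finitely many terms come close to the dominant one.\<close>

lemma sole_term_ratio:
  fixes a :: "rat \<Rightarrow> 'a::nonarch_field"
  assumes s: "s > 0" "null_at s a" and n: "sole_term s a n"
  obtains \<theta> where "0 \<le> \<theta>" "\<theta> < 1" "\<And>m. m \<noteq> n \<Longrightarrow> wabs s a m \<le> \<theta> * wabs s a n"
proof -
  have W: "wabs s a n > 0" using n s by (simp add: sole_term_def wabs_pos_iff)
  define S where "S = {m. wabs s a n / 2 \<le> wabs s a m} - {n}"
  have S: "finite S" using s W unfolding S_def null_at_wabs by (metis finite_Diff half_gt_zero)
  define \<theta> where "\<theta> = Max (insert (1/2) ((\<lambda>m. wabs s a m / wabs s a n) ` S))"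
  have 1: "1/2 \<le> \<theta>" unfolding \<theta>_def using S by (intro Max_ge) auto
  have 2: "\<theta> < 1" unfolding \<theta>_def using S n W by (subst Max_less_iff) (auto simp: S_def sole_term_def)
  have "wabs s a m \<le> \<theta> * wabs s a n" if "m \<noteq> n" for m
  proof (cases "m \<in> S")
    case True
    then have "wabs s a m / wabs s a n \<le> \<theta>" unfolding \<theta>_def using S by (intro Max_ge) auto
    then show ?thesis using W by (simp add: divide_le_eq)
  next
    case False
    then have "wabs s a m \<le> 1 / 2 * wabs s a n" using that by (simp add: S_def)
    also have "\<dots> \<le> \<theta> * wabs s a n" using 1 W by (intro mult_right_mono) auto
    finally show ?thesis .
  qed
  then show ?thesis using that[of \<theta>] 1 2 by simp
qed

text \<open>The annulus is enlarged to radii R < r and R' > r' at which its two end terms are alone.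
  This supplies the strict dominance, and the open annulus of convergence of the multiplier contains
  the closed one.\<close>

lemma weierstrass_multiplier:
  fixes a :: "rat \<Rightarrow> 'a::perfectoid_field"
  assumes a: "lev i a" and null: "\<And>s. s > 0 \<Longrightarrow> null_at s a" and r: "0 < r" "r \<le> r'"
    and m: "first_term r a m" and M: "last_term r' a M"
  obtains q v where "lev i q" "lev i v" "\<And>s. r \<le> s \<Longrightarrow> s \<le> r' \<Longrightarrow> null_at s q"
    "\<And>s. r \<le> s \<Longrightarrow> s \<le> r' \<Longrightarrow> null_at s v" "q \<star> v = const_series 1"
    "\<And>k. k < m \<or> M < k \<Longrightarrow> (q \<star> a) k = 0"
proof -
  obtain R where R: "0 < R" "R < r" "sole_term R a m"
    using sole_term_before[OF r(1) null m] by blast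
  obtain R' where R': "r' < R'" "sole_term R' a M"
    using sole_term_beyond[of r' a M] r null M by force
  have RR: "R < R'" "R' > 0" using R R' r by auto
  \<comment> \<open>A shift by \<open>m\<close> moves the first dominant term to exponent 0, where
    the multiplier expects it.\<close>
  define b where "b = (\<lambda>n. a (n + m))"
  have bm: "b = mono_series (- m) 1 \<star> a" by (simp add: cauchy_prod_mono b_def)
  have am: "a m \<noteq> 0" "a M \<noteq> 0" using m M by (auto simp: first_term_def last_term_def)
  then have mE: "m \<in> exponents_level (residue_char TYPE('a)) i" "M \<in> exponents_level (residue_char TYPE('a)) i"
    using a levD by blast+
  have lb: "lev i b" unfolding bm using a mE exponents_level_closed(3) by (intro lev_mult lev_mono) auto
  have nb: "null_at s b" if "s > 0" for s
    unfolding bm using that null by (intro null_at_cauchy_prod) auto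
  have wb: "wabs s b n = wabs s a (n + m) / s powr of_rat m" if "s > 0" for s n
    unfolding b_def by (rule wabs_shift[OF that])
  have sb: "sole_term R b 0"
    unfolding sole_term_def wb[OF R(1)] using R by (auto simp: b_def sole_term_def divide_strict_right_mono)
  have sb': "sole_term R' b (M - m)"
    unfolding sole_term_def wb[OF RR(2)] using R' RR by (auto simp: b_def sole_term_def divide_strict_right_mono)
  obtain t1 where t1: "0 \<le> t1" "t1 < 1" "\<And>n. n \<noteq> 0 \<Longrightarrow> wabs R b n \<le> t1 * wabs R b 0"
    using sole_term_ratio[OF R(1) nb sb] R by metis
  obtain t2 where t2: "0 \<le> t2" "t2 < 1" "\<And>n. n \<noteq> M - m \<Longrightarrow> wabs R' b n \<le> t2 * wabs R' b (M - m)"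
    using sole_term_ratio[OF RR(2) nb sb'] RR by metis
  define t where "t = max t1 t2"
  have t: "0 \<le> t" "t < 1" using t1 t2 by (auto simp: t_def)
  have t1': "wabs R b n \<le> t * wabs R b 0" if "n \<noteq> 0" for n
    using t1(3)[OF that] mult_right_mono[of t1 t "wabs R b 0"] by (simp add: t_def)
  have t2': "wabs R' b n \<le> t * wabs R' b (M - m)" if "n \<noteq> M - m" for n
    using t2(3)[OF that] mult_right_mono[of t2 t "wabs R' b (M - m)"] by (simp add: t_def)
  have b0: "b 0 \<noteq> 0" "b (M - m) \<noteq> 0" using am by (auto simp: b_def)
  have nb': "null_at s b" if "R < s" "s < R'" for s using nb R that by simp
  obtain q where q: "lev i q" "\<And>s. R < s \<Longrightarrow> s < R' \<Longrightarrow> null_at s q" "q 0 = 1"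
    "\<And>n. n \<noteq> 0 \<Longrightarrow> wabs R q n \<le> t" "\<And>n. n \<noteq> 0 \<Longrightarrow> wabs R' q n \<le> t"
    "\<And>k. k < 0 \<or> M - m < k \<Longrightarrow> (q \<star> b) k = 0"
    by (rule truncating_multiplier[OF R(1) RR(1) lb nb' exponents_level_diff[OF mE(2,1)] b0 t t1' t2']) (blast+)
  obtain v where v: "lev i v" "\<And>s. R < s \<Longrightarrow> s < R' \<Longrightarrow> null_at s v" "q \<star> v = const_series 1"
    using near_one_unit[OF R(1) RR(1) q(1,2,3) t q(4,5)] by blast
  have "q \<star> b = mono_series (- m) 1 \<star> (q \<star> a)"
    unfolding bm using q(2)[of r] R R' r null by (intro cauchy_prod_left_commute[of r]) auto
  then have qb: "(q \<star> b) k = (q \<star> a) (k + m)" for k by (simp add: cauchy_prod_mono)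
  show ?thesis
  proof (rule that[of q v])
    fix k assume "k < m \<or> M < k"
    then show "(q \<star> a) k = 0" using q(6)[of "k - m"] qb[of "k - m"] by auto
  qed (use q v R R' in auto)
qed

section \<open>Polynomials over a field and its algebraic closure\<close>

hide_const (open) Polynomials.degree Polynomials.lead_coeff Coset.order Divisibility.irreducible Divisibility.prime
  up_ring.coeff up_ring.monom Module.smult


abbreviation ac_poly :: "'a::field poly \<Rightarrow> 'a alg_closure poly" where
  "ac_poly \<equiv> map_poly to_ac"

lemma coeff_ac_poly [simp]: "coeff (ac_poly P) n = to_ac (coeff P n)"
  by (simp add: coeff_map_poly)

lemma degree_ac_poly [simp]: "degree (ac_poly P) = degree P"
  by (intro degree_map_poly) auto

lemma ac_poly_eq_0_iff [simp]: "ac_poly P = 0 \<longleftrightarrow> P = 0"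
  by (intro map_poly_eq_0_iff) auto

lemma ac_poly_add: "ac_poly (P + Q) = ac_poly P + ac_poly Q"
  by (intro poly_eqI) simp

lemma ac_poly_diff: "ac_poly (P - Q) = ac_poly P - ac_poly Q"
  by (intro poly_eqI) simp

lemma ac_poly_mult: "ac_poly (P * Q) = ac_poly P * ac_poly Q"
  by (intro poly_eqI) (simp add: coeff_mult to_ac_sum)

lemma ac_poly_1: "ac_poly 1 = 1"
  by simp

lemma ac_poly_smult: "ac_poly (smult c P) = smult (to_ac c) (ac_poly P)"
  by (intro poly_eqI) simp

lemma ac_poly_power: "ac_poly (P ^ n) = ac_poly P ^ n"
  by (induction n) (simp_all add: ac_poly_mult)

lemma ac_poly_prod: "ac_poly (prod f A) = (\<Prod>x\<in>A. ac_poly (f x))"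
  by (induction A rule: infinite_finite_induct) (simp_all add: ac_poly_mult)

lemma ac_poly_monom: "ac_poly (monom c n) = monom (to_ac c) n"
  by (simp add: map_poly_monom)

lemma ac_poly_pcompose: "ac_poly (pcompose P Q) = pcompose (ac_poly P) (ac_poly Q)"
  by (induction P) (simp_all add: pcompose_pCons map_poly_pCons ac_poly_add ac_poly_mult)

lemma ac_poly_pderiv: "ac_poly (pderiv P) = pderiv (ac_poly P)"
  by (intro poly_eqI) (simp add: coeff_pderiv)

lemma order_prod:
  assumes "\<And>x. x \<in> A \<Longrightarrow> f x \<noteq> (0 :: 'b::idom poly)"
  shows "order \<beta> (prod f A) = (\<Sum>x\<in>A. order \<beta> (f x))"
  using assms
proof (induction A rule: infinite_finite_induct)
  case (insert x F)
  then show ?case by (simp add: order_mult)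
qed auto

lemma order_power: "P \<noteq> 0 \<Longrightarrow> order \<beta> (P ^ n) = n * order \<beta> (P :: 'b::idom poly)"
  by (induction n) (simp_all add: order_mult)

section \<open>Minimal polynomials and conjugacy classes\<close>

lemma min_poly_exists:
  fixes \<alpha> :: "'a::field alg_closure"
  obtains P where "lead_coeff P = 1" "irreducible P" "poly (ac_poly P) \<alpha> = 0"
    "\<And>F. poly (ac_poly F) \<alpha> = 0 \<Longrightarrow> P dvd F"
proof -
  let ?S = "\<lambda>P :: 'a poly. P \<noteq> 0 \<and> poly (ac_poly P) \<alpha> = 0"
  obtain P0 where "?S P0" using alg_closure_algebraic[of \<alpha>] by metis
  then obtain P1 where P1: "?S P1" "\<And>F. ?S F \<Longrightarrow> degree P1 \<le> degree F"
    using ex_has_least_nat[of ?S P0 degree] by blast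
  define P where "P = smult (inverse (lead_coeff P1)) P1"
  have lc: "lead_coeff P1 \<noteq> 0" using P1 by simp
  have P: "?S P" "lead_coeff P = 1" "degree P = degree P1"
    using P1 lc by (auto simp: P_def ac_poly_smult)
  have dvd: "P dvd F" if "poly (ac_poly F) \<alpha> = 0" for F
  proof -
    have "F = F div P * P + F mod P" by simp
    then have "poly (ac_poly F) \<alpha> = poly (ac_poly (F div P)) \<alpha> * poly (ac_poly P) \<alpha> + poly (ac_poly (F mod P)) \<alpha>"
      by (metis ac_poly_add ac_poly_mult poly_add poly_mult)
    then have "poly (ac_poly (F mod P)) \<alpha> = 0" using that P by simp
    then have "F mod P = 0" using P1(2)[of "F mod P"] degree_mod_less'[of P F] P by force
    then show ?thesis by auto
  qed
  have "irreducible P"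
  proof (rule Factorial_Ring.irreducibleI)
    show "P \<noteq> 0" using P by simp
    show "\<not> P dvd 1"
    proof
      assume "P dvd 1"
      then obtain C where "1 = P * C" by (elim dvdE)
      then have "1 = poly (ac_poly P) \<alpha> * poly (ac_poly C) \<alpha>" by (metis ac_poly_1 ac_poly_mult poly_mult poly_1)
      with P show False by simp
    qed
    fix A B assume AB: "P = A * B"
    then have ne: "A \<noteq> 0" "B \<noteq> 0" using P by auto
    have "poly (ac_poly A) \<alpha> = 0 \<or> poly (ac_poly B) \<alpha> = 0" using P AB by (simp add: ac_poly_mult)
    then have "degree P \<le> degree A \<or> degree P \<le> degree B" using P1(2) P ne by auto
    then have "degree A = 0 \<or> degree B = 0" using AB ne by (auto simp: degree_mult_eq)
    then show "A dvd 1 \<or> B dvd 1" using ne by (simp add: is_unit_iff_degree)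
  qed
  with that P dvd show ?thesis by blast
qed

lemma min_poly_props:
  fixes \<alpha> :: "'a::field alg_closure"
  shows lead_coeff_min_poly [simp]: "lead_coeff (min_poly \<alpha>) = 1"
    and irreducible_min_poly: "irreducible (min_poly \<alpha>)"
    and poly_min_poly [simp]: "poly (ac_poly (min_poly \<alpha>)) \<alpha> = 0"
    and min_poly_dvd_iff: "min_poly \<alpha> dvd F \<longleftrightarrow> poly (ac_poly F) \<alpha> = 0"
    and min_poly_eqI: "lead_coeff F = 1 \<Longrightarrow> irreducible F \<Longrightarrow> poly (ac_poly F) \<alpha> = 0 \<Longrightarrow> min_poly \<alpha> = F"
proof -
  obtain P where P: "lead_coeff P = 1" "irreducible P" "poly (ac_poly P) \<alpha> = 0"
    "\<And>F. poly (ac_poly F) \<alpha> = 0 \<Longrightarrow> P dvd F"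
    using min_poly_exists by blast
  have unique: "F = P" if F: "lead_coeff F = 1" "irreducible F" "poly (ac_poly F) \<alpha> = 0" for F
  proof -
    obtain C where C: "F = P * C" using P(4)[OF F(3)] by (elim dvdE)
    have "\<not> P dvd 1" using P(2) unfolding Factorial_Ring.irreducible_def by blast
    then have "C dvd 1" using Factorial_Ring.irreducibleD[OF F(2) C] by blast
    then obtain c where c: "C = [:c:]" using is_unit_polyE by blast
    have "lead_coeff C = 1" using F(1) P(1) unfolding C lead_coeff_mult by simp
    then have "C = 1" using c by (simp add: one_pCons)
    then show ?thesis using C by simp
  qed
  have "min_poly \<alpha> = P"
    unfolding min_poly_def
    by (rule the_equality, intro conjI P(1-3), elim conjE, rule unique)
  then show "lead_coeff (min_poly \<alpha>) = 1" "irreducible (min_poly \<alpha>)"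
    "poly (ac_poly (min_poly \<alpha>)) \<alpha> = 0"
    using P(1-3) by simp_all
  show "min_poly \<alpha> = F" if "lead_coeff F = 1" "irreducible F" "poly (ac_poly F) \<alpha> = 0"
    using unique[OF that] \<open>min_poly \<alpha> = P\<close> by simp
  show "min_poly \<alpha> dvd F \<longleftrightarrow> poly (ac_poly F) \<alpha> = 0"
  proof
    assume "min_poly \<alpha> dvd F"
    then have "P dvd F" using \<open>min_poly \<alpha> = P\<close> by simp
    then obtain C where "F = P * C" by (elim dvdE)
    then show "poly (ac_poly F) \<alpha> = 0" using P(3) by (simp add: ac_poly_mult)
  qed (use P(4) \<open>min_poly \<alpha> = P\<close> in simp)
qed

lemma min_poly_nonzero [simp]: "min_poly \<alpha> \<noteq> 0"
  using lead_coeff_min_poly[of \<alpha>] by force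

lemma degree_min_poly_pos: "degree (min_poly \<alpha>) > 0"
  using irreducible_min_poly[of \<alpha>] is_unit_iff_degree[OF min_poly_nonzero, of \<alpha>]
  by (auto simp: Factorial_Ring.irreducible_def)

lemma conj_class_iff_root: "\<beta> \<in> conj_class \<alpha> \<longleftrightarrow> poly (ac_poly (min_poly \<alpha>)) \<beta> = 0"
  unfolding conj_class_def mem_Collect_eq
  by (metis min_poly_eqI poly_min_poly irreducible_min_poly lead_coeff_min_poly)

lemma conj_class_self [simp]: "\<alpha> \<in> conj_class \<alpha>"
  by (simp add: conj_class_def)

lemma finite_conj_class [simp]: "finite (conj_class \<alpha>)"
proof -
  have "conj_class \<alpha> = {\<beta>. poly (ac_poly (min_poly \<alpha>)) \<beta> = 0}" by (auto simp: conj_class_iff_root)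
  then show ?thesis by (simp add: poly_roots_finite)
qed

lemma conj_class_eq: "\<beta> \<in> conj_class \<alpha> \<Longrightarrow> conj_class \<beta> = conj_class \<alpha>"
  by (simp add: conj_class_def)

lemma conj_class_nonzero:
  assumes "\<beta> \<in> conj_class \<alpha>" "\<alpha> \<noteq> 0"
  shows "\<beta> \<noteq> 0"
proof
  assume "\<beta> = 0"
  have "irreducible [:0, 1 :: 'a:]"
  proof (rule Factorial_Ring.irreducibleI)
    show "[:0, 1 :: 'a:] \<noteq> 0" "\<not> [:0, 1 :: 'a:] dvd 1" by (auto simp: is_unit_pCons_iff)
    fix A B :: "'a poly" assume AB: "[:0, 1:] = A * B"
    then have ne: "A \<noteq> 0" "B \<noteq> 0" by auto
    then have "degree A + degree B = 1" using AB by (metis degree_mult_eq degree_pCons_eq_if degree_1 one_pCons one_neq_zero One_nat_def)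
    then have "degree A = 0 \<or> degree B = 0" by linarith
    then show "A dvd 1 \<or> B dvd 1" using ne by (simp add: is_unit_iff_degree)
  qed
  then have "min_poly (0 :: 'a alg_closure) = [:0, 1:]" by (intro min_poly_eqI) (auto simp: map_poly_pCons)
  then have "min_poly \<alpha> = [:0, 1:]" using assms \<open>\<beta> = 0\<close> by (simp add: conj_class_def)
  then have "poly (ac_poly [:0, 1:]) \<alpha> = 0" using poly_min_poly[of \<alpha>] by simp
  then show False using assms by (simp add: map_poly_pCons)
qed

lemma root_exists:
  fixes P :: "'a::field poly"
  assumes "degree P > 0"
  obtains \<beta> where "poly (ac_poly P) \<beta> = 0"
  using alg_closed_imp_poly_has_root[of "ac_poly P"] assms by (metis degree_ac_poly)

section \<open>Coprimality and common roots\<close>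

lemma coprime_no_common_root:
  assumes "coprime A B" "poly (ac_poly A) \<beta> = 0"
  shows "poly (ac_poly B) \<beta> \<noteq> 0"
proof
  assume "poly (ac_poly B) \<beta> = 0"
  then have "min_poly \<beta> dvd A" "min_poly \<beta> dvd B" using assms by (simp_all add: min_poly_dvd_iff)
  then have "min_poly \<beta> dvd 1" using assms(1) coprime_common_divisor by blast
  then show False using irreducible_min_poly[of \<beta>] by (simp add: Factorial_Ring.irreducible_def)
qed

lemma coprimeI_no_common_root:
  fixes A B :: "'a::field poly"
  assumes "A \<noteq> 0 \<or> B \<noteq> 0" and "\<And>\<beta>. poly (ac_poly A) \<beta> = 0 \<Longrightarrow> poly (ac_poly B) \<beta> \<noteq> 0"
  shows "coprime A B"
proof (rule coprimeI)
  fix C assume C: "C dvd A" "C dvd B"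
  then have "C \<noteq> 0" using assms(1) by auto
  show "C dvd 1"
  proof (rule ccontr)
    assume "\<not> C dvd 1"
    then have "degree C > 0" using \<open>C \<noteq> 0\<close> by (simp add: is_unit_iff_degree)
    then obtain \<beta> where \<beta>: "poly (ac_poly C) \<beta> = 0" by (rule root_exists)
    then have "poly (ac_poly A) \<beta> = 0" "poly (ac_poly B) \<beta> = 0"
      using C by (auto elim!: dvdE simp: ac_poly_mult)
    with assms(2) show False by blast
  qed
qed

lemma coprime_decomposition:
  fixes A B :: "'a::field poly"
  assumes "A \<noteq> 0" "B \<noteq> 0"
  obtains C A' B' where "A = C * A'" "B = C * B'" "coprime A' B'"
  using assms
proof (induction "degree A" arbitrary: A B thesis rule: less_induct)
  case less
  show ?case
  proof (cases "coprime A B")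
    case True
    then show ?thesis using less.prems(1)[of 1 A B] by simp
  next
    case False
    then obtain D where D: "D dvd A" "D dvd B" "\<not> D dvd 1" unfolding coprime_def by blast
    then obtain A1 B1 where A1: "A = D * A1" "B = D * B1" by (elim dvdE)
    then have ne: "D \<noteq> 0" "A1 \<noteq> 0" "B1 \<noteq> 0" using less.prems by auto
    then have "degree D > 0" using D by (simp add: is_unit_iff_degree)
    then have "degree A1 < degree A" using ne A1 by (simp add: degree_mult_eq)
    then obtain C A' B' where "A1 = C * A'" "B1 = C * B'" "coprime A' B'"
      using less.hyps[of A1 B1] ne by metis
    then show ?thesis using less.prems(1)[of "D * C" A' B'] A1 by (simp add: mult.assoc)
  qed
qed

text \<open>A nonzero combination of least degree divides both polynomials. It does not vanish at
  \<beta> because it divides \<open>B\<close>, so as a divisor of an irreducible polynomial it must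
  be a unit.\<close>

lemma min_poly_bezout:
  fixes B :: "'a::field poly"
  assumes "poly (ac_poly B) \<beta> \<noteq> 0"
  obtains x y where "x * min_poly \<beta> + y * B = 1"
proof -
  let ?I = "\<lambda>D. D \<noteq> 0 \<and> (\<exists>x y. D = x * min_poly \<beta> + y * B)"
  have "?I (min_poly \<beta>)" by (auto intro: exI[of _ 1] exI[of _ 0])
  then obtain D where D: "?I D" "\<And>F. ?I F \<Longrightarrow> degree D \<le> degree F"
    using ex_has_least_nat[of ?I "min_poly \<beta>" degree] by blast
  then obtain x y where xy: "D = x * min_poly \<beta> + y * B" by blast
  have dvd: "D dvd F" if F: "F = u * min_poly \<beta> + v * B" for F u v
  proof -
    have "F mod D = F - F div D * D" by (simp add: minus_div_mult_eq_mod)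
    also have "\<dots> = (u - F div D * x) * min_poly \<beta> + (v - F div D * y) * B"
      unfolding F xy by (simp add: algebra_simps)
    finally have "F mod D \<noteq> 0 \<longrightarrow> ?I (F mod D)" by blast
    then have "F mod D = 0" using D(2)[of "F mod D"] degree_mod_less'[of D F] D(1) by force
    then show ?thesis by auto
  qed
  have "D dvd min_poly \<beta>" "D dvd B" using dvd[of _ 1 0] dvd[of _ 0 1] by auto
  then obtain E where E: "min_poly \<beta> = D * E" by (elim dvdE)
  have "poly (ac_poly D) \<beta> \<noteq> 0" using \<open>D dvd B\<close> assms by (auto elim!: dvdE simp: ac_poly_mult)
  then have "\<not> min_poly \<beta> dvd D" by (simp add: min_poly_dvd_iff)
  then have "\<not> E dvd 1" using E by (metis dvd_mult_unit_iff dvd_refl)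
  then have "D dvd 1" using Factorial_Ring.irreducibleD[OF irreducible_min_poly E] by blast
  then obtain D' where "1 = D * D'" by (elim dvdE)
  then have "D' * x * min_poly \<beta> + D' * y * B = 1" unfolding xy by (simp add: algebra_simps)
  then show ?thesis by (rule that)
qed

section \<open>Substituting a power of the variable\<close>

lemma coeff_pcompose_power:
  assumes "N > 0"
  shows "coeff (pcompose P (monom 1 N)) k = (if N dvd k then coeff P (k div N) else (0 :: 'b::comm_ring_1))"
proof (induction P arbitrary: k)
  case (pCons a P)
  have "coeff (pcompose (pCons a P) (monom 1 N)) k =
      coeff [:a:] k + (if k \<ge> N then coeff (pcompose P (monom 1 N)) (k - N) else 0)"
    by (simp add: pcompose_pCons coeff_monom_mult)
  also have "\<dots> = (if N dvd k then coeff (pCons a P) (k div N) else 0)"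
  proof (cases "k \<ge> N")
    case True
    then have "N dvd k \<longleftrightarrow> N dvd (k - N)" "k div N = Suc ((k - N) div N)" "k > 0"
      using assms by (auto simp: dvd_minus_self le_div_geq)
    then show ?thesis using True pCons.IH[of "k - N"] by (simp add: coeff_pCons')
  next
    case False
    then show ?thesis using assms by (auto simp: coeff_pCons' dest: dvd_imp_le)
  qed
  finally show ?case .
qed auto

lemma pcompose_power_nonzero: "N > 0 \<Longrightarrow> P \<noteq> 0 \<Longrightarrow> pcompose P (monom 1 N) \<noteq> (0 :: 'b::idom poly)"
  using pcompose_eq_0[of P "monom 1 N"] by (auto simp: degree_monom_eq)

text \<open>Only the factor X - \<beta>^N of \<open>P\<close> vanishes at \<beta> after the
  substitution, and it becomes Y^N - \<beta>^N. The second factor no longer depends on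
  \<open>P\<close>.\<close>

lemma order_pcompose_power:
  fixes P :: "'b::field poly"
  assumes N: "N > 0" and P: "P \<noteq> 0"
  shows "order \<beta> (pcompose P (monom 1 N)) = order (\<beta> ^ N) P * order \<beta> (monom 1 N - [:\<beta> ^ N:])"
proof -
  let ?l = "monom 1 N - [:\<beta> ^ N:]"
  obtain S where S: "P = [:- (\<beta> ^ N), 1:] ^ order (\<beta> ^ N) P * S" "\<not> [:- (\<beta> ^ N), 1:] dvd S"
    using order_decomp[OF P] by blast
  have S0: "S \<noteq> 0" using S P by auto
  have S\<beta>: "poly S (\<beta> ^ N) \<noteq> 0" using S(2) poly_eq_0_iff_dvd by blast
  have l: "pcompose [:- (\<beta> ^ N), 1:] (monom 1 N) = ?l" by (simp add: pcompose_pCons)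
  have l0: "?l \<noteq> 0"
    using pcompose_power_nonzero[OF N, of "[:- (\<beta> ^ N), 1:]"] by (simp only: l) simp
  have pow: "pcompose (A ^ n) B = pcompose A B ^ n" for A B :: "'b poly" and n
    by (induction n) (simp_all add: pcompose_mult pcompose_1)
  have "pcompose P (monom 1 N) = ?l ^ order (\<beta> ^ N) P * pcompose S (monom 1 N)"
    by (subst S(1)) (simp only: pcompose_mult pow l)
  moreover have "order \<beta> (pcompose S (monom 1 N)) = 0"
    using S\<beta> by (intro order_0I) (simp add: poly_pcompose poly_monom)
  moreover have "pcompose S (monom 1 N) \<noteq> 0" using pcompose_power_nonzero[OF N S0] .
  ultimately show ?thesis using l0 by (simp add: order_mult order_power)
qed

lemma order_eq_1I:
  fixes P :: "'b::field poly"
  assumes "P \<noteq> 0" "poly P \<beta> = 0" "poly (pderiv P) \<beta> \<noteq> 0"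
  shows "order \<beta> P = 1"
proof -
  have "order \<beta> P \<noteq> 0" using assms by (simp add: order_root)
  moreover have "\<not> 2 \<le> order \<beta> P"
  proof
    assume "2 \<le> order \<beta> P"
    then have "[:- \<beta>, 1:] ^ 2 dvd P" by (simp add: order_divides)
    then obtain S where "P = [:- \<beta>, 1:] ^ 2 * S" by (elim dvdE)
    define l where "l = [:- \<beta>, 1:]"
    have "P = l * (l * S)" using \<open>P = _\<close> by (simp only: l_def power2_eq_square mult.assoc)
    moreover have "poly l \<beta> = 0" by (simp add: l_def)
    ultimately have "poly (pderiv P) \<beta> = 0" by (simp add: pderiv_mult)
    with assms show False by simp
  qed
  ultimately show ?thesis by linarith
qed

section \<open>Roots of the Frobenius and separability\<close>

lemma char_perfectoid:
  assumes "CHAR('a::perfectoid_field) \<noteq> 0"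
  shows "CHAR('a) = residue_char TYPE('a)" "Factorial_Ring.prime (CHAR('a))"
proof -
  show p: "Factorial_Ring.prime (CHAR('a))" using assms prime_CHAR_semidom by blast
  show "CHAR('a) = residue_char TYPE('a)"
    by (rule residue_char_eqI[symmetric]) (use p in simp_all)
qed

text \<open>In characteristic p the element p has absolute value 0, so surjectivity of the Frobenius
  modulo p is exact surjectivity on the valuation ring. Inverses give the remaining
  elements.\<close>

lemma frobenius_root:
  assumes "CHAR('a::perfectoid_field) \<noteq> 0"
  shows "\<exists>y. y ^ (residue_char TYPE('a) ^ j) = (x :: 'a)"
proof -
  let ?p = "residue_char TYPE('a)"
  have p0: "of_nat ?p = (0::'a)" using char_perfectoid[OF assms] by (metis of_nat_CHAR)
  have small: "\<exists>y. y ^ ?p = x" if x: "absv x \<le> 1" for x :: 'a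
  proof -
    obtain p' where p': "Factorial_Ring.prime p'" "absv (of_nat p' :: 'a) < 1"
      "\<And>x :: 'a. absv x \<le> 1 \<Longrightarrow> \<exists>y. absv y \<le> 1 \<and> absv (x - y ^ p') \<le> absv (of_nat p' :: 'a)"
      using residue_frobenius_surj[where 'a='a] by blast
    have "?p = p'" using p' by (intro residue_char_eqI)
    then obtain y where "absv (x - y ^ ?p) \<le> 0" using p'(3)[OF x] p0 by auto
    then have "x - y ^ ?p = 0" using absv_ge_0[of "x - y ^ ?p"] absv_eq_0 by (metis order_antisym)
    then show ?thesis by auto
  qed
  have root: "\<exists>y. y ^ ?p = x" for x :: 'a
  proof (cases "absv x \<le> 1")
    case False
    then have "absv (inverse x) \<le> 1" by (simp add: absv_inverse inverse_le_1_iff)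
    then obtain y where "y ^ ?p = inverse x" using small by blast
    then have "inverse y ^ ?p = x" by (simp add: power_inverse)
    then show ?thesis by blast
  qed (rule small)
  show ?thesis
  proof (induction j arbitrary: x)
    case (Suc j)
    obtain y where y: "y ^ ?p = x" using root by blast
    obtain z where "z ^ (?p ^ j) = y" using Suc by blast
    then have "z ^ (?p ^ j * ?p) = x" using y by (simp only: power_mult)
    then have "z ^ (?p ^ Suc j) = x" by (simp only: power_Suc2)
    then show ?case by blast
  qed simp
qed

text \<open>Since every coefficient has an N-th root, the polynomial with these roots as
  coefficients has the required N-th power, because the Frobenius is additive.\<close>

lemma pcompose_frobenius:
  fixes P :: "'a::perfectoid_field poly"
  assumes "CHAR('a) \<noteq> 0"
  shows "\<exists>R. pcompose P (monom 1 (residue_char TYPE('a) ^ j)) = R ^ (residue_char TYPE('a) ^ j)"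
proof (induction P)
  case 0
  have "residue_char TYPE('a) ^ j > 0" using residue_char_pos[where 'a='a] by simp
  then show ?case by (intro exI[of _ 0]) (simp add: power_0_left)
next
  case (pCons a P)
  let ?N = "residue_char TYPE('a) ^ j"
  obtain R where R: "pcompose P (monom 1 ?N) = R ^ ?N" using pCons by blast
  obtain r where r: "r ^ ?N = a" using frobenius_root[OF assms] by blast
  have "(([:r:] :: 'a poly) + monom 1 1 * R) ^ ?N = [:r:] ^ ?N + (monom 1 1 * R) ^ ?N"
    using char_perfectoid[OF assms] by (intro freshmans_dream') auto
  also have "\<dots> = pcompose (pCons a P) (monom 1 ?N)"
    by (simp add: pcompose_pCons R power_mult_distrib monom_power poly_const_pow r)
  finally show ?case by metis
qed

text \<open>Separability: a zero derivative would make the minimal polynomial a polynomial in X^p,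
  hence a p-th power over the perfect base field, against its irreducibility.\<close>

lemma pderiv_min_poly:
  fixes \<alpha> :: "'a::perfectoid_field alg_closure"
  shows "poly (pderiv (ac_poly (min_poly \<alpha>))) \<alpha> \<noteq> 0"
proof -
  let ?P = "min_poly \<alpha>" and ?p = "residue_char TYPE('a)"
  have "pderiv ?P \<noteq> 0"
  proof
    assume d: "pderiv ?P = 0"
    have d': "of_nat k * coeff ?P k = 0" if "k > 0" for k
      using coeff_pderiv[of ?P "k - 1"] that d by simp
    have char: "CHAR('a) \<noteq> 0"
    proof
      assume "CHAR('a) = 0"
      then have "(of_nat (degree ?P) :: 'a) \<noteq> 0"
        using degree_min_poly_pos[of \<alpha>] by (simp add: of_nat_eq_0_iff_char_dvd)
      then show False using d'[OF degree_min_poly_pos] by (metis lead_coeff_min_poly mult.right_neutral)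
    qed
    have p: "CHAR('a) = ?p" using char_perfectoid[OF char] by simp
    have pp: "?p > 0" by (rule residue_char_pos)
    \<comment> \<open>The coefficients at multiples of p; at the other exponents k the factor k is
      invertible, so the vanishing derivative kills them.\<close>
    define P0 where "P0 = Abs_poly (\<lambda>k. coeff ?P (k * ?p))"
    have "\<forall>\<^sub>\<infinity>k. coeff ?P (k * ?p) = 0"
      unfolding MOST_nat
    proof (intro exI allI impI coeff_eq_0)
      fix k assume "degree ?P < k"
      also have "k \<le> k * ?p" using pp by simp
      finally show "degree ?P < k * ?p" .
    qed
    then have c0: "coeff P0 k = coeff ?P (k * ?p)" for k by (simp add: P0_def Abs_poly_inverse)
    have "pcompose P0 (monom 1 ?p) = ?P"
    proof (rule poly_eqI)
      fix k
      have "coeff ?P k = 0" if "\<not> ?p dvd k"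
        using d'[of k] that p by (cases k) (auto simp: of_nat_eq_0_iff_char_dvd simp del: of_nat_Suc)
      then show "coeff (pcompose P0 (monom 1 ?p)) k = coeff ?P k"
        using pp by (auto simp: coeff_pcompose_power c0)
    qed
    then obtain R where R: "?P = R ^ ?p" using pcompose_frobenius[OF char, of P0 1] by auto
    have "R \<noteq> 0"
    proof
      assume "R = 0"
      then have "?P = 0" using R pp by (simp only: power_0_left) simp
      then show False by simp
    qed
    have "poly (ac_poly R) \<alpha> ^ ?p = poly (ac_poly (R ^ ?p)) \<alpha>" by (simp only: ac_poly_power poly_power)
    also have "\<dots> = 0" using poly_min_poly[of \<alpha>] unfolding R[symmetric] .
    finally have "?P dvd R" by (simp add: min_poly_dvd_iff)
    \<comment> \<open>The contradiction is one of degrees: \<open>R\<close> has \<alpha> as a root,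
      but its degree is smaller by the factor p.\<close>
    then have "degree ?P \<le> degree R" using \<open>R \<noteq> 0\<close> by (rule dvd_imp_degree_le)
    moreover have deg: "degree ?P = ?p * degree R"
      by (subst R) (rule degree_power_eq[OF \<open>R \<noteq> 0\<close>])
    moreover have "1 < ?p" using residue_char_prime[where 'a='a] prime_gt_1_nat by blast
    moreover have "0 < degree R" using deg degree_min_poly_pos[of \<alpha>] by (cases "degree R") auto
    ultimately show False using mult_less_mono1[of 1 ?p "degree R"] by simp
  qed
  then have "degree (pderiv ?P) < degree ?P"
    using degree_min_poly_pos[of \<alpha>] by (intro degree_lessI) (auto simp: coeff_pderiv coeff_eq_0 simp del: of_nat_Suc)
  then have "\<not> ?P dvd pderiv ?P" using \<open>pderiv ?P \<noteq> 0\<close> by (auto dest: dvd_imp_degree_le)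
  then show ?thesis by (simp add: min_poly_dvd_iff ac_poly_pderiv)
qed


text \<open>The order of a root of \<open>P (Y\<^sup>N)\<close>, where \<open>P\<close> is irreducible and \<open>N = p\<^sup>j\<close>.\<close>

definition insep_degree :: "'a::perfectoid_field itself \<Rightarrow> nat \<Rightarrow> nat" where
  "insep_degree _ j = (if CHAR('a) = 0 then 1 else residue_char TYPE('a) ^ j)"

lemma insep_degree_pos [simp]: "insep_degree TYPE('a::perfectoid_field) j > 0"
  using residue_char_pos[where 'a='a] by (simp add: insep_degree_def)

lemma insep_degree_dvd: "insep_degree TYPE('a::perfectoid_field) j dvd residue_char TYPE('a) ^ j"
  by (simp add: insep_degree_def)

text \<open>In characteristic 0 the derivative N Y^(N-1) does not vanish at \<beta>, so the zero is
  simple. In characteristic p the polynomial is (Y - \<beta>)^N.\<close>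

lemma order_power_minus_const:
  fixes \<beta> :: "'a::perfectoid_field alg_closure"
  assumes "\<beta> \<noteq> 0"
  shows "order \<beta> (monom 1 (residue_char TYPE('a) ^ j) - [:\<beta> ^ (residue_char TYPE('a) ^ j):]) =
         insep_degree TYPE('a) j"
proof (cases "CHAR('a) = 0")
  case True
  let ?N = "residue_char TYPE('a) ^ j" and ?l = "monom 1 (residue_char TYPE('a) ^ j) - [:\<beta> ^ (residue_char TYPE('a) ^ j):]"
  have N: "?N > 0" using residue_char_pos[where 'a='a] by simp
  have "CHAR('a alg_closure) = 0" using True by simp
  then have N0: "(of_nat ?N :: 'a alg_closure) \<noteq> 0"
    using N unfolding CHAR_eq0_iff by blast
  have d: "poly (pderiv ?l) \<beta> \<noteq> 0"
    using N0 assms by (simp add: pderiv_diff pderiv_monom poly_monom del: of_nat_power)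
  then have "?l \<noteq> 0" by (metis pderiv_0 poly_0)
  then have "order \<beta> ?l = 1" using d by (intro order_eq_1I) (auto simp: poly_monom)
  then show ?thesis using True by (simp add: insep_degree_def)
next
  case False
  let ?N = "residue_char TYPE('a) ^ j"
  have N: "?N > 0" using residue_char_pos[where 'a='a] by simp
  have "([:- \<beta>, 1:] + [:\<beta>:]) ^ ?N = [:- \<beta>, 1:] ^ ?N + [:\<beta>:] ^ ?N"
    using char_perfectoid[OF False] by (intro freshmans_dream'[where n = j]) auto
  moreover have "[:- \<beta>, 1:] + [:\<beta>:] = monom 1 1" by (simp add: monom_altdef)
  ultimately have "monom 1 ?N - [:\<beta> ^ ?N:] = [:- \<beta>, 1:] ^ ?N"
    by (simp add: monom_power poly_const_pow algebra_simps)
  then show ?thesis using False by (simp add: order_power_n_n insep_degree_def)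
qed

lemma order_min_poly_power:
  fixes \<alpha> \<beta> :: "'a::perfectoid_field alg_closure"
  assumes "\<alpha> \<noteq> 0"
  shows "order \<beta> (ac_poly (pcompose (min_poly \<alpha>) (monom 1 (residue_char TYPE('a) ^ j)))) =
    (if \<beta> ^ (residue_char TYPE('a) ^ j) \<in> conj_class \<alpha> then insep_degree TYPE('a) j else 0)"
proof -
  let ?N = "residue_char TYPE('a) ^ j"
  have N: "?N > 0" using residue_char_pos[where 'a='a] by simp
  have eq: "order \<beta> (ac_poly (pcompose (min_poly \<alpha>) (monom 1 ?N))) =
    order (\<beta> ^ ?N) (ac_poly (min_poly \<alpha>)) * order \<beta> (monom 1 ?N - [:\<beta> ^ ?N:])"
    using order_pcompose_power[OF N, of "ac_poly (min_poly \<alpha>)" \<beta>]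
    by (simp add: ac_poly_pcompose ac_poly_monom)
  show ?thesis
  proof (cases "\<beta> ^ ?N \<in> conj_class \<alpha>")
    case True
    then have "\<beta> \<noteq> 0" using conj_class_nonzero[OF True assms] N by (auto simp: power_0_left)
    have eq': "min_poly (\<beta> ^ ?N) = min_poly \<alpha>" using True by (simp add: conj_class_def)
    have "order (\<beta> ^ ?N) (ac_poly (min_poly \<alpha>)) = 1"
      using pderiv_min_poly[of "\<beta> ^ ?N"] poly_min_poly[of "\<beta> ^ ?N"] unfolding eq'
      by (intro order_eq_1I) auto
    then show ?thesis using True order_power_minus_const[OF \<open>\<beta> \<noteq> 0\<close>] eq by simp
  next
    case False
    then have "order (\<beta> ^ ?N) (ac_poly (min_poly \<alpha>)) = 0"
      by (intro order_0I) (simp add: conj_class_iff_root)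
    then show ?thesis using False eq by simp
  qed
qed

section \<open>The multiplicity in terms of orders of zeros\<close>

text \<open>Let e be the inseparable degree. Comparing orders at each root \<beta> of P(Y^N), where
  \<open>B\<close> has order 0, the defining equation is solvable for k exactly if k e is at most N
  times the order difference at every \<beta>. Hence the largest k is N/e times the minimum of the
  differences; the powers \<open>nat k\<close> and \<open>nat (- k)\<close> keep both signs of k
  polynomial.\<close>

lemma multiplicity_at_eq:
  fixes G H :: "'a::perfectoid_field poly" and j :: nat
  defines "N \<equiv> residue_char TYPE('a) ^ j"
  assumes G: "G \<noteq> 0" and H: "H \<noteq> 0" and \<alpha>: "\<alpha> \<noteq> 0"
  defines "V \<equiv> {int (order \<beta> (ac_poly G)) - int (order \<beta> (ac_poly H)) | \<beta>. \<beta> ^ N \<in> conj_class \<alpha>}"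
  shows "finite V" "V \<noteq> {}"
    and "multiplicity_at \<alpha> j G H = of_int (Min V) / of_nat (insep_degree TYPE('a) j)"
proof -
  define P where "P = pcompose (min_poly \<alpha>) (monom 1 N)"
  define e where "e = insep_degree TYPE('a) j"
  have N: "N > 0" using residue_char_pos[where 'a='a] by (simp add: N_def)
  have P: "P \<noteq> 0" unfolding P_def by (rule pcompose_power_nonzero[OF N]) simp
  have e: "e > 0" by (simp add: e_def)
  have ordP: "order \<beta> (ac_poly P) = (if \<beta> ^ N \<in> conj_class \<alpha> then e else 0)" for \<beta>
    unfolding P_def N_def e_def by (rule order_min_poly_power[OF \<alpha>])
  have rootP: "poly (ac_poly P) \<beta> = 0 \<longleftrightarrow> \<beta> ^ N \<in> conj_class \<alpha>" for \<beta>
    using ordP[of \<beta>] order_root[of "ac_poly P" \<beta>] P e by auto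
  have degP: "degree P > 0"
    using N degree_min_poly_pos[of \<alpha>] by (simp add: P_def degree_pcompose degree_monom_eq)
  have roots: "{\<beta>. \<beta> ^ N \<in> conj_class \<alpha>} = {\<beta>. poly (ac_poly P) \<beta> = 0}"
    using rootP by blast
  have Vim: "V = (\<lambda>\<beta>. int (order \<beta> (ac_poly G)) - int (order \<beta> (ac_poly H))) ` {\<beta>. poly (ac_poly P) \<beta> = 0}"
    unfolding V_def roots[symmetric] by blast
  show fV: "finite V" unfolding Vim using P by (intro finite_imageI poly_roots_finite) simp
  show nV: "V \<noteq> {}" unfolding Vim using root_exists[OF degP] by blast
  define good where "good = (\<lambda>k::int. \<exists>A B. coprime B P \<and> G ^ N * B * P ^ nat (- k) = A * H ^ N * P ^ nat k)"
  have e_N: "e dvd N" using insep_degree_dvd[where 'a='a and j=j] by (simp add: e_def N_def)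
  then obtain N' where N': "N = e * N'" by (elim dvdE)
  have N'0: "N' > 0" using N N' by auto
  have good_iff: "good k \<longleftrightarrow> k \<le> int N' * Min V" for k
  proof -
    have "good k \<longleftrightarrow> (\<forall>\<beta>. poly (ac_poly P) \<beta> = 0 \<longrightarrow>
      k * int e \<le> int N * (int (order \<beta> (ac_poly G)) - int (order \<beta> (ac_poly H))))"
    proof
      assume "good k"
      then obtain A B where AB: "coprime B P" "G ^ N * B * P ^ nat (- k) = A * H ^ N * P ^ nat k"
        unfolding good_def by blast
      have "B \<noteq> 0" using AB(1) degP P by (auto simp: is_unit_iff_degree)
      then have ne: "G ^ N * B * P ^ nat (- k) \<noteq> 0" using G P by simp
      then have "A \<noteq> 0" using AB by auto
      show "\<forall>\<beta>. poly (ac_poly P) \<beta> = 0 \<longrightarrow>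
          k * int e \<le> int N * (int (order \<beta> (ac_poly G)) - int (order \<beta> (ac_poly H)))"
      proof (intro allI impI)
        fix \<beta> assume \<beta>: "poly (ac_poly P) \<beta> = 0"
        then have oP: "order \<beta> (ac_poly P) = e" using ordP rootP by simp
        have oB: "order \<beta> (ac_poly B) = 0"
          using coprime_no_common_root[of P B \<beta>] AB(1) \<beta> by (intro order_0I) (simp add: coprime_commute)
        have "order \<beta> (ac_poly (G ^ N * B * P ^ nat (- k))) = order \<beta> (ac_poly (A * H ^ N * P ^ nat k))"
          using AB(2) by simp
        then have "N * order \<beta> (ac_poly G) + nat (- k) * e =
            order \<beta> (ac_poly A) + N * order \<beta> (ac_poly H) + nat k * e"
          using G H P \<open>A \<noteq> 0\<close> \<open>B \<noteq> 0\<close>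
          by (simp add: ac_poly_mult ac_poly_power order_mult order_power oP oB)
        then have "int (N * order \<beta> (ac_poly G) + nat (- k) * e) \<ge> int (N * order \<beta> (ac_poly H) + nat k * e)"
          by simp
        moreover have "int (nat k) - int (nat (- k)) = k" by simp
        ultimately show "k * int e \<le> int N * (int (order \<beta> (ac_poly G)) - int (order \<beta> (ac_poly H)))"
          by (smt (verit, del_insts) left_diff_distrib right_diff_distrib of_nat_add of_nat_mult)
      qed
    next
      assume *: "\<forall>\<beta>. poly (ac_poly P) \<beta> = 0 \<longrightarrow>
          k * int e \<le> int N * (int (order \<beta> (ac_poly G)) - int (order \<beta> (ac_poly H)))"
      \<comment> \<open>For the converse the fraction is brought to lowest terms A/B. A common root
        of \<open>B\<close> and P(Y^N) would be a zero of the denominator of higher order than of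
        the numerator, against the inequality.\<close>
      have ne: "G ^ N * P ^ nat (- k) \<noteq> 0" "H ^ N * P ^ nat k \<noteq> 0" using G H P by auto
      then obtain C A B where C: "G ^ N * P ^ nat (- k) = C * A" "H ^ N * P ^ nat k = C * B" "coprime A B"
        using coprime_decomposition by metis
      have ne': "C \<noteq> 0" "A \<noteq> 0" "B \<noteq> 0" using C ne by auto
      have "coprime B P"
      proof (rule coprimeI_no_common_root)
        fix \<beta> assume \<beta>: "poly (ac_poly B) \<beta> = 0"
        show "poly (ac_poly P) \<beta> \<noteq> 0"
        proof
          assume P\<beta>: "poly (ac_poly P) \<beta> = 0"
          then have oP: "order \<beta> (ac_poly P) = e" using ordP rootP by simp
          have oA: "order \<beta> (ac_poly A) = 0"
            using coprime_no_common_root[of B A \<beta>] C(3) \<beta> by (intro order_0I) (simp add: coprime_commute)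
          have oB: "order \<beta> (ac_poly B) > 0" using \<beta> ne' by (simp add: order_gt_0_iff)
          have "N * order \<beta> (ac_poly G) + nat (- k) * e = order \<beta> (ac_poly C)"
            using arg_cong[OF C(1), of "\<lambda>P. order \<beta> (ac_poly P)"] G P ne' oA
            by (simp add: ac_poly_mult ac_poly_power order_mult order_power oP)
          moreover have "N * order \<beta> (ac_poly H) + nat k * e = order \<beta> (ac_poly C) + order \<beta> (ac_poly B)"
            using arg_cong[OF C(2), of "\<lambda>P. order \<beta> (ac_poly P)"] H P ne'
            by (simp add: ac_poly_mult ac_poly_power order_mult order_power oP)
          ultimately have "int (N * order \<beta> (ac_poly G) + nat (- k) * e) < int (N * order \<beta> (ac_poly H) + nat k * e)"
            using oB by simp
          moreover have "int (nat k) - int (nat (- k)) = k" by simp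
          ultimately have "int N * (int (order \<beta> (ac_poly G)) - int (order \<beta> (ac_poly H))) < k * int e"
            by (smt (verit, del_insts) left_diff_distrib right_diff_distrib of_nat_add of_nat_mult)
          with * P\<beta> show False by fastforce
        qed
      qed (use ne' in simp)
      moreover have "G ^ N * B * P ^ nat (- k) = A * H ^ N * P ^ nat k"
        using C(1,2) by (metis mult.assoc mult.commute)
      ultimately show "good k" unfolding good_def by blast
    qed
    also have "\<dots> \<longleftrightarrow> (\<forall>v\<in>V. k \<le> int N' * v)"
    proof -
      have "k * int e \<le> int N * v \<longleftrightarrow> k \<le> int N' * v" for v
      proof -
        have "k * int e \<le> int N * v \<longleftrightarrow> int e * k \<le> int e * (int N' * v)" by (simp add: N' mult_ac)
        then show ?thesis using e by simp
      qed
      then show ?thesis unfolding Vim by auto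
    qed
    also have "\<dots> \<longleftrightarrow> k \<le> int N' * Min V"
    proof
      assume "\<forall>v\<in>V. k \<le> int N' * v"
      then show "k \<le> int N' * Min V" using Min_in[OF fV nV] by blast
    next
      assume k: "k \<le> int N' * Min V"
      show "\<forall>v\<in>V. k \<le> int N' * v"
        using k Min_le[OF fV] by (meson mult_left_mono of_nat_0_le_iff order_trans)
    qed
    finally show ?thesis .
  qed
  have "(GREATEST k. good k) = int N' * Min V"
    by (rule Greatest_equality) (auto simp: good_iff)
  then have "multiplicity_at \<alpha> j G H = of_int (int N' * Min V) / of_nat N"
    by (simp add: multiplicity_at_def Let_def good_def P_def N_def)
  also have "\<dots> = of_int (Min V) / of_nat e" using N'0 e by (simp add: N')
  finally show "multiplicity_at \<alpha> j G H = of_int (Min V) / of_nat (insep_degree TYPE('a) j)"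
    by (simp add: e_def)
qed

section \<open>The degree of a simple extension\<close>

lemma ext_degree_eq: "ext_degree (\<alpha> :: 'a::field alg_closure) = degree (min_poly \<alpha>)"
proof -
  let ?P = "min_poly \<alpha>"
  let ?D = "degree ?P"
  define B where "B = (\<lambda>k. \<alpha> ^ k) ` {..<?D}"
  have low: "F = 0" if "poly (ac_poly F) \<alpha> = 0" "degree F < ?D" for F
    using that by (metis min_poly_dvd_iff dvd_imp_degree_le leD)
  have inj: "inj_on (\<lambda>k. \<alpha> ^ k) {..<?D}"
  proof (rule inj_onI, rule ccontr)
    fix k l assume kl: "k \<in> {..<?D}" "l \<in> {..<?D}" "\<alpha> ^ k = \<alpha> ^ l" "k \<noteq> l"
    let ?F = "monom 1 k - monom 1 l :: 'a poly"
    have "poly (ac_poly ?F) \<alpha> = 0" using kl by (simp add: ac_poly_diff ac_poly_monom poly_monom)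
    moreover have "degree ?F < ?D" using kl
      by (intro le_less_trans[OF degree_diff_le_max]) (auto simp: degree_monom_eq)
    ultimately have "?F = 0" by (rule low)
    then have "coeff ?F k = 0" by simp
    then show False using kl by simp
  qed
  have comb: "poly (ac_poly F) \<alpha> = (\<Sum>k<?D. to_ac (coeff F k) * \<alpha> ^ k)" if "degree F < ?D" for F
  proof -
    have "poly (ac_poly F) \<alpha> = (\<Sum>k\<le>degree F. to_ac (coeff F k) * \<alpha> ^ k)"
      by (simp add: poly_altdef)
    also have "\<dots> = (\<Sum>k<?D. to_ac (coeff F k) * \<alpha> ^ k)"
      using that by (intro sum.mono_neutral_left) (auto simp: coeff_eq_0)
    finally show ?thesis .
  qed
  have "ac.independent B"
  proof (rule ac.independent_if_scalars_zero)
    show "finite B" by (simp add: B_def)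
    fix u x assume sum: "(\<Sum>x\<in>B. to_ac (u x) * x) = 0" and x: "x \<in> B"
    define F where "F = (\<Sum>k<?D. monom (u (\<alpha> ^ k)) k)"
    have cF: "coeff F k = (if k < ?D then u (\<alpha> ^ k) else 0)" for k
      unfolding F_def coeff_sum by (simp add: coeff_monom)
    have dF: "degree F < ?D"
      using degree_min_poly_pos[of \<alpha>] cF by (intro degree_lessI) auto
    have "poly (ac_poly F) \<alpha> = (\<Sum>k<?D. to_ac (u (\<alpha> ^ k)) * \<alpha> ^ k)"
      unfolding comb[OF dF] by (intro sum.cong) (auto simp: cF)
    also have "\<dots> = (\<Sum>x\<in>B. to_ac (u x) * x)" unfolding B_def by (simp add: sum.reindex[OF inj])
    finally have "F = 0" using sum dF low by simp
    obtain k where "k < ?D" "x = \<alpha> ^ k" using x by (auto simp: B_def)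
    then show "u x = 0" using cF[of k] \<open>F = 0\<close> by simp
  qed
  moreover have "B \<subseteq> adjoin \<alpha>"
  proof
    fix x assume "x \<in> B"
    then obtain k where "x = \<alpha> ^ k" by (auto simp: B_def)
    then have "x = poly (ac_poly (monom 1 k)) \<alpha> / poly (ac_poly 1) \<alpha>"
      by (simp add: ac_poly_monom poly_monom)
    then show "x \<in> adjoin \<alpha>" unfolding adjoin_def by blast
  qed
  moreover have "adjoin \<alpha> \<subseteq> ac.span B"
  proof
    fix x assume "x \<in> adjoin \<alpha>"
    then obtain g h where x: "x = poly (ac_poly g) \<alpha> / poly (ac_poly h) \<alpha>" by (auto simp: adjoin_def)
    have "\<exists>F. x = poly (ac_poly F) \<alpha>"
    proof (cases "poly (ac_poly h) \<alpha> = 0")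
      \<comment> \<open>Division by 0 gives 0, so fractions with a denominator vanishing at \<alpha>
        add only the element 0 to \<open>adjoin\<close>.\<close>
      case True then show ?thesis using x by (intro exI[of _ 0]) simp
    next
      case False
      \<comment> \<open>The Bezout coefficient of the denominator is its inverse at \<alpha>, which
        makes every fraction a polynomial in \<alpha>.\<close>
      then obtain u v where "u * ?P + v * h = 1" using min_poly_bezout by blast
      then have "poly (ac_poly (u * ?P + v * h)) \<alpha> = 1" by simp
      then have "poly (ac_poly v) \<alpha> * poly (ac_poly h) \<alpha> = 1" by (simp add: ac_poly_add ac_poly_mult)
      then have "x = poly (ac_poly (g * v)) \<alpha>" using False by (simp add: x ac_poly_mult field_simps)
      then show ?thesis by blast
    qed
    then obtain F where F: "x = poly (ac_poly F) \<alpha>" by blast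
    have "F = F div ?P * ?P + F mod ?P" by simp
    then have "poly (ac_poly F) \<alpha> = poly (ac_poly (F div ?P)) \<alpha> * poly (ac_poly ?P) \<alpha> + poly (ac_poly (F mod ?P)) \<alpha>"
      by (metis ac_poly_add ac_poly_mult poly_add poly_mult)
    then have "x = poly (ac_poly (F mod ?P)) \<alpha>" using F by simp
    moreover have "degree (F mod ?P) < ?D"
      using degree_mod_less[of ?P F] degree_min_poly_pos[of \<alpha>] by auto
    ultimately have "x = (\<Sum>k<?D. to_ac (coeff (F mod ?P) k) * \<alpha> ^ k)" using comb by simp
    also have "\<dots> \<in> ac.span B"
      by (intro ac.span_sum ac.span_scale ac.span_base) (auto simp: B_def)
    finally show "x \<in> ac.span B" .
  qed
  ultimately have "card B = ac.dim (adjoin \<alpha>)" by (intro ac.basis_card_eq_dim)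
  then show ?thesis by (simp add: ext_degree_def B_def card_image[OF inj])
qed

section \<open>Polynomials as series\<close>

declare of_nat_power [simp del] residue_char_pos [simp]

lemma residue_char_neq_0 [simp]: "residue_char TYPE('a::perfectoid_field) \<noteq> 0"
  using residue_char_pos by simp

lemma of_nat_div_in_exponents_level: "of_nat k / of_nat (p ^ j) \<in> exponents_level p j"
  unfolding exponents_level_def by (auto intro!: exI[of _ "int k"])

lemma of_int_div_in_exponents_level: "of_int k / of_nat (p ^ j) \<in> exponents_level p j"
  unfolding exponents_level_def by auto

lemma poly_series_at:
  fixes G :: "'a::perfectoid_field poly"
  shows "poly_series j G (of_nat k / of_nat (residue_char TYPE('a) ^ j)) = coeff G k"
proof -
  have "(of_nat (residue_char TYPE('a) ^ j) :: rat) \<noteq> 0"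
    using residue_char_pos[where 'a='a] by simp
  then show ?thesis
    using of_nat_div_in_exponents_level[of k "residue_char TYPE('a)" j]
    by (simp add: poly_series_def)
qed

lemma poly_series_nonzeroE:
  fixes G :: "'a::perfectoid_field poly"
  assumes "poly_series j G n \<noteq> 0"
  obtains k where "n = of_nat k / of_nat (residue_char TYPE('a) ^ j)" "coeff G k \<noteq> 0" "k \<le> degree G"
proof -
  let ?N = "residue_char TYPE('a) ^ j"
  have N: "(of_nat ?N :: rat) > 0" using residue_char_pos[where 'a='a] by simp
  have n: "n \<in> exponents_level (residue_char TYPE('a)) j" "0 \<le> n" "coeff G (nat \<lfloor>n * of_nat ?N\<rfloor>) \<noteq> 0"
    using assms by (auto simp: poly_series_def split: if_splits)
  then obtain m where m: "n = of_int m / of_nat ?N" by (auto simp: exponents_level_def)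
  then have "0 \<le> m" using n N by (simp add: zero_le_divide_iff)
  then have "n = of_nat (nat m) / of_nat ?N" "\<lfloor>n * of_nat ?N\<rfloor> = m" using m N by auto
  then show ?thesis using that[of "nat m"] n by (simp add: le_degree)
qed

lemma poly_series_eq_0I:
  fixes G :: "'a::perfectoid_field poly"
  assumes "n \<notin> (\<lambda>k. of_nat k / of_nat (residue_char TYPE('a) ^ j)) ` {..degree G}"
  shows "poly_series j G n = 0"
proof (rule ccontr)
  assume "poly_series j G n \<noteq> 0"
  then show False using assms by (elim poly_series_nonzeroE) blast
qed

lemma lev_poly_series: "lev j (poly_series j G)"
  by (auto simp: lev_def poly_series_def)

lemma finite_poly_series: "finite {n. poly_series j (G::'a::perfectoid_field poly) n \<noteq> 0}"
proof (rule finite_subset)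
  show "{n. poly_series j G n \<noteq> 0} \<subseteq> (\<lambda>k. of_nat k / of_nat (residue_char TYPE('a) ^ j)) ` {..degree G}"
    by (auto elim!: poly_series_nonzeroE)
qed simp

lemma null_at_poly_series [simp]: "null_at s (poly_series j G)"
  unfolding null_at_iff
proof (intro allI impI)
  fix e :: real assume "e > 0"
  then have "{n. e \<le> absv (poly_series j G n) * s powr of_rat n} \<subseteq> {n. poly_series j G n \<noteq> 0}"
    by auto
  then show "finite {n. e \<le> absv (poly_series j G n) * s powr of_rat n}"
    using finite_poly_series finite_subset by blast
qed

lemma poly_series_eq_0_iff [simp]: "poly_series j G = (\<lambda>_. 0) \<longleftrightarrow> G = (0 :: 'a::perfectoid_field poly)"
proof
  assume "poly_series j G = (\<lambda>_. 0)"
  then have "coeff G k = 0" for k using poly_series_at[of j G k] by simp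
  then show "G = 0" by (simp add: poly_eq_iff)
qed (auto simp: poly_series_def)

lemma poly_series_add: "poly_series j (A + B) n = poly_series j A n + poly_series j B n"
  by (simp add: poly_series_def)

lemma poly_series_const: "poly_series j [:c:] = const_series (c :: 'a::perfectoid_field)"
proof
  fix n
  show "poly_series j [:c:] n = const_series c n"
  proof (cases "n = 0")
    case True
    then show ?thesis using exponents_level_closed(1) by (simp add: poly_series_def const_series_def)
  next
    case False
    have "poly_series j [:c:] n = 0"
    proof (rule ccontr)
      assume "poly_series j [:c:] n \<noteq> 0"
      then show False by (rule poly_series_nonzeroE) (use False in auto)
    qed
    then show ?thesis using False by (simp add: const_series_def)
  qed
qed

lemma poly_series_1 [simp]: "poly_series j 1 = const_series 1"
  using poly_series_const[of j 1] by (simp add: one_pCons)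

lemma cauchy_prod_poly_series:
  fixes G :: "'a::perfectoid_field poly"
  shows "(poly_series j G \<star> a) n =
    (\<Sum>k\<le>degree G. coeff G k * a (n - of_nat k / of_nat (residue_char TYPE('a) ^ j)))"
proof -
  let ?N = "residue_char TYPE('a) ^ j"
  let ?f = "\<lambda>k. of_nat k / (of_nat ?N :: rat)"
  have N: "(of_nat ?N :: rat) \<noteq> 0" using residue_char_pos[where 'a='a] by simp
  have inj: "inj_on ?f {..degree G}" using N by (auto simp: inj_on_def)
  have "(poly_series j G \<star> a) n = (\<Sum>\<^sub>\<infinity>m\<in>?f ` {..degree G}. poly_series j G m * a (n - m))"
    unfolding cauchy_prod_def by (rule infsum_cong_neutral) (use poly_series_eq_0I[of _ j G] in auto)
  also have "\<dots> = (\<Sum>k\<le>degree G. coeff G k * a (n - ?f k))"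
    by (simp add: sum.reindex[OF inj] poly_series_at)
  finally show ?thesis .
qed

lemma poly_series_mult:
  fixes A B :: "'a::perfectoid_field poly"
  shows "poly_series j (A * B) = poly_series j A \<star> poly_series j B"
proof
  fix n
  let ?N = "residue_char TYPE('a) ^ j"
  have N: "(of_nat ?N :: rat) > 0" using residue_char_pos[where 'a='a] by simp
  have zero: "poly_series j C n = 0" if "\<And>k. n \<noteq> of_nat k / of_nat ?N" for C :: "'a poly" and n
    using that by (metis poly_series_nonzeroE)
  show "poly_series j (A * B) n = (poly_series j A \<star> poly_series j B) n"
  proof (cases "\<exists>m. n = of_nat m / of_nat ?N")
    case True
    then obtain m where m: "n = of_nat m / of_nat ?N" by blast
    have sub: "poly_series j B (n - of_nat k / of_nat ?N) = (if k \<le> m then coeff B (m - k) else 0)" for k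
    proof (cases "k \<le> m")
      case True
      then have "n - of_nat k / of_nat ?N = of_nat (m - k) / of_nat ?N"
        unfolding m by (simp only: of_nat_diff diff_divide_distrib)
      then show ?thesis using True by (simp only: poly_series_at if_True)
    next
      case False
      then have "n - of_nat k / of_nat ?N < 0" unfolding m using N by (simp add: divide_less_cancel)
      then show ?thesis using False by (simp add: poly_series_def)
    qed
    have "(poly_series j A \<star> poly_series j B) n = (\<Sum>k\<le>degree A. coeff A k * (if k \<le> m then coeff B (m - k) else 0))"
      unfolding cauchy_prod_poly_series sub ..
    also have "\<dots> = (\<Sum>k\<le>m. coeff A k * coeff B (m - k))"
      by (rule sum.mono_neutral_cong) (auto simp: coeff_eq_0)
    finally show ?thesis by (simp add: m poly_series_at coeff_mult)
  next
    case False
    have "poly_series j B (n - of_nat k / of_nat ?N) = 0" for k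
    proof (rule zero)
      fix l
      show "n - of_nat k / of_nat ?N \<noteq> of_nat l / of_nat ?N"
      proof
        assume "n - of_nat k / of_nat ?N = of_nat l / of_nat ?N"
        then have "n = of_nat (l + k) / of_nat ?N" by (simp add: add_divide_distrib algebra_simps)
        with False show False by blast
      qed
    qed
    then have "(poly_series j A \<star> poly_series j B) n = 0" unfolding cauchy_prod_poly_series by simp
    moreover have "poly_series j (A * B) n = 0" using False by (intro zero) auto
    ultimately show ?thesis by simp
  qed
qed

text \<open>With Z = X^(1/p^(j+e)) the variable of level j is Z^(p^e). This lets polynomial parts
  written at different levels be compared at a common one.\<close>

lemma poly_series_pcompose:
  fixes G :: "'a::perfectoid_field poly"
  shows "poly_series (j + e) (pcompose G (monom 1 (residue_char TYPE('a) ^ e))) = poly_series j G"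
proof
  fix n
  let ?p = "residue_char TYPE('a)" and ?G = "pcompose G (monom 1 (residue_char TYPE('a) ^ e))"
  have p: "(of_nat ?p :: rat) > 0" "?p ^ e > 0" using residue_char_pos[where 'a='a] by auto
  have at: "poly_series (j + e) ?G (of_nat k / of_nat (?p ^ j)) = coeff G k" for k
  proof -
    have "of_nat k / of_nat (?p ^ j) = (of_nat (k * ?p ^ e) / of_nat (?p ^ (j + e)) :: rat)"
      using p by (simp add: power_add)
    then show ?thesis using p poly_series_at[of "j + e" ?G "k * ?p ^ e"] by (simp add: coeff_pcompose_power)
  qed
  show "poly_series (j + e) ?G n = poly_series j G n"
  proof (cases "\<exists>k. n = of_nat k / of_nat (?p ^ j)")
    case True
    then show ?thesis using at poly_series_at[of j G] by metis
  next
    case False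
    have "poly_series j G n = 0" using False by (metis poly_series_nonzeroE)
    moreover have "poly_series (j + e) ?G n = 0"
    proof (rule ccontr)
      assume "poly_series (j + e) ?G n \<noteq> 0"
      then obtain k where k: "n = of_nat k / of_nat (?p ^ (j + e))" "coeff ?G k \<noteq> 0"
        by (rule poly_series_nonzeroE)
      then obtain l where "k = ?p ^ e * l" using p by (auto simp: coeff_pcompose_power split: if_splits)
      then have "n = of_nat l / of_nat (?p ^ j)" using k p by (simp add: power_add)
      with False show False by blast
    qed
    ultimately show ?thesis by simp
  qed
qed

lemma series_eq_poly_series:
  fixes b :: "rat \<Rightarrow> 'a::perfectoid_field"
  assumes b: "lev i b" and supp: "\<And>n. n < 0 \<or> M < n \<Longrightarrow> b n = 0" and M: "0 \<le> M"
  obtains G where "b = poly_series i G" "of_nat (degree G) \<le> M * of_nat (residue_char TYPE('a) ^ i)"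
proof -
  let ?N = "residue_char TYPE('a) ^ i"
  have N: "(of_nat ?N :: rat) > 0" using residue_char_pos[where 'a='a] by simp
  define m where "m = nat \<lfloor>M * of_nat ?N\<rfloor>"
  have large: "M < of_nat k / of_nat ?N" if "k > m" for k
  proof -
    have "M * of_nat ?N < of_nat k" using that unfolding m_def by linarith
    then show ?thesis using N by (simp add: pos_less_divide_eq)
  qed
  have "\<forall>\<^sub>\<infinity>k. b (of_nat k / of_nat ?N) = 0"
    unfolding MOST_nat using large supp by blast
  then have c: "coeff (Abs_poly (\<lambda>k. b (of_nat k / of_nat ?N))) k = b (of_nat k / of_nat ?N)" for k
    by (simp add: Abs_poly_inverse)
  define G where "G = Abs_poly (\<lambda>k. b (of_nat k / of_nat ?N))"
  have "degree G \<le> m" unfolding G_def by (rule degree_le) (use c large supp in auto)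
  then have "of_nat (degree G) \<le> M * of_nat ?N" unfolding m_def using M N by (simp add: le_nat_iff le_floor_iff)
  moreover have "b = poly_series i G"
  proof
    fix n
    show "b n = poly_series i G n"
    proof (cases "\<exists>k. n = of_nat k / of_nat ?N")
      case True
      then show ?thesis using poly_series_at[of i G] c unfolding G_def by metis
    next
      case False
      have "b n = 0"
      proof (rule ccontr)
        assume "b n \<noteq> 0"
        then have "n \<in> exponents_level (residue_char TYPE('a)) i" "0 \<le> n"
          using b levD supp by (blast, metis linorder_not_less)
        then obtain k where k: "n = of_int k / of_nat ?N" by (auto simp: exponents_level_def)
        then have "0 \<le> k" using \<open>0 \<le> n\<close> N by (simp add: zero_le_divide_iff)
        then have "n = of_nat (nat k) / of_nat ?N" using k by simp
        with False show False by blast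
      qed
      moreover have "poly_series i G n = 0" using False by (metis poly_series_nonzeroE)
      ultimately show ?thesis by simp
    qed
  qed
  ultimately show ?thesis using that by blast
qed

text \<open>The circle |X| = t^N is the circle |Y| = t, on which the terms of \<open>G\<close> have
  their usual sizes.\<close>

lemma wabs_poly_series:
  fixes G :: "'a::perfectoid_field poly"
  assumes "t > 0"
  shows "wabs (t ^ (residue_char TYPE('a) ^ j)) (poly_series j G) (of_nat k / of_nat (residue_char TYPE('a) ^ j)) =
         absv (coeff G k) * t ^ k"
proof -
  let ?N = "residue_char TYPE('a) ^ j"
  have N: "real ?N > 0" using residue_char_pos[where 'a='a] by simp
  have "(t ^ ?N) powr of_rat (of_nat k / of_nat ?N) = (t powr real ?N) powr (real k / real ?N)"
    by (simp only: powr_realpow[OF assms] of_rat_divide of_rat_of_nat_eq)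
  also have "\<dots> = t powr real k" unfolding powr_powr using N by simp
  also have "\<dots> = t ^ k" by (rule powr_realpow[OF assms])
  finally show ?thesis by (simp add: wabs_def poly_series_at)
qed

lemma cauchy_prod_mult_swap:
  fixes a b c d :: "rat \<Rightarrow> 'b::{nonarch_field,complete_space}"
  assumes s: "s > 0" and n: "null_at s a" "null_at s b" "null_at s c" "null_at s d"
  shows "a \<star> c \<star> (b \<star> d) = a \<star> b \<star> (c \<star> d)"
proof -
  have "a \<star> c \<star> (b \<star> d) = a \<star> (c \<star> (b \<star> d))"
    using s n by (intro cauchy_prod_assoc'[of s] null_at_cauchy_prod)
  also have "c \<star> (b \<star> d) = b \<star> (c \<star> d)" using s n by (intro cauchy_prod_left_commute[of s])
  also have "a \<star> (b \<star> (c \<star> d)) = a \<star> b \<star> (c \<star> d)"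
    using s n by (intro cauchy_prod_assoc'[of s, symmetric] null_at_cauchy_prod)
  finally show ?thesis .
qed

section \<open>Existence of Weierstrass factorisations\<close>

text \<open>The unit and its inverse are both kept at level \<open>i\<close>, so that quotients
  formed with them are again series in \<open>Y\<close>.\<close>

definition unit_on :: "real \<Rightarrow> real \<Rightarrow> nat \<Rightarrow> (rat \<Rightarrow> 'a::perfectoid_field) \<Rightarrow> (rat \<Rightarrow> 'a) \<Rightarrow> bool" where
  "unit_on r r' i u v \<longleftrightarrow> lev i u \<and> lev i v \<and>
     (\<forall>s. r \<le> s \<longrightarrow> s \<le> r' \<longrightarrow> null_at s u \<and> null_at s v) \<and> u \<star> v = const_series 1"

lemma unit_on_mult:
  assumes u: "unit_on r r' i u v" and u': "unit_on r r' i u' v'" and r: "0 < r" "r \<le> r'"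
  shows "unit_on r r' i (u \<star> u') (v \<star> v')"
  unfolding unit_on_def
proof (intro conjI allI impI)
  have n: "null_at s u" "null_at s v" "null_at s u'" "null_at s v'" if "r \<le> s" "s \<le> r'" for s
    using u u' that by (auto simp: unit_on_def)
  note n' = n[OF order_refl r(2)]
  show "lev i (u \<star> u')" "lev i (v \<star> v')" using u u' by (auto simp: unit_on_def intro: lev_mult)
  show "null_at s (u \<star> u')" "null_at s (v \<star> v')" if "r \<le> s" "s \<le> r'" for s
    using n[OF that] r that by (auto intro: null_at_cauchy_prod)
  have "u \<star> u' \<star> (v \<star> v') = u \<star> v \<star> (u' \<star> v')"
    by (rule cauchy_prod_mult_swap[OF r(1) n'])
  then show "u \<star> u' \<star> (v \<star> v') = const_series 1" using u u' by (simp add: unit_on_def)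
qed

lemma unit_on_mono:
  assumes "m \<in> exponents_level (residue_char TYPE('a)) i" "c \<noteq> (0::'a::perfectoid_field)"
  shows "unit_on r r' i (mono_series m c) (mono_series (- m) (inverse c))"
  using assms by (simp add: unit_on_def lev_mono exponents_level_closed(3) mono_series_mult mono_series_0)

text \<open>The multiplier cuts the series down to exponents in [m, M], and a shift by
  \<open>m\<close> makes it a polynomial in \<open>Y\<close>. The bound on the degree is what later
  detects units and compares the absolute values of conjugates.\<close>

lemma weierstrass_factorisation:
  fixes a :: "rat \<Rightarrow> 'a::perfectoid_field"
  assumes a: "lev i a" and null: "\<And>s. s > 0 \<Longrightarrow> null_at s a" and r: "0 < r" "r \<le> r'"
    and m: "first_term r a m" and M: "last_term r' a M"
  obtains G u v where "G \<noteq> 0" "of_nat (degree G) \<le> (M - m) * of_nat (residue_char TYPE('a) ^ i)"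
    "unit_on r r' i u v" "a = poly_series i G \<star> u"
proof -
  obtain q v where q: "lev i q" "lev i v" "\<And>s. r \<le> s \<Longrightarrow> s \<le> r' \<Longrightarrow> null_at s q"
    "\<And>s. r \<le> s \<Longrightarrow> s \<le> r' \<Longrightarrow> null_at s v" "q \<star> v = const_series 1"
    "\<And>k. k < m \<or> M < k \<Longrightarrow> (q \<star> a) k = 0"
    by (rule weierstrass_multiplier[OF a null r m M]) (blast+)
  have un: "unit_on r r' i v q" using q by (auto simp: unit_on_def cauchy_prod_commute)
  have nr: "null_at r q" "null_at r v" "null_at r a" using q(3,4)[of r] null r by auto
  have mE: "m \<in> exponents_level (residue_char TYPE('a)) i" using m a levD by (auto simp: first_term_def)
  define b where "b = mono_series (- m) 1 \<star> (q \<star> a)"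
  have lb: "lev i b" unfolding b_def using mE a q by (intro lev_mult lev_mono exponents_level_closed(3))
  have nb: "null_at r b" unfolding b_def using nr r by (intro null_at_cauchy_prod) auto
  have bval: "b k = (q \<star> a) (k + m)" for k by (simp add: b_def cauchy_prod_mono)
  have ab: "a = b \<star> (mono_series m 1 \<star> v)"
  proof -
    have "v \<star> (q \<star> a) = v \<star> q \<star> a" using nr r by (simp only: cauchy_prod_assoc')
    then have qav: "q \<star> a \<star> v = a" using q(5) by (simp add: cauchy_prod_commute[of _ v])
    have "b \<star> (mono_series m 1 \<star> v) = mono_series m 1 \<star> (b \<star> v)"
      using nr nb r by (intro cauchy_prod_left_commute[of r]) auto
    also have "b \<star> v = mono_series (- m) 1 \<star> (q \<star> a \<star> v)"
      unfolding b_def using nr r by (intro cauchy_prod_assoc'[of r] null_at_cauchy_prod) auto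
    finally show ?thesis by (simp add: qav cauchy_prod_mono)
  qed
  have b0: "b \<noteq> (\<lambda>_. 0)"
  proof
    assume "b = (\<lambda>_. 0)"
    then have "a = (\<lambda>_. 0)" using ab by simp
    then show False using m by (simp add: first_term_def)
  qed
  have supp: "b k = 0" if "k < 0 \<or> M - m < k" for k using q(6)[of "k + m"] that by (auto simp: bval)
  have "0 \<le> M - m"
  proof (rule ccontr)
    assume "\<not> ?thesis"
    then have "b k = 0" for k using supp[of k] by linarith
    with b0 show False by auto
  qed
  with series_eq_poly_series[OF lb supp] obtain G where
    G: "b = poly_series i G" "of_nat (degree G) \<le> (M - m) * of_nat (residue_char TYPE('a) ^ i)" by blast
  show ?thesis
  proof (rule that[of G "mono_series m 1 \<star> v" "mono_series (- m) 1 \<star> q"])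
    show "G \<noteq> 0" using b0 G by auto
    show "unit_on r r' i (mono_series m 1 \<star> v) (mono_series (- m) 1 \<star> q)"
      using unit_on_mult[OF unit_on_mono[OF mE, of 1] un r] by simp
  qed (use G ab in auto)
qed

lemma weierstrass_factorisation_exists:
  fixes a :: "rat \<Rightarrow> 'a::perfectoid_field"
  assumes a: "lev i a" and null: "\<And>s. s > 0 \<Longrightarrow> null_at s a" and r: "0 < r" "r \<le> r'"
    and ne: "a \<noteq> (\<lambda>_. 0)"
  obtains G u v where "G \<noteq> 0" "unit_on r r' i u v" "a = poly_series i G \<star> u"
proof -
  obtain k where "a k \<noteq> 0" using ne by auto
  then obtain m M where "first_term r a m" "last_term r' a M"
    using first_term_exists[OF r(1) null[OF r(1)]] last_term_exists[of r' a] null[of r'] r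
    by (metis less_le_trans)
  then show ?thesis using weierstrass_factorisation[OF a null r] that by blast
qed

text \<open>With the same dominant exponent at both ends, the degree bound forces the polynomial
  part to be constant.\<close>

lemma sole_term_unit:
  fixes a :: "rat \<Rightarrow> 'a::perfectoid_field"
  assumes a: "lev i a" and null: "\<And>s. s > 0 \<Longrightarrow> null_at s a" and r: "0 < r" "r \<le> r'"
    and n: "sole_term r a n" "sole_term r' a n"
  obtains v where "unit_on r r' i a v"
proof -
  obtain G u v where G: "G \<noteq> 0" "of_nat (degree G) \<le> (n - n) * of_nat (residue_char TYPE('a) ^ i)"
    "unit_on r r' i u v" "a = poly_series i G \<star> u"
    using weierstrass_factorisation[OF a null r, of n n] n[THEN sole_term_imp] by blast
  then have "degree G = 0" by simp
  then obtain c where c: "G = [:c:]" by (rule degree_eq_zeroE)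
  then have "c \<noteq> 0" using G by simp
  then have "unit_on r r' i (poly_series i G) (const_series (inverse c))"
    using unit_on_mono[of 0 i c r r'] exponents_level_closed(1) by (simp add: c poly_series_const mono_series_0)
  from unit_on_mult[OF this G(3) r] show ?thesis using that G(4) by auto
qed

section \<open>The absolute value of the algebraic closure\<close>

locale abs_extension =
  fixes w :: "'a::perfectoid_field alg_closure \<Rightarrow> real"
  assumes ext: "extends_absv w"
begin

lemma w_ge_0 [simp]: "0 \<le> w x" and w_eq_0 [simp]: "w x = 0 \<longleftrightarrow> x = 0"
  and w_mult: "w (x * y) = w x * w y" and w_add_le: "w (x + y) \<le> max (w x) (w y)"
  and w_to_ac [simp]: "w (to_ac c) = absv c"
  using ext unfolding extends_absv_def by blast+

lemma w_pos [simp]: "0 < w x \<longleftrightarrow> x \<noteq> 0"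
  using w_ge_0[of x] w_eq_0[of x] by linarith

lemma w_0 [simp]: "w 0 = 0" by simp

lemma w_1 [simp]: "w 1 = 1" using w_to_ac[of 1] by simp

lemma w_uminus [simp]: "w (- x) = w x"
  using w_mult[of "to_ac (- 1)" x] w_to_ac[of "- 1"] by simp

lemma w_diff_le: "w (x - y) \<le> max (w x) (w y)"
  using w_add_le[of x "- y"] by simp

lemma w_power: "w (x ^ n) = w x ^ n"
  by (induction n) (auto simp: w_mult)

lemma w_power_int: "w (x powi n) = w x powi n"
proof -
  have "w (inverse x) = inverse (w x)" for x
  proof (cases "x = 0")
    case False
    then have "w x * w (inverse x) = 1" by (simp flip: w_mult)
    then show ?thesis by (metis inverse_unique)
  qed simp
  then show ?thesis by (simp add: power_int_def w_power)
qed

lemma w_add_eq: "w y < w x \<Longrightarrow> w (x + y) = w x"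
  using w_add_le[of x y] w_diff_le[of "x + y" y] by simp

lemma w_diff_eq: "w y < w x \<Longrightarrow> w (x - y) = w x"
  using w_add_eq[of "- y" x] by simp

lemma w_sum_less:
  assumes "finite A" "\<And>k. k \<in> A \<Longrightarrow> w (f k) < B" "0 < B"
  shows "w (sum f A) < B"
  using assms
proof (induction A rule: finite_induct)
  case (insert k A)
  have "w (f k + sum f A) \<le> max (w (f k)) (w (sum f A))" by (rule w_add_le)
  also have "\<dots> < B" using insert by auto
  finally show ?case using insert by simp
qed auto

lemma sum_dominant_nonzero:
  assumes "finite A" "n \<in> A" "f n \<noteq> 0" "\<And>k. k \<in> A \<Longrightarrow> k \<noteq> n \<Longrightarrow> w (f k) < w (f n)"
  shows "sum f A \<noteq> 0"
proof
  assume "sum f A = 0"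
  then have "f n = - sum f (A - {n})" using assms by (simp add: sum.remove add_eq_0_iff2)
  moreover have "w (sum f (A - {n})) < w (f n)" using assms by (intro w_sum_less) auto
  ultimately show False by simp
qed

text \<open>A root forces its polynomial to have two dominant terms on the circle through it.\<close>

lemma min_poly_not_unit:
  assumes "\<beta> \<noteq> 0" and u: "null_at (w \<beta> ^ (residue_char TYPE('a) ^ j)) u"
  shows "poly_series j (min_poly \<beta>) \<star> u \<noteq> const_series 1"
proof
  let ?N = "residue_char TYPE('a) ^ j" and ?R = "min_poly \<beta>"
  assume "poly_series j ?R \<star> u = const_series 1"
  moreover have t: "w \<beta> ^ ?N > 0" using assms by simp
  ultimately obtain n where n: "sole_term (w \<beta> ^ ?N) (poly_series j ?R) n"
    using unit_sole_term[OF t null_at_poly_series u] by blast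
  then obtain l where l: "n = of_nat l / of_nat ?N" "coeff ?R l \<noteq> 0" "l \<le> degree ?R"
    unfolding sole_term_def using poly_series_nonzeroE by metis
  have wt: "w (to_ac (coeff ?R k) * \<beta> ^ k) = wabs (w \<beta> ^ ?N) (poly_series j ?R) (of_nat k / of_nat ?N)" for k
    using assms wabs_poly_series[of "w \<beta>" j ?R k] by (simp add: w_mult w_power)
  have N: "(of_nat ?N :: rat) \<noteq> 0" using residue_char_pos[where 'a='a] by simp
  have "(\<Sum>k\<le>degree ?R. to_ac (coeff ?R k) * \<beta> ^ k) \<noteq> 0"
  proof (rule sum_dominant_nonzero[of _ l])
    fix k assume "k \<noteq> l"
    then have "of_nat k / of_nat ?N \<noteq> n" using l N by simp
    then show "w (to_ac (coeff ?R k) * \<beta> ^ k) < w (to_ac (coeff ?R l) * \<beta> ^ l)"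
      unfolding wt using n l(1) by (simp add: sole_term_def)
  qed (use l assms in auto)
  then show False using poly_min_poly[of \<beta>] by (simp add: poly_altdef)
qed

text \<open>The minimal polynomial of \<beta> is split off from both sides as long as \<beta> is a
  root of \<open>A\<close>. If \<beta> were a root of \<open>A\<close> but not of \<open>B\<close>,
  a Bezout identity would invert this minimal polynomial on the circle through \<beta>.\<close>

lemma order_le_of_unit_multiple:
  assumes \<beta>: "\<beta> \<noteq> 0" and U: "null_at (w \<beta> ^ (residue_char TYPE('a) ^ j)) U" "U \<noteq> (\<lambda>_. 0)"
    and "A \<noteq> 0" "poly_series j A \<star> U = poly_series j B"
  shows "B \<noteq> 0 \<and> order \<beta> (ac_poly A) \<le> order \<beta> (ac_poly B)"
  using assms(4,5)
proof (induction "degree A" arbitrary: A B rule: less_induct)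
  case less
  let ?t = "w \<beta> ^ (residue_char TYPE('a) ^ j)" and ?R = "min_poly \<beta>"
  have t: "?t > 0" using \<beta> by simp
  have B0: "B \<noteq> 0"
  proof
    assume "B = 0"
    then have "poly_series j A \<star> U = (\<lambda>_. 0)" using less.prems by simp
    then show False using cauchy_prod_eq_0D[OF t null_at_poly_series U(1)] less.prems(1) U(2) by simp
  qed
  show ?case
  proof (cases "poly (ac_poly A) \<beta> = 0")
    case False
    then show ?thesis using B0 by (simp add: order_0I)
  next
    case True
    then have "?R dvd A" by (simp add: min_poly_dvd_iff)
    then obtain A' where A': "A = ?R * A'" by (elim dvdE)
    then have A'0: "A' \<noteq> 0" using less.prems by auto
    have psA: "poly_series j A \<star> U = poly_series j ?R \<star> (poly_series j A' \<star> U)"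
      unfolding A' poly_series_mult by (rule cauchy_prod_assoc'[OF t _ _ U(1)]) simp_all
    have "poly (ac_poly B) \<beta> = 0"
    proof (rule ccontr)
      assume "\<not> ?thesis"
      then obtain x y where xy: "x * ?R + y * B = 1" using min_poly_bezout by blast
      \<comment> \<open>The inverse in question: with R the minimal polynomial, A = R A' and B = A
        U, the identity x R + y B = 1 reads R (x + y A' U) = 1.\<close>
      define V where "V = (\<lambda>n. poly_series j x n + (poly_series j y \<star> (poly_series j A' \<star> U)) n)"
      have n2: "null_at ?t (poly_series j y \<star> (poly_series j A' \<star> U))"
        using t U by (intro null_at_cauchy_prod) auto
      have nV: "null_at ?t V" unfolding V_def using n2 by (intro null_at_add) auto
      have "V \<star> poly_series j ?R =
          (\<lambda>n. (poly_series j x \<star> poly_series j ?R) n + (poly_series j y \<star> (poly_series j A' \<star> U) \<star> poly_series j ?R) n)"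
        unfolding V_def using t n2 by (intro cauchy_prod_distrib[of ?t]) auto
      also have "poly_series j y \<star> (poly_series j A' \<star> U) \<star> poly_series j ?R =
          poly_series j y \<star> (poly_series j ?R \<star> (poly_series j A' \<star> U))"
        unfolding cauchy_prod_commute[of _ "poly_series j ?R"]
        using t U by (intro cauchy_prod_left_commute[of ?t] null_at_cauchy_prod) auto
      also have "\<dots> = poly_series j y \<star> poly_series j B" unfolding psA[symmetric] less.prems(2) ..
      also have "(\<lambda>n. (poly_series j x \<star> poly_series j ?R) n + (poly_series j y \<star> poly_series j B) n) =
          poly_series j (x * ?R + y * B)"
        by (simp only: fun_eq_iff poly_series_add poly_series_mult) simp
      also have "\<dots> = const_series 1" unfolding xy by simp
      finally have "poly_series j ?R \<star> V = const_series 1" by (simp add: cauchy_prod_commute)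
      with min_poly_not_unit[OF \<beta> nV] show False by simp
    qed
    then have "?R dvd B" by (simp add: min_poly_dvd_iff)
    then obtain B' where B': "B = ?R * B'" by (elim dvdE)
    have "poly_series j A' \<star> U = poly_series j B'"
    proof (rule cauchy_prod_cancel[OF t])
      show "poly_series j ?R \<star> (poly_series j A' \<star> U) = poly_series j ?R \<star> poly_series j B'"
        using psA less.prems(2) by (simp add: B' poly_series_mult)
    qed (use t U in \<open>auto intro: null_at_cauchy_prod\<close>)
    moreover have "degree A' < degree A"
      using A'0 degree_min_poly_pos[of \<beta>] by (simp add: A' degree_mult_eq)
    ultimately have "order \<beta> (ac_poly A') \<le> order \<beta> (ac_poly B')" using less.hyps A'0 by blast
    then have "order \<beta> (ac_poly A') \<le> order \<beta> (ac_poly B')" by blast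
    moreover have "B' \<noteq> 0" using B0 B' by auto
    ultimately show ?thesis using B0 A'0 unfolding A' B' by (simp add: ac_poly_mult order_mult)
  qed
qed

text \<open>A factorisation on a single circle, with no condition on the exponents of the units. In
  this form it covers every presentation that \<open>ord_at\<close> admits.\<close>

definition weierstrass_at :: "real \<Rightarrow> nat \<Rightarrow> (rat \<Rightarrow> 'a) \<Rightarrow> 'a poly \<Rightarrow> bool" where
  "weierstrass_at t j a G \<longleftrightarrow> G \<noteq> 0 \<and>
     (\<exists>u v. null_at t u \<and> null_at t v \<and> u \<star> v = const_series 1 \<and> a = poly_series j G \<star> u)"

text \<open>Two polynomial parts of one series are unit multiples of each other on the circle, so
  neither order exceeds the other. The radius is |\<beta>|^N because \<beta> is a value of
  \<open>Y\<close> and the circle is one for X.\<close>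

lemma weierstrass_at_unique:
  assumes \<beta>: "\<beta> \<noteq> 0" and t: "t = w \<beta> ^ (residue_char TYPE('a) ^ j)"
    and G: "weierstrass_at t j a G" and H: "weierstrass_at t j a H"
  shows "order \<beta> (ac_poly G) = order \<beta> (ac_poly H)"
proof -
  have t0: "t > 0" using \<beta> t by simp
  have le: "order \<beta> (ac_poly G) \<le> order \<beta> (ac_poly H)" if G: "weierstrass_at t j a G" and H: "weierstrass_at t j a H" for G H
  proof -
    obtain u v u' v' where u: "null_at t u" "null_at t v" "u \<star> v = const_series 1" "a = poly_series j G \<star> u"
      and u': "null_at t u'" "null_at t v'" "u' \<star> v' = const_series 1" "a = poly_series j H \<star> u'"
      using G H unfolding weierstrass_at_def by metis
    have "poly_series j G \<star> (u \<star> v') = a \<star> v'" using u u' t0 by (simp add: cauchy_prod_assoc'[of t])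
    also have "\<dots> = poly_series j H \<star> (u' \<star> v')" unfolding u'(4) using u' t0 by (intro cauchy_prod_assoc'[of t]) auto
    finally have eq: "poly_series j G \<star> (u \<star> v') = poly_series j H" using u' by simp
    have "u \<star> v' \<noteq> (\<lambda>_. 0)"
    proof
      assume "u \<star> v' = (\<lambda>_. 0)"
      then have "poly_series j H = (\<lambda>_. 0)" using eq by simp
      then show False using H by (simp add: weierstrass_at_def)
    qed
    moreover have "null_at t (u \<star> v')" using u u' t0 by (intro null_at_cauchy_prod)
    ultimately show ?thesis
      using order_le_of_unit_multiple[OF \<beta>, of j "u \<star> v'" G H] eq G t by (simp add: weierstrass_at_def)
  qed
  show ?thesis using le[OF G H] le[OF H G] by simp
qed

lemma weierstrass_at_mult:
  assumes t: "t > 0" and G: "weierstrass_at t j a G" and H: "weierstrass_at t j b H"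
  shows "weierstrass_at t j (a \<star> b) (G * H)"
proof -
  obtain u v u' v' where u: "null_at t u" "null_at t v" "u \<star> v = const_series 1" "a = poly_series j G \<star> u"
    and u': "null_at t u'" "null_at t v'" "u' \<star> v' = const_series 1" "b = poly_series j H \<star> u'"
    using G H unfolding weierstrass_at_def by metis
  have "a \<star> b = poly_series j (G * H) \<star> (u \<star> u')"
    unfolding u(4) u'(4) poly_series_mult using t u u' by (intro cauchy_prod_mult_swap[of t]) auto
  moreover have "u \<star> u' \<star> (v \<star> v') = u \<star> v \<star> (u' \<star> v')"
    using t u u' by (intro cauchy_prod_mult_swap[of t]) auto
  moreover have "null_at t (u \<star> u')" "null_at t (v \<star> v')" using t u u' by (auto intro: null_at_cauchy_prod)
  ultimately show ?thesis using G H u u' unfolding weierstrass_at_def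
    by (metis cauchy_prod_1(1) no_zero_divisors)
qed

lemma weierstrass_at_level:
  "weierstrass_at t j a G \<Longrightarrow> weierstrass_at t (j + e) a (pcompose G (monom 1 (residue_char TYPE('a) ^ e)))"
  using residue_char_pos[where 'a='a]
  by (auto simp: weierstrass_at_def poly_series_pcompose pcompose_power_nonzero)

lemma weierstrass_atI:
  "G \<noteq> 0 \<Longrightarrow> unit_on r r' i u v \<Longrightarrow> a = poly_series j G \<star> u \<Longrightarrow> r \<le> t \<Longrightarrow> t \<le> r' \<Longrightarrow> weierstrass_at t j a G"
  unfolding weierstrass_at_def unit_on_def by blast

section \<open>Conjugates have equal absolute value\<close>

lemma w_coeff_0_prod_le:
  assumes "\<And>x. x \<in># A \<Longrightarrow> w x \<le> t"
  shows "w (coeff (\<Prod>x\<in>#A. [:- x, 1:]) 0) \<le> t ^ size A"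
  using assms
proof (induction A)
  case (add x A)
  then have "w x * w (coeff (\<Prod>x\<in>#A. [:- x, 1:]) 0) \<le> t * t ^ size A"
    by (intro mult_mono) (auto intro: order_trans[OF w_ge_0])
  then show ?case by (simp add: w_mult)
qed simp

text \<open>If the conjugates had different absolute values, then on the circle of the largest one the minimal
  polynomial would not be dominated by its constant term, and preparation would give a polynomial of
  smaller degree with a common root.\<close>

lemma w_conj:
  assumes "\<gamma> \<in> conj_class \<alpha>"
  shows "w \<gamma> = w \<alpha>"
proof -
  let ?R = "min_poly \<alpha>"
  define D where "D = degree ?R"
  define t where "t = Max (w ` conj_class \<alpha>)"
  have fin: "finite (w ` conj_class \<alpha>)" "w ` conj_class \<alpha> \<noteq> {}"
    by (simp, metis conj_class_self empty_iff image_is_empty)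
  have le: "w x \<le> t" if "x \<in> conj_class \<alpha>" for x unfolding t_def using that fin by auto
  have "t \<in> w ` conj_class \<alpha>" unfolding t_def using fin by (rule Max_in)
  then obtain \<beta> where \<beta>: "\<beta> \<in> conj_class \<alpha>" "w \<beta> = t" by auto
  have "w x = t" if x: "x \<in> conj_class \<alpha>" for x
  proof (rule ccontr)
    assume "w x \<noteq> t"
    then have "w x < t" using le[OF x] by simp
    then have t0: "t > 0" using w_ge_0[of x] by linarith
    have \<beta>0: "\<beta> \<noteq> 0" using \<beta> t0 by auto
    obtain A where A: "size A = D" "ac_poly ?R = (\<Prod>x\<in>#A. [:- x, 1:])"
      using alg_closed_imp_factorization[of "ac_poly ?R"] by (auto simp: D_def)
    have roots: "y \<in># A \<longleftrightarrow> y \<in> conj_class \<alpha>" for y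
      unfolding conj_class_iff_root A(2) poly_prod_mset by (auto simp: image_iff)
    obtain A' where A': "A = add_mset x A'" using x roots by (metis mset_add)
    \<comment> \<open>Up to sign the constant coefficient is the product of \<open>D\<close> roots
      of absolute value at most \<open>t\<close>, and the factor \<open>x\<close> is strictly
      smaller.\<close>
    have "w (coeff (\<Prod>x\<in>#A'. [:- x, 1:]) 0) \<le> t ^ size A'"
      by (rule w_coeff_0_prod_le) (use le roots A' in auto)
    then have "w x * w (coeff (\<Prod>x\<in>#A'. [:- x, 1:]) 0) \<le> w x * t ^ size A'" by (intro mult_left_mono) auto
    also have "\<dots> < t * t ^ size A'" using \<open>w x < t\<close> t0 by simp
    finally have "w (coeff (ac_poly ?R) 0) < t ^ D" using A A' by (auto simp: w_mult)
    then have c0: "absv (coeff ?R 0) < t ^ D" by simp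
    let ?a = "poly_series 0 ?R"
    have wt: "wabs t ?a (of_nat k) = absv (coeff ?R k) * t ^ k" for k
      using wabs_poly_series[OF t0, of 0 ?R k] by simp
    have wD: "wabs t ?a (of_nat D) = t ^ D" unfolding wt by (simp add: D_def)
    have ne: "?a \<noteq> (\<lambda>_. 0)" by simp
    then obtain k where "?a k \<noteq> 0" by fast
    then obtain m M where m: "first_term t ?a m" and M: "last_term t ?a M"
      using first_term_exists[OF t0 null_at_poly_series] last_term_exists[OF t0 null_at_poly_series] by metis
    obtain G u v where G: "G \<noteq> 0" "of_nat (degree G) \<le> (M - m) * of_nat (residue_char TYPE('a) ^ 0)"
      "unit_on t t 0 u v" "?a = poly_series 0 G \<star> u"
      using weierstrass_factorisation[OF lev_poly_series _ t0 _ m M] by (metis null_at_poly_series order_refl)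
    have "?a m \<noteq> 0" "?a M \<noteq> 0" using m M by (auto simp: first_term_def last_term_def)
    then obtain k l where k: "m = of_nat k" and l: "M = of_nat l" "l \<le> D"
      unfolding D_def by (metis poly_series_nonzeroE div_by_1 of_nat_1 power_0)
    \<comment> \<open>The leading term has size t^D and beats the constant term, so exponent 0 is
      not dominant and \<open>G\<close> loses at least one degree.\<close>
    have "k \<noteq> 0"
    proof
      assume "k = 0"
      have "wabs t ?a (of_nat D) \<le> wabs t ?a m" using m by (simp add: first_term_def)
      then show False using wD wt[of 0] c0 k \<open>k = 0\<close> by simp
    qed
    have "of_nat (degree G) \<le> M - m" using G(2) by simp
    also have "\<dots> < of_nat D" using k l \<open>k \<noteq> 0\<close> by simp
    finally have dG: "degree G < D" by simp
    have 1: "weierstrass_at t 0 ?a G" using weierstrass_atI[OF G(1,3,4)] by simp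
    have 2: "weierstrass_at t 0 ?a ?R"
      unfolding weierstrass_at_def using null_at_const
      by (auto intro!: exI[of _ "const_series 1"])
    have "order \<beta> (ac_poly G) = order \<beta> (ac_poly ?R)"
      by (rule weierstrass_at_unique[OF \<beta>0 _ 1 2]) (simp add: \<beta>)
    moreover have "poly (ac_poly ?R) \<beta> = 0" using \<beta>(1) by (simp add: conj_class_iff_root)
    ultimately have "poly (ac_poly G) \<beta> = 0" using G(1) order_root[of "ac_poly G" \<beta>] order_root[of "ac_poly ?R" \<beta>] by simp
    moreover have "min_poly \<beta> = ?R" using \<beta>(1) by (simp add: conj_class_def)
    ultimately have "?R dvd G" using min_poly_dvd_iff[of \<beta> G] by simp
    then have "D \<le> degree G" unfolding D_def using G(1) by (rule dvd_imp_degree_le)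
    with dG show False by simp
  qed
  from this[OF assms] this[OF conj_class_self] show ?thesis by simp
qed

section \<open>Polynomials without zeros in an annulus\<close>

text \<open>Factors are multiplied in one at a time. If |x| < r, the X in X - x wins and the
  dominant index moves up by one; if |x| > r', the constant wins and the index stays. Either way one
  index serves all circles of the annulus, and it stays 0 if all roots lie outside the outer
  circle.\<close>

lemma prod_linear_dominant:
  assumes r: "0 < r" "r \<le> r'" and A: "\<And>x. x \<in># A \<Longrightarrow> w x < r \<or> r' < w x"
  shows "\<exists>k. coeff (\<Prod>x\<in>#A. [:- x, 1:]) k \<noteq> 0 \<and>
    (\<forall>s j. r \<le> s \<longrightarrow> s \<le> r' \<longrightarrow> j \<noteq> k \<longrightarrow>
      w (coeff (\<Prod>x\<in>#A. [:- x, 1:]) j) * s ^ j < w (coeff (\<Prod>x\<in>#A. [:- x, 1:]) k) * s ^ k) \<and>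
    ((\<forall>x\<in>#A. r' < w x) \<longrightarrow> k = 0)"
  using A
proof (induction A)
  case empty
  then show ?case using r by (intro exI[of _ 0]) (auto simp: coeff_1)
next
  case (add x A)
  define P where "P = (\<Prod>x\<in>#A. [:- x, 1:])"
  define P' where "P' = (\<Prod>x\<in>#add_mset x A. [:- x, 1:])"
  obtain k where k: "coeff P k \<noteq> 0"
    "\<And>s j. r \<le> s \<Longrightarrow> s \<le> r' \<Longrightarrow> j \<noteq> k \<Longrightarrow> w (coeff P j) * s ^ j < w (coeff P k) * s ^ k"
    "(\<forall>x\<in>#A. r' < w x) \<Longrightarrow> k = 0"
    using add unfolding P_def by auto
  have kle: "w (coeff P j) * s ^ j \<le> w (coeff P k) * s ^ k" if "r \<le> s" "s \<le> r'" for s j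
    using k(2)[OF that, of j] by (cases "j = k") auto
  \<comment> \<open>The coefficients of X P, so that those of (X - x) P become a difference.\<close>
  define c where "c = (\<lambda>j. case j of 0 \<Rightarrow> 0 | Suc l \<Rightarrow> coeff P l)"
  have P': "P' = [:- x, 1:] * P" by (simp add: P'_def P_def)
  have coeff': "coeff P' j = c j - x * coeff P j" for j
    unfolding P' c_def by (cases j) auto
  have bnd: "w (coeff P' j) * s ^ j \<le> max (w (c j) * s ^ j) (w x * (w (coeff P j) * s ^ j))" if "0 \<le> s" for j s
  proof -
    have "w (coeff P' j) * s ^ j \<le> max (w (c j)) (w x * w (coeff P j)) * s ^ j"
      unfolding coeff' using w_diff_le[of "c j" "x * coeff P j"] that
      by (intro mult_right_mono) (auto simp: w_mult)
    also have "\<dots> = max (w (c j) * s ^ j) (w x * (w (coeff P j) * s ^ j))"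
      using that by (simp add: max_mult_distrib_right mult.assoc)
    finally show ?thesis .
  qed
  have "\<exists>k. coeff P' k \<noteq> 0 \<and> (\<forall>s j. r \<le> s \<longrightarrow> s \<le> r' \<longrightarrow> j \<noteq> k \<longrightarrow>
      w (coeff P' j) * s ^ j < w (coeff P' k) * s ^ k) \<and> ((\<forall>x\<in>#add_mset x A. r' < w x) \<longrightarrow> k = 0)"
  proof -
    consider "w x < r" | "r' < w x" using add.prems by auto
    then show ?thesis
    proof cases
      case 1
      have "w (coeff P (Suc k)) * r * r ^ k < w (coeff P k) * r ^ k"
        using k(2)[of r "Suc k"] r by (simp add: mult_ac)
      then have lt: "w (coeff P (Suc k)) * r < w (coeff P k)" using r by simp
      have "w x * w (coeff P (Suc k)) \<le> w (coeff P (Suc k)) * r"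
        using 1 mult_right_mono[of "w x" r "w (coeff P (Suc k))"] by (simp add: mult.commute)
      then have "w (coeff P' (Suc k)) = w (coeff P k)"
        unfolding coeff' using lt w_diff_eq[of "x * coeff P (Suc k)" "coeff P k"] by (simp add: c_def w_mult)
      note wk = this
      have "coeff P' (Suc k) \<noteq> 0" using wk k(1) by auto
      moreover have "w (coeff P' j) * s ^ j < w (coeff P' (Suc k)) * s ^ Suc k"
        if s: "r \<le> s" "s \<le> r'" and j: "j \<noteq> Suc k" for s j
      proof -
        have s0: "s > 0" using s r by simp
        have pos: "w (coeff P k) * s ^ k > 0" using k(1) s0 by simp
        have "w (c j) * s ^ j < s * (w (coeff P k) * s ^ k)"
        proof (cases j)
          case 0 then show ?thesis using pos s0 by (simp add: c_def)
        next
          case (Suc l)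
          then have "w (coeff P l) * s ^ l < w (coeff P k) * s ^ k" using k(2)[OF s, of l] j by simp
          then have "s * (w (coeff P l) * s ^ l) < s * (w (coeff P k) * s ^ k)" using s0 by simp
          then show ?thesis using Suc by (simp add: c_def mult_ac)
        qed
        moreover have "w x * (w (coeff P j) * s ^ j) < s * (w (coeff P k) * s ^ k)"
        proof -
          have "w x * (w (coeff P j) * s ^ j) \<le> w x * (w (coeff P k) * s ^ k)"
            using kle[OF s] by (intro mult_left_mono) auto
          also have "\<dots> < s * (w (coeff P k) * s ^ k)" using 1 s pos by (intro mult_strict_right_mono) auto
          finally show ?thesis .
        qed
        ultimately show ?thesis using bnd[of s j] s0 by (simp add: wk mult_ac)
      qed
      moreover have "\<not> (\<forall>x\<in>#add_mset x A. r' < w x)" using 1 r by auto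
      ultimately show ?thesis by blast
    next
      case 2
      have x0: "w x > 0" using 2 r by linarith
      have "w (c k) < w x * w (coeff P k)"
      proof (cases k)
        case 0 then show ?thesis using x0 k(1) by (simp add: c_def)
      next
        case (Suc l)
        have r0: "r' > 0" using r by simp
        have "w (coeff P l) * r' ^ l < r' * w (coeff P k) * r' ^ l"
          using k(2)[of r' l] r Suc by (simp add: mult_ac)
        then have "w (coeff P l) < r' * w (coeff P k)" using r0 by simp
        also have "\<dots> \<le> w x * w (coeff P k)" using 2 by (intro mult_right_mono) auto
        finally show ?thesis using Suc by (simp add: c_def)
      qed
      then have wk: "w (coeff P' k) = w x * w (coeff P k)"
        unfolding coeff' using w_diff_eq[of "c k" "x * coeff P k"] w_uminus[of "c k - x * coeff P k"]
        by (simp add: w_mult)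
      have "coeff P' k \<noteq> 0" using wk k(1) x0 by auto
      moreover have "w (coeff P' j) * s ^ j < w (coeff P' k) * s ^ k"
        if s: "r \<le> s" "s \<le> r'" and j: "j \<noteq> k" for s j
      proof -
        have s0: "s > 0" using s r by simp
        have pos: "w (coeff P k) * s ^ k > 0" using k(1) s0 by simp
        have "w (c j) * s ^ j < w x * (w (coeff P k) * s ^ k)"
        proof (cases j)
          case 0 then show ?thesis using pos x0 by (simp add: c_def)
        next
          case (Suc l)
          have "s * (w (coeff P l) * s ^ l) \<le> s * (w (coeff P k) * s ^ k)" using kle[OF s, of l] s0 by simp
          also have "\<dots> < w x * (w (coeff P k) * s ^ k)" using 2 s pos by (intro mult_strict_right_mono) auto
          finally show ?thesis using Suc by (simp add: c_def mult_ac)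
        qed
        moreover have "w x * (w (coeff P j) * s ^ j) < w x * (w (coeff P k) * s ^ k)"
          using k(2)[OF s j] x0 by simp
        ultimately show ?thesis using bnd[of s j] s0 by (simp add: wk mult_ac)
      qed
      moreover have "(\<forall>x\<in>#add_mset x A. r' < w x) \<longrightarrow> k = 0" using k(3) by auto
      ultimately show ?thesis by blast
    qed
  qed
  then show ?case unfolding P'_def .
qed

lemma no_root_dominant:
  fixes B :: "'a poly"
  assumes r: "0 < r" "r \<le> r'" and B: "B \<noteq> 0"
    and no: "\<And>x. poly (ac_poly B) x = 0 \<Longrightarrow> w x < r \<or> r' < w x"
  obtains k where "coeff B k \<noteq> 0"
    "\<And>s j. r \<le> s \<Longrightarrow> s \<le> r' \<Longrightarrow> j \<noteq> k \<Longrightarrow> absv (coeff B j) * s ^ j < absv (coeff B k) * s ^ k"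
    "(\<And>x. poly (ac_poly B) x = 0 \<Longrightarrow> r' < w x) \<Longrightarrow> k = 0"
proof -
  obtain A where A: "ac_poly B = smult (lead_coeff (ac_poly B)) (\<Prod>x\<in>#A. [:- x, 1:])"
    using alg_closed_imp_factorization[of "ac_poly B"] B by auto
  define P where "P = (\<Prod>x\<in>#A. [:- x, 1:])"
  have root: "poly (ac_poly B) x = 0" if "x \<in># A" for x
    by (subst A) (use that in \<open>auto simp: poly_prod_mset image_iff\<close>)
  obtain k where k: "coeff P k \<noteq> 0"
    "\<And>s j. r \<le> s \<Longrightarrow> s \<le> r' \<Longrightarrow> j \<noteq> k \<Longrightarrow> w (coeff P j) * s ^ j < w (coeff P k) * s ^ k"
    "(\<forall>x\<in>#A. r' < w x) \<Longrightarrow> k = 0"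
    using prod_linear_dominant[OF r, of A] no root unfolding P_def by metis
  define c where "c = lead_coeff B"
  have c0: "c \<noteq> 0" using B by (simp add: c_def)
  have "to_ac (coeff B j) = to_ac c * coeff P j" for j
    using arg_cong[OF A, of "\<lambda>p. coeff p j"] by (simp add: P_def c_def)
  then have eq: "absv (coeff B j) = absv c * w (coeff P j)" for j
    by (metis w_mult w_to_ac)
  show ?thesis
  proof (rule that[of k])
    show "coeff B k \<noteq> 0" using eq[of k] k(1) c0 by (metis absv_eq_0 mult_eq_0_iff w_eq_0)
    show "absv (coeff B j) * s ^ j < absv (coeff B k) * s ^ k" if "r \<le> s" "s \<le> r'" "j \<noteq> k" for s j
      using k(2)[OF that] c0 by (simp add: eq mult.assoc)
    show "k = 0" if "\<And>x. poly (ac_poly B) x = 0 \<Longrightarrow> r' < w x" using k(3) root that by blast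
  qed
qed

lemma sole_term_poly_series:
  fixes B :: "'a poly"
  assumes t: "t > 0" and k: "coeff B k \<noteq> 0"
    and lt: "\<And>j. j \<noteq> k \<Longrightarrow> absv (coeff B j) * t ^ j < absv (coeff B k) * t ^ k"
  shows "sole_term (t ^ (residue_char TYPE('a) ^ i)) (poly_series i B) (of_nat k / of_nat (residue_char TYPE('a) ^ i))"
proof -
  let ?N = "residue_char TYPE('a) ^ i"
  have pos: "0 < absv (coeff B k) * t ^ k" using k t by simp
  show ?thesis
    unfolding sole_term_def
  proof (intro conjI allI impI)
    show "poly_series i B (of_nat k / of_nat ?N) \<noteq> 0" using k by (simp add: poly_series_at)
    fix n assume n: "n \<noteq> of_nat k / (of_nat ?N :: rat)"
    show "wabs (t ^ ?N) (poly_series i B) n < wabs (t ^ ?N) (poly_series i B) (of_nat k / of_nat ?N)"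
    proof (cases "poly_series i B n = 0")
      case True
      then show ?thesis using pos by (simp add: wabs_poly_series[OF t]) (simp add: wabs_def)
    next
      case False
      then obtain j where "n = of_nat j / of_nat ?N" by (rule poly_series_nonzeroE)
      then show ?thesis using lt[of j] n by (auto simp: wabs_poly_series[OF t])
    qed
  qed
qed

text \<open>A polynomial without zeros in the annulus has a single dominant index there, the same at
  both boundary circles, and is therefore a unit.\<close>

lemma no_root_unit:
  fixes B :: "'a poly"
  assumes r: "0 < r" "r \<le> r'" and B: "B \<noteq> 0"
    and no: "\<And>x. poly (ac_poly B) x = 0 \<Longrightarrow> w x ^ (residue_char TYPE('a) ^ i) < r \<or> r' < w x ^ (residue_char TYPE('a) ^ i)"
  obtains v where "unit_on r r' i (poly_series i B) v"
proof -
  let ?N = "residue_char TYPE('a) ^ i"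
  have N: "?N > 0" by simp
  \<comment> \<open>The roots are values of \<open>Y\<close>, so the radii are the N-th roots of
    those for X.\<close>
  define s where "s = root ?N r"
  define s' where "s' = root ?N r'"
  have s: "s ^ ?N = r" "s' ^ ?N = r'" "0 < s" "s \<le> s'"
    using r by (auto simp: s_def s'_def)
  have lt: "w x < s \<or> s' < w x" if "poly (ac_poly B) x = 0" for x
    using no[OF that] s power_mono[of s "w x" ?N] power_mono[of "w x" s' ?N]
    by (metis linorder_not_less w_ge_0 less_imp_le)
  obtain k where k: "coeff B k \<noteq> 0"
    "\<And>t j. s \<le> t \<Longrightarrow> t \<le> s' \<Longrightarrow> j \<noteq> k \<Longrightarrow> absv (coeff B j) * t ^ j < absv (coeff B k) * t ^ k"
    using no_root_dominant[OF s(3,4) B lt] by metis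
  have "sole_term r (poly_series i B) (of_nat k / of_nat ?N)" "sole_term r' (poly_series i B) (of_nat k / of_nat ?N)"
    using sole_term_poly_series[of s B k i] sole_term_poly_series[of s' B k i] k s by auto
  then show ?thesis
    using sole_term_unit[OF lev_poly_series null_at_poly_series r] that by blast
qed

section \<open>The order of an analytic function at a point\<close>

lemma null_at_coef [simp]: "s > 0 \<Longrightarrow> null_at s (coef g)"
  using pls_null_at[OF coef[of g]] .

lemma lev_coef_iff: "lev i (coef g) \<longleftrightarrow> g \<in> analytic_level i"
  by (simp add: lev_def analytic_level_def)

lemma coef_mult: "coef (g * h) = coef g \<star> coef h"
  by (rule times_analytic.rep_eq)

lemma coef_eq_0_iff: "coef (g :: 'b::perfectoid_field analytic) = (\<lambda>_. 0) \<longleftrightarrow> g = 0"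
proof -
  have "coef (0 :: 'b analytic) = (\<lambda>_. 0)" by (auto simp: zero_analytic.rep_eq const_series_def)
  then show ?thesis using coef_inject[of g 0] by simp
qed

lemma analytic_level_mult: "g \<in> analytic_level i \<Longrightarrow> h \<in> analytic_level i \<Longrightarrow> g * h \<in> analytic_level i"
  unfolding lev_coef_iff[symmetric] coef_mult by (rule lev_mult)

text \<open>The order of the zero of the Laurent series in \<open>Y\<close> at Y = \<beta>. The
  choice of \<open>G\<close> does not matter for \<beta> \<noteq> 0, by uniqueness of the order on
  the circle through \<beta>.\<close>

definition zero_order :: "nat \<Rightarrow> 'a alg_closure \<Rightarrow> 'a analytic \<Rightarrow> nat" where
  "zero_order i \<beta> g = order \<beta> (ac_poly (SOME G. weierstrass_at (w \<beta> ^ (residue_char TYPE('a) ^ i)) i (coef g) G))"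

lemma zero_order_eq:
  assumes "\<beta> \<noteq> 0" "weierstrass_at (w \<beta> ^ (residue_char TYPE('a) ^ i)) i (coef g) G"
  shows "zero_order i \<beta> g = order \<beta> (ac_poly G)"
  unfolding zero_order_def by (rule weierstrass_at_unique[OF assms(1) refl someI assms(2)]) (rule assms(2))

lemma analytic_factorisation:
  assumes "g \<in> analytic_level i" "g \<noteq> (0 :: 'b::perfectoid_field analytic)" "0 < r" "r \<le> r'"
  obtains G u v where "G \<noteq> 0" "unit_on r r' i u v" "coef g = poly_series i G \<star> u"
proof (rule weierstrass_factorisation_exists[of i "coef g" r r'])
  show "lev i (coef g)" using assms(1) by (simp add: lev_coef_iff)
  show "coef g \<noteq> (\<lambda>_. 0)" using assms(2) by (simp add: coef_eq_0_iff)
qed (use assms that in auto)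

lemma weierstrass_at_exists:
  assumes "g \<in> analytic_level i" "g \<noteq> 0" "t > 0"
  obtains G where "weierstrass_at t i (coef g) G"
proof -
  obtain G u v where "G \<noteq> 0" "unit_on t t i u v" "coef g = poly_series i G \<star> u"
    by (rule analytic_factorisation[OF assms(1,2,3) order_refl])
  then show ?thesis using that weierstrass_atI[of G t t i u v "coef g" i t] by simp
qed

lemma zero_order_mult:
  assumes "\<beta> \<noteq> 0" "g \<in> analytic_level i" "h \<in> analytic_level i" "g \<noteq> 0" "h \<noteq> 0"
  shows "zero_order i \<beta> (g * h) = zero_order i \<beta> g + zero_order i \<beta> h"
proof -
  let ?t = "w \<beta> ^ (residue_char TYPE('a) ^ i)"
  have t: "?t > 0" using assms by simp
  obtain G H where G: "weierstrass_at ?t i (coef g) G" and H: "weierstrass_at ?t i (coef h) H"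
    using weierstrass_at_exists t assms by metis
  have "weierstrass_at ?t i (coef (g * h)) (G * H)"
    unfolding coef_mult by (rule weierstrass_at_mult[OF t G H])
  moreover have "G \<noteq> 0" "H \<noteq> 0" using G H by (auto simp: weierstrass_at_def)
  ultimately show ?thesis
    using zero_order_eq[OF assms(1)] G H by (simp add: ac_poly_mult order_mult)
qed

lemma weierstrass_partD:
  assumes "weierstrass_part r r' g j G" "r \<le> t" "t \<le> r'"
  shows "weierstrass_at t j (coef g) G"
  using assms unfolding weierstrass_part_def weierstrass_at_def annulus_series_def by blast

lemma lev_in_annulus_series:
  assumes "lev i u" "\<And>s. r \<le> s \<Longrightarrow> s \<le> r' \<Longrightarrow> null_at s (u :: rat \<Rightarrow> 'b::perfectoid_field)"
  shows "u \<in> annulus_series r r'"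
  unfolding annulus_series_def
proof (intro CollectI conjI allI impI)
  show "n \<in> int_adjoin_inverse (residue_char TYPE('b))" if "u n \<noteq> 0" for n
    using levD[OF assms(1) that] unfolding int_adjoin_inverse_def by blast
  show "null_at s u" if "r \<le> s \<and> s \<le> r'" for s
    using assms(2) that by simp
qed

lemma weierstrass_part_exists:
  assumes "g \<in> analytic_level i" "g \<noteq> 0" "t > 0"
  obtains G where "weierstrass_part t t g i G"
proof -
  obtain G u v where G: "G \<noteq> 0" "unit_on t t i u v" "coef g = poly_series i G \<star> u"
    by (rule analytic_factorisation[OF assms(1,2,3) order_refl])
  have "u \<in> annulus_series t t" "v \<in> annulus_series t t"
    using G(2) unfolding unit_on_def by (auto intro: lev_in_annulus_series)
  then show ?thesis using that G unfolding weierstrass_part_def unit_on_def by blast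
qed

text \<open>Raising the level by \<open>e\<close> multiplies all orders at nonzero points by
  \<open>insep_degree\<close> of \<open>e\<close>, and the normalising denominator by the same
  number.\<close>

lemma multiplicity_at_level:
  fixes G H :: "'a poly"
  assumes G: "G \<noteq> 0" and H: "H \<noteq> 0" and \<alpha>: "\<alpha> \<noteq> 0"
  shows "multiplicity_at \<alpha> (j + e) (pcompose G (monom 1 (residue_char TYPE('a) ^ e)))
    (pcompose H (monom 1 (residue_char TYPE('a) ^ e))) = multiplicity_at \<alpha> j G H"
proof -
  let ?p = "residue_char TYPE('a)"
  let ?G = "pcompose G (monom 1 (?p ^ e))" and ?H = "pcompose H (monom 1 (?p ^ e))"
  let ?n = "insep_degree TYPE('a) e"
  define V where "V = {int (order \<beta> (ac_poly G)) - int (order \<beta> (ac_poly H)) | \<beta>. \<beta> ^ (?p ^ j) \<in> conj_class \<alpha>}"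
  define V' where "V' = {int (order \<beta> (ac_poly ?G)) - int (order \<beta> (ac_poly ?H)) | \<beta>. \<beta> ^ (?p ^ (j + e)) \<in> conj_class \<alpha>}"
  have G': "?G \<noteq> 0" "?H \<noteq> 0"
    using pcompose_power_nonzero[of "?p ^ e" G] pcompose_power_nonzero[of "?p ^ e" H] G H by simp_all
  have fV: "finite V" "V \<noteq> {}" "multiplicity_at \<alpha> j G H = of_int (Min V) / of_nat (insep_degree TYPE('a) j)"
    unfolding V_def using multiplicity_at_eq[OF G H \<alpha>] by blast+
  have fV': "multiplicity_at \<alpha> (j + e) ?G ?H = of_int (Min V') / of_nat (insep_degree TYPE('a) (j + e))"
    unfolding V'_def by (rule multiplicity_at_eq(3)[OF G' \<alpha>])
  have ord: "order \<beta> (ac_poly (pcompose F (monom 1 (?p ^ e)))) = order (\<beta> ^ (?p ^ e)) (ac_poly F) * ?n"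
    if "\<beta> \<noteq> 0" "F \<noteq> 0" for \<beta> and F :: "'a poly"
    using order_pcompose_power[of "?p ^ e" "ac_poly F" \<beta>] order_power_minus_const[OF that(1), of e] that
    by (simp add: ac_poly_pcompose ac_poly_monom)
  have val: "int (order \<gamma> (ac_poly ?G)) - int (order \<gamma> (ac_poly ?H)) =
      int ?n * (int (order (\<gamma> ^ (?p ^ e)) (ac_poly G)) - int (order (\<gamma> ^ (?p ^ e)) (ac_poly H)))" if "\<gamma> \<noteq> 0" for \<gamma>
    by (simp add: ord[OF that G] ord[OF that H] right_diff_distrib mult.commute)
  have "V' = (\<lambda>v. int ?n * v) ` V"
  proof (intro equalityI subsetI)
    fix v assume "v \<in> V'"
    then obtain \<beta> where \<beta>: "\<beta> ^ (?p ^ (j + e)) \<in> conj_class \<alpha>"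
      "v = int (order \<beta> (ac_poly ?G)) - int (order \<beta> (ac_poly ?H))" unfolding V'_def by blast
    then have "\<beta> \<noteq> 0" using conj_class_nonzero[OF \<beta>(1) \<alpha>] by (auto simp: power_0_left)
    moreover have "(\<beta> ^ (?p ^ e)) ^ (?p ^ j) \<in> conj_class \<alpha>"
      using \<beta>(1) by (simp add: power_add mult.commute flip: power_mult)
    ultimately show "v \<in> (\<lambda>v. int ?n * v) ` V"
      unfolding \<beta>(2) val[OF \<open>\<beta> \<noteq> 0\<close>] V_def by blast
  next
    fix v assume "v \<in> (\<lambda>v. int ?n * v) ` V"
    then obtain \<beta> where \<beta>: "\<beta> ^ (?p ^ j) \<in> conj_class \<alpha>"
      "v = int ?n * (int (order \<beta> (ac_poly G)) - int (order \<beta> (ac_poly H)))" unfolding V_def by blast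
    \<comment> \<open>Every root at the lower level has a p^e-th root above it, so no order
      difference is lost.\<close>
    have "\<exists>\<gamma>. poly (monom 1 (?p ^ e) - [:\<beta>:]) \<gamma> = 0"
    proof (rule alg_closed_imp_poly_has_root)
      have "coeff (monom 1 (?p ^ e) - [:\<beta>:]) (?p ^ e) = 1" by (simp add: coeff_pCons')
      then show "0 < degree (monom 1 (?p ^ e) - [:\<beta>:])"
        by (metis le_degree not_gr_zero zero_neq_one power_eq_0_iff residue_char_neq_0 le_zero_eq)
    qed
    then obtain \<gamma> where \<gamma>: "\<gamma> ^ (?p ^ e) = \<beta>" by (auto simp: poly_monom)
    have "\<beta> \<noteq> 0" using conj_class_nonzero[OF \<beta>(1) \<alpha>] by (auto simp: power_0_left)
    then have "\<gamma> \<noteq> 0" using \<gamma> by (auto simp: power_0_left)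
    have "\<gamma> ^ (?p ^ (j + e)) \<in> conj_class \<alpha>"
      using \<beta>(1) \<gamma> by (simp add: power_add mult.commute power_mult)
    moreover have "v = int (order \<gamma> (ac_poly ?G)) - int (order \<gamma> (ac_poly ?H))"
      unfolding \<beta>(2) val[OF \<open>\<gamma> \<noteq> 0\<close>] \<gamma> ..
    ultimately show "v \<in> V'" unfolding V'_def by blast
  qed
  then have "Min V' = int ?n * Min V"
    using mono_Min_commute[of "\<lambda>v. int ?n * v" V] fV(1,2) by (simp add: mono_def mult_left_mono)
  moreover have "insep_degree TYPE('a) (j + e) = insep_degree TYPE('a) j * ?n"
    by (simp add: insep_degree_def power_add)
  ultimately show ?thesis
    using fV(3) fV' insep_degree_pos[where 'a='a and j=e] by (simp del: insep_degree_pos)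
qed

text \<open>The description in \<open>ord_at\<close> determines one value: any two presentations of
  the fraction can be lifted to a common level, where cross-multiplication and uniqueness of orders
  on the circle through \<alpha> make the differences agree. All relevant \<beta> lie on this circle
  because conjugates have equal absolute value.\<close>

lemma ord_at_Fract:
  assumes \<alpha>: "\<alpha> \<noteq> 0" and g: "g \<in> analytic_level i" "g \<noteq> 0" and h: "h \<in> analytic_level i" "h \<noteq> 0"
  defines "V \<equiv> {int (zero_order i \<beta> g) - int (zero_order i \<beta> h) | \<beta>. \<beta> ^ (residue_char TYPE('a) ^ i) \<in> conj_class \<alpha>}"
  shows "finite V" "V \<noteq> {}" "ord_at w \<alpha> (Fract g h) = of_int (Min V) / of_nat (insep_degree TYPE('a) i)"
proof -
  let ?p = "residue_char TYPE('a)"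
  have t: "w \<alpha> > 0" using \<alpha> by simp
  obtain G H where G: "weierstrass_part (w \<alpha>) (w \<alpha>) g i G" and H: "weierstrass_part (w \<alpha>) (w \<alpha>) h i H"
    using weierstrass_part_exists g h t by metis
  have ne: "G \<noteq> 0" "H \<noteq> 0" using G H by (auto simp: weierstrass_part_def)
  have G': "weierstrass_at (w \<alpha>) i (coef g) G" and H': "weierstrass_at (w \<alpha>) i (coef h) H"
    using weierstrass_partD[OF G] weierstrass_partD[OF H] by auto
  have w\<beta>: "w \<beta> ^ (?p ^ j) = w \<alpha> \<and> \<beta> \<noteq> 0" if "\<beta> ^ (?p ^ j) \<in> conj_class \<alpha>" for \<beta> j
    using w_conj[OF that] conj_class_nonzero[OF that \<alpha>] by (auto simp: w_power power_0_left)
  have V: "V = {int (order \<beta> (ac_poly G)) - int (order \<beta> (ac_poly H)) | \<beta>. \<beta> ^ (?p ^ i) \<in> conj_class \<alpha>}"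
  proof -
    have "zero_order i \<beta> g = order \<beta> (ac_poly G)" "zero_order i \<beta> h = order \<beta> (ac_poly H)"
      if "\<beta> ^ (?p ^ i) \<in> conj_class \<alpha>" for \<beta>
      using zero_order_eq[of \<beta> i g G] zero_order_eq[of \<beta> i h H] w\<beta>[OF that] G' H' by auto
    then show ?thesis unfolding V_def by (intro Collect_cong) metis
  qed
  show "finite V" "V \<noteq> {}" unfolding V using multiplicity_at_eq(1,2)[OF ne \<alpha>] by blast+
  have "ord_at w \<alpha> (Fract g h) = multiplicity_at \<alpha> i G H"
    unfolding ord_at_def
  proof (rule the_equality)
    show "\<exists>g' h' r r' j G' H'. g' \<noteq> 0 \<and> h' \<noteq> 0 \<and> Fract g h = Fract g' h' \<and> 0 < r \<and> r \<le> w \<alpha> \<and> w \<alpha> \<le> r' \<and>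
        weierstrass_part r r' g' j G' \<and> weierstrass_part r r' h' j H' \<and>
        multiplicity_at \<alpha> i G H = multiplicity_at \<alpha> j G' H'"
      using g h t G H by blast
  next
    fix m
    assume "\<exists>g' h' r r' j G' H'. g' \<noteq> 0 \<and> h' \<noteq> 0 \<and> Fract g h = Fract g' h' \<and> 0 < r \<and> r \<le> w \<alpha> \<and> w \<alpha> \<le> r' \<and>
        weierstrass_part r r' g' j G' \<and> weierstrass_part r r' h' j H' \<and> m = multiplicity_at \<alpha> j G' H'"
    then obtain g' h' r r' j G1 H1 where *: "g' \<noteq> 0" "h' \<noteq> 0" "Fract g h = Fract g' h'" "r \<le> w \<alpha>" "w \<alpha> \<le> r'"
        "weierstrass_part r r' g' j G1" "weierstrass_part r r' h' j H1" "m = multiplicity_at \<alpha> j G1 H1"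
      by blast
    have eq: "coef g \<star> coef h' = coef g' \<star> coef h"
      using *(1-3) h(2) unfolding coef_mult[symmetric] by (simp add: eq_fract)
    have ne1: "G1 \<noteq> 0" "H1 \<noteq> 0" using *(6,7) by (auto simp: weierstrass_part_def)
    \<comment> \<open>\<open>up k\<close> rewrites a polynomial at a level higher by
      \<open>k\<close>. The given fraction goes up by \<open>j\<close> and the competing one by
      \<open>i\<close>, so that they meet at i + j.\<close>
    define up where "up = (\<lambda>k (F :: 'a poly). pcompose F (monom 1 (?p ^ k)))"
    have up0: "up k F \<noteq> 0" if "F \<noteq> 0" for k F unfolding up_def using that by (intro pcompose_power_nonzero) auto
    have gG: "weierstrass_at (w \<alpha>) (i + j) (coef g) (up j G)" and hH: "weierstrass_at (w \<alpha>) (i + j) (coef h) (up j H)"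
      using weierstrass_at_level[OF G', of j] weierstrass_at_level[OF H', of j] by (simp_all add: up_def)
    have gG1: "weierstrass_at (w \<alpha>) (i + j) (coef g') (up i G1)" and hH1: "weierstrass_at (w \<alpha>) (i + j) (coef h') (up i H1)"
      using weierstrass_at_level[OF weierstrass_partD[OF *(6,4,5)], of i]
        weierstrass_at_level[OF weierstrass_partD[OF *(7,4,5)], of i] by (simp_all add: up_def add.commute)
    have 1: "weierstrass_at (w \<alpha>) (i + j) (coef g \<star> coef h') (up j G * up i H1)"
      by (rule weierstrass_at_mult[OF t gG hH1])
    have 2: "weierstrass_at (w \<alpha>) (i + j) (coef g \<star> coef h') (up i G1 * up j H)"
      unfolding eq by (rule weierstrass_at_mult[OF t gG1 hH])
    have "int (order \<beta> (ac_poly (up j G))) - int (order \<beta> (ac_poly (up j H))) =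
        int (order \<beta> (ac_poly (up i G1))) - int (order \<beta> (ac_poly (up i H1)))"
      if "\<beta> ^ (?p ^ (i + j)) \<in> conj_class \<alpha>" for \<beta>
    proof -
      have "order \<beta> (ac_poly (up j G * up i H1)) = order \<beta> (ac_poly (up i G1 * up j H))"
        using weierstrass_at_unique[OF _ _ 1 2] w\<beta>[OF that] by metis
      then show ?thesis using up0 ne ne1 by (simp add: ac_poly_mult order_mult)
    qed
    then have VV: "{int (order \<beta> (ac_poly (up j G))) - int (order \<beta> (ac_poly (up j H))) | \<beta>. \<beta> ^ (?p ^ (i + j)) \<in> conj_class \<alpha>} =
        {int (order \<beta> (ac_poly (up i G1))) - int (order \<beta> (ac_poly (up i H1))) | \<beta>. \<beta> ^ (?p ^ (i + j)) \<in> conj_class \<alpha>}"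
      by (intro Collect_cong) metis
    have "multiplicity_at \<alpha> i G H = multiplicity_at \<alpha> (i + j) (up j G) (up j H)"
      unfolding up_def by (rule multiplicity_at_level[OF ne \<alpha>, symmetric])
    also have "\<dots> = multiplicity_at \<alpha> (i + j) (up i G1) (up i H1)"
      unfolding multiplicity_at_eq(3)[OF up0[OF ne(1)] up0[OF ne(2)] \<alpha>]
        multiplicity_at_eq(3)[OF up0[OF ne1(1)] up0[OF ne1(2)] \<alpha>] VV ..
    also have "\<dots> = multiplicity_at \<alpha> (j + i) (up i G1) (up i H1)" by (simp add: add.commute)
    also have "\<dots> = m" unfolding up_def *(8) by (rule multiplicity_at_level[OF ne1 \<alpha>])
    finally show "m = multiplicity_at \<alpha> i G H" ..
  qed
  also have "\<dots> = of_int (Min V) / of_nat (insep_degree TYPE('a) i)"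
    unfolding V by (rule multiplicity_at_eq(3)[OF ne \<alpha>])
  finally show "ord_at w \<alpha> (Fract g h) = of_int (Min V) / of_nat (insep_degree TYPE('a) i)" .
qed

section \<open>Divisibility of analytic functions\<close>

lemma coef_Abs:
  assumes "lev i a" "\<And>s. s > 0 \<Longrightarrow> null_at s (a :: rat \<Rightarrow> 'a)"
  shows "coef (Abs_analytic a) = a" "Abs_analytic a \<in> analytic_level i"
proof -
  have "a \<in> punctured_line_series"
    unfolding punctured_line_series_def
  proof (intro CollectI conjI allI impI)
    show "n \<in> int_adjoin_inverse (residue_char TYPE('a))" if "a n \<noteq> 0" for n
      using levD[OF assms(1) that] unfolding int_adjoin_inverse_def by blast
  qed (rule assms(2))
  then show *: "coef (Abs_analytic a) = a" by (rule Abs_analytic_inverse)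
  then show "Abs_analytic a \<in> analytic_level i" using assms(1) by (simp add: lev_coef_iff[symmetric])
qed

text \<open>After cancelling the common factor of the polynomial parts, a root of the remaining
  factor \<open>B'\<close> in the annulus would be a zero of \<open>b\<close> of higher order than
  of \<open>a\<close>. So \<open>B'\<close> has no zero there and is a unit.\<close>

lemma divides_on_annulus:
  assumes a: "a \<in> analytic_level i" "a \<noteq> (0 :: 'a analytic)" and b: "b \<in> analytic_level i" "b \<noteq> 0"
    and le: "\<And>\<beta>. \<beta> \<noteq> 0 \<Longrightarrow> zero_order i \<beta> b \<le> zero_order i \<beta> a"
    and r: "0 < r" "r \<le> r'"
  obtains c where "lev i c" "\<And>s. r \<le> s \<Longrightarrow> s \<le> r' \<Longrightarrow> null_at s c" "coef b \<star> c = coef a"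
proof -
  let ?N = "residue_char TYPE('a) ^ i"
  obtain A u u' where A: "A \<noteq> 0" "unit_on r r' i u u'" "coef a = poly_series i A \<star> u"
    by (rule analytic_factorisation[OF a r])
  obtain B v v' where B: "B \<noteq> 0" "unit_on r r' i v v'" "coef b = poly_series i B \<star> v"
    by (rule analytic_factorisation[OF b r])
  obtain C A' B' where C: "A = C * A'" "B = C * B'" "coprime A' B'"
    using coprime_decomposition[OF A(1) B(1)] by blast
  have ne: "C \<noteq> 0" "A' \<noteq> 0" "B' \<noteq> 0" using A(1) B(1) C by auto
  have no: "w x ^ ?N < r \<or> r' < w x ^ ?N" if x: "poly (ac_poly B') x = 0" for x
  proof (rule ccontr)
    assume "\<not> ?thesis"
    then have t: "r \<le> w x ^ ?N" "w x ^ ?N \<le> r'" by auto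
    then have "x \<noteq> 0" using r by (auto simp: power_0_left)
    have "zero_order i x a = order x (ac_poly A)" "zero_order i x b = order x (ac_poly B)"
      using zero_order_eq[OF \<open>x \<noteq> 0\<close> weierstrass_atI[OF A t]] zero_order_eq[OF \<open>x \<noteq> 0\<close> weierstrass_atI[OF B t]] by auto
    then have "order x (ac_poly B) \<le> order x (ac_poly A)" using le[OF \<open>x \<noteq> 0\<close>] by simp
    then have "order x (ac_poly B') \<le> order x (ac_poly A')"
      using ne by (simp add: C(1,2) ac_poly_mult order_mult)
    moreover have "order x (ac_poly A') = 0"
      using coprime_no_common_root[of B' A' x] C(3) x by (intro order_0I) (simp add: coprime_commute)
    moreover have "order x (ac_poly B') > 0" using x ne by (simp add: order_gt_0_iff)
    ultimately show False by simp
  qed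
  obtain y where y: "unit_on r r' i (poly_series i B') y"
    using no_root_unit[OF r ne(3) no] by blast
  let ?C = "poly_series i C" and ?X = "poly_series i B' \<star> v" and ?Y = "y \<star> v'" and ?Z = "poly_series i A' \<star> u"
  have XY: "unit_on r r' i ?X ?Y" by (rule unit_on_mult[OF y B(2) r])
  have nXY: "null_at s ?X" "null_at s ?Y" if "r \<le> s" "s \<le> r'" for s
    using XY that by (auto simp: unit_on_def)
  have nZ: "null_at s ?Z" if "r \<le> s" "s \<le> r'" for s
    using A(2) that r by (intro null_at_cauchy_prod) (auto simp: unit_on_def)
  have nu: "null_at r u" "null_at r v" using A(2) B(2) r by (auto simp: unit_on_def)
  have bX: "coef b = ?C \<star> ?X"
    unfolding B(3) C(2) poly_series_mult by (rule cauchy_prod_assoc'[OF r(1) _ _ nu(2)]) simp_all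
  have aZ: "coef a = ?C \<star> ?Z"
    unfolding A(3) C(1) poly_series_mult by (rule cauchy_prod_assoc'[OF r(1) _ _ nu(1)]) simp_all
  show ?thesis
  proof (rule that[of "?Y \<star> ?Z"])
    have "lev i ?Y" "lev i ?Z"
      using XY A(2) by (auto simp: unit_on_def intro: lev_mult[OF lev_poly_series])
    then show "lev i (?Y \<star> ?Z)" by (rule lev_mult)
    show "null_at s (?Y \<star> ?Z)" if "r \<le> s" "s \<le> r'" for s
      using that r by (intro null_at_cauchy_prod[of s ?Y ?Z] nXY nZ) auto
    note n = nXY[OF order_refl r(2)] nZ[OF order_refl r(2)]
    have "coef b \<star> (?Y \<star> ?Z) = ?C \<star> (?X \<star> (?Y \<star> ?Z))"
      unfolding bX by (rule cauchy_prod_assoc'[OF r(1) _ n(1) null_at_cauchy_prod[OF r(1) n(2,3)]]) simp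
    also have "?X \<star> (?Y \<star> ?Z) = ?X \<star> ?Y \<star> ?Z"
      by (rule cauchy_prod_assoc'[OF r(1) n, symmetric])
    also have "?X \<star> ?Y = const_series 1" using XY by (simp add: unit_on_def)
    finally show "coef b \<star> (?Y \<star> ?Z) = coef a" by (simp add: aZ)
  qed
qed

text \<open>The annuli with radii 1/(n+1) and n+1 exhaust the punctured line. All of them contain
  the circle |X| = 1, where cancellation shows that their quotients are one and the same
  series.\<close>

lemma analytic_divides:
  assumes a: "a \<in> analytic_level i" "a \<noteq> (0 :: 'a analytic)" and b: "b \<in> analytic_level i" "b \<noteq> 0"
    and le: "\<And>\<beta>. \<beta> \<noteq> 0 \<Longrightarrow> zero_order i \<beta> b \<le> zero_order i \<beta> a"
  obtains c where "c \<in> analytic_level i" "a = b * c"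
proof -
  have "\<exists>c. lev i c \<and> (\<forall>s. 1 / real (Suc n) \<le> s \<longrightarrow> s \<le> real (Suc n) \<longrightarrow> null_at s c) \<and> coef b \<star> c = coef a" for n
  proof (rule divides_on_annulus[OF a b le])
    show "0 < 1 / real (Suc n)" by simp
    show "1 / real (Suc n) \<le> real (Suc n)" by (rule order_trans[of _ 1]) auto
  qed blast+
  then obtain c where c: "\<And>n. lev i (c n)"
    "\<And>n s. 1 / real (Suc n) \<le> s \<Longrightarrow> s \<le> real (Suc n) \<Longrightarrow> null_at s (c n)" "\<And>n. coef b \<star> c n = coef a"
    by metis
  have n1: "null_at 1 (c n)" for n by (rule c(2)) auto
  have b0: "coef b \<noteq> (\<lambda>_. 0)" using b by (simp add: coef_eq_0_iff)
  have eq: "c n = c 0" for n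
    by (rule cauchy_prod_cancel[OF zero_less_one n1 n1 _ _ b0]) (simp_all add: c(3))
  have null: "null_at s (c 0)" if "s > 0" for s
  proof -
    obtain n where n: "real n \<ge> max s (1 / s)" using real_arch_simple by blast
    have "1 / real (Suc n) \<le> s" "s \<le> real (Suc n)" using n that by (auto simp: field_simps)
    then show ?thesis using c(2)[of n s] eq[of n] by simp
  qed
  note cc = coef_Abs[OF c(1)[of 0] null]
  show ?thesis
  proof (rule that[of "Abs_analytic (c 0)"])
    show "Abs_analytic (c 0) \<in> analytic_level i" by (rule cc(2))
    have "coef a = coef (b * Abs_analytic (c 0))" using c(3)[of 0] by (simp add: coef_mult cc(1))
    then show "a = b * Abs_analytic (c 0)" by (simp add: coef_inject)
  qed
qed

section \<open>Dilations\<close>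

text \<open>\<open>dilate\<close> for series that converge only on an annulus, such as the units of
  a factorisation.\<close>

definition dilate_series :: "nat \<Rightarrow> 'a \<Rightarrow> (rat \<Rightarrow> 'a) \<Rightarrow> rat \<Rightarrow> 'a" where
  "dilate_series i c a n = (if n \<in> exponents_level (residue_char TYPE('a)) i
     then c powi \<lfloor>n * of_nat (residue_char TYPE('a) ^ i)\<rfloor> * a n else 0)"

lemma coef_dilate: "c \<noteq> 0 \<Longrightarrow> coef (dilate i c g) = dilate_series i c (coef g)"
  by (auto simp: dilate.rep_eq dilate_series_def fun_eq_iff)

lemma exponents_levelE:
  assumes "n \<in> exponents_level (residue_char TYPE('a)) i"
  obtains k where "n = of_int k / of_nat (residue_char TYPE('a) ^ i)" "\<lfloor>n * of_nat (residue_char TYPE('a) ^ i)\<rfloor> = k"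
proof -
  obtain k where k: "n = of_int k / of_nat (residue_char TYPE('a) ^ i)"
    using assms by (auto simp: exponents_level_def)
  moreover have "n * of_nat (residue_char TYPE('a) ^ i) = of_int k" using k by simp
  ultimately show ?thesis using that by (metis floor_of_int)
qed

lemma lev_dilate_series: "lev i (dilate_series i c a)"
  by (rule levI) (simp add: dilate_series_def)

lemma dilate_series_mult:
  assumes c: "c \<noteq> 0" and a: "lev i a" and b: "lev i b"
  shows "dilate_series i c (a \<star> b) = dilate_series i c a \<star> dilate_series i c b"
proof
  fix n
  let ?E = "exponents_level (residue_char TYPE('a)) i" and ?N = "of_nat (residue_char TYPE('a) ^ i) :: rat"
  show "dilate_series i c (a \<star> b) n = (dilate_series i c a \<star> dilate_series i c b) n"
  proof (cases "n \<in> ?E")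
    case False
    then have "(dilate_series i c a \<star> dilate_series i c b) n = 0"
      using lev_mult[OF lev_dilate_series lev_dilate_series] unfolding lev_def by blast
    then show ?thesis using False by (simp add: dilate_series_def)
  next
    case True
    have term_eq: "dilate_series i c a m * dilate_series i c b (n - m) = c powi \<lfloor>n * ?N\<rfloor> * (a m * b (n - m))" for m
    proof (cases "m \<in> ?E")
      case m: True
      have nm: "n - m \<in> ?E" by (rule exponents_level_diff[OF True m])
      obtain k l where kl: "n = of_int k / ?N" "m = of_int l / ?N"
        using True m by (metis exponents_levelE)
      have "n * ?N = of_int k" "m * ?N = of_int l" "(n - m) * ?N = of_int (k - l)"
        using kl by (auto simp: field_simps)
      then have "\<lfloor>n * ?N\<rfloor> = k" "\<lfloor>m * ?N\<rfloor> = l" "\<lfloor>(n - m) * ?N\<rfloor> = k - l" by auto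
      moreover have "c powi l * c powi (k - l) = c powi k" using c by (simp flip: power_int_add)
      ultimately show ?thesis using m nm by (simp add: dilate_series_def mult_ac)
    next
      case False
      then have "a m = 0" using a levD by blast
      then show ?thesis by (simp add: dilate_series_def)
    qed
    have "(dilate_series i c a \<star> dilate_series i c b) n = c powi \<lfloor>n * ?N\<rfloor> * (a \<star> b) n"
      unfolding cauchy_prod_def term_eq by (rule infsum_cmult_right')
    then show ?thesis using True by (simp add: dilate_series_def)
  qed
qed

lemma dilate_series_const: "dilate_series i c (const_series d) = const_series d"
  using exponents_level_closed(1) by (auto simp: dilate_series_def const_series_def fun_eq_iff)

lemma dilate_series_mono:
  "dilate_series i c (mono_series (of_int k / of_nat (residue_char TYPE('a) ^ i)) d) =
   mono_series (of_int k / of_nat (residue_char TYPE('a) ^ i)) (c powi k * d)"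
  using of_int_div_in_exponents_level[of k "residue_char TYPE('a)" i]
  by (auto simp: dilate_series_def mono_series_def fun_eq_iff)

lemma dilate_series_inverse:
  assumes "c \<noteq> 0" "lev i a"
  shows "dilate_series i (inverse c) (dilate_series i c a) = a"
proof
  fix n
  show "dilate_series i (inverse c) (dilate_series i c a) n = a n"
  proof (cases "n \<in> exponents_level (residue_char TYPE('a)) i")
    case True
    then show ?thesis using assms(1) by (simp add: dilate_series_def power_int_inverse)
  next
    case False
    then show ?thesis using levD[OF assms(2)] by (auto simp: dilate_series_def)
  qed
qed

text \<open>Y -> c Y multiplies the radius in X by |c|^N. It is an inequality only because terms
  outside the level are dropped.\<close>

lemma wabs_dilate_series_le:
  assumes c: "c \<noteq> 0" and t: "t > 0"
  shows "wabs t (dilate_series i c a) n \<le> wabs (absv c ^ (residue_char TYPE('a) ^ i) * t) a n"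
proof (cases "n \<in> exponents_level (residue_char TYPE('a)) i")
  case True
  let ?N = "residue_char TYPE('a) ^ i"
  obtain k where k: "n = of_int k / of_nat ?N" "\<lfloor>n * of_nat ?N\<rfloor> = k" using True by (rule exponents_levelE)
  have c0: "absv c > 0" using c by simp
  have "(absv c ^ ?N) powr of_rat n = (absv c powr real ?N) powr (of_int k / real ?N)"
    by (simp only: powr_realpow[OF c0] k(1) of_rat_divide of_rat_of_nat_eq of_rat_of_int_eq)
  also have "\<dots> = absv c powr of_int k" unfolding powr_powr by simp
  also have "\<dots> = absv c powi k" using c0 powr_real_of_int'[of "absv c" k] by simp
  finally have "wabs t (dilate_series i c a) n = wabs (absv c ^ ?N * t) a n"
    using True k(2) c0 t by (simp add: wabs_def dilate_series_def absv_mult absv_power_int powr_mult)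
  then show ?thesis by simp
qed (simp add: dilate_series_def wabs_def)

lemma null_at_dilate_series:
  assumes "c \<noteq> 0" "t > 0" "null_at (absv c ^ (residue_char TYPE('a) ^ i) * t) a"
  shows "null_at t (dilate_series i c a)"
  unfolding null_at_wabs
proof (intro allI impI)
  fix e :: real assume "e > 0"
  have "{n. e \<le> wabs t (dilate_series i c a) n} \<subseteq> {n. e \<le> wabs (absv c ^ (residue_char TYPE('a) ^ i) * t) a n}"
    using wabs_dilate_series_le[OF assms(1,2)] order_trans by blast
  then show "finite {n. e \<le> wabs t (dilate_series i c a) n}"
    using assms(3) \<open>e > 0\<close> unfolding null_at_wabs by (meson finite_subset)
qed

lemma dilate_poly_series:
  "dilate_series i c (poly_series i G) = poly_series i (pcompose G [:0, c:])"
proof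
  fix n
  let ?N = "residue_char TYPE('a) ^ i"
  show "dilate_series i c (poly_series i G) n = poly_series i (pcompose G [:0, c:]) n"
  proof (cases "\<exists>k. n = of_nat k / of_nat ?N")
    case True
    then obtain k where k: "n = of_nat k / of_nat ?N" by blast
    have "\<lfloor>n * of_nat ?N\<rfloor> = int k" using k by simp
    then show ?thesis
      using of_nat_div_in_exponents_level[of k "residue_char TYPE('a)" i]
      by (simp add: dilate_series_def k poly_series_at coeff_pcompose_linear)
  next
    case False
    then have "poly_series i F n = 0" for F :: "'a poly" by (metis poly_series_nonzeroE)
    then show ?thesis by (simp add: dilate_series_def)
  qed
qed

lemma order_pcompose_linear:
  fixes P :: "'b::field poly"
  assumes c: "c \<noteq> 0" and P: "P \<noteq> 0"
  shows "order \<beta> (pcompose P [:0, c:]) = order (c * \<beta>) P"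
proof -
  obtain S where S: "P = [:- (c * \<beta>), 1:] ^ order (c * \<beta>) P * S" "\<not> [:- (c * \<beta>), 1:] dvd S"
    using order_decomp[OF P] by blast
  have S0: "S \<noteq> 0" using S P by auto
  have S\<beta>: "poly S (c * \<beta>) \<noteq> 0" using S(2) poly_eq_0_iff_dvd by blast
  have l: "pcompose [:- (c * \<beta>), 1:] [:0, c:] = smult c [:- \<beta>, 1:]" by (simp add: pcompose_pCons)
  have pow: "pcompose (A ^ n) B = pcompose A B ^ n" for A B :: "'b poly" and n
    by (induction n) (simp_all add: pcompose_mult pcompose_1)
  have eq: "pcompose P [:0, c:] = smult c [:- \<beta>, 1:] ^ order (c * \<beta>) P * pcompose S [:0, c:]"
    by (subst S(1)) (simp only: pcompose_mult pow l)
  have "order \<beta> (pcompose S [:0, c:]) = 0"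
    using S\<beta> by (intro order_0I) (simp add: poly_pcompose mult.commute)
  moreover have "pcompose S [:0, c:] \<noteq> 0" using S0 c pcompose_eq_0[of S "[:0, c:]"] by auto
  moreover have "smult c [:- \<beta>, 1:] \<noteq> 0" using c by simp
  moreover have "order \<beta> (smult c [:- \<beta>, 1:]) = 1"
    by (simp only: order_smult[OF c]) (use order_power_n_n[of \<beta> 1] in simp)
  ultimately show ?thesis unfolding eq using c by (subst order_mult) (simp_all add: order_power del: smult_pCons)
qed

lemma dilate_level: "(c :: 'a) \<noteq> 0 \<Longrightarrow> dilate i c g \<in> analytic_level i"
  unfolding lev_coef_iff[symmetric] by (simp add: coef_dilate lev_dilate_series)

lemma dilate_mult:
  assumes "(c :: 'a) \<noteq> 0" "g \<in> analytic_level i" "h \<in> analytic_level i"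
  shows "dilate i c (g * h) = dilate i c g * dilate i c h"
proof -
  have "coef (dilate i c (g * h)) = coef (dilate i c g * dilate i c h)"
    using assms by (simp add: coef_dilate coef_mult dilate_series_mult lev_coef_iff)
  then show ?thesis by (simp add: coef_inject)
qed

lemma dilate_dilate_inverse:
  assumes "(c :: 'a) \<noteq> 0" "g \<in> analytic_level i"
  shows "dilate i (inverse c) (dilate i c g) = g"
proof -
  have "coef (dilate i (inverse c) (dilate i c g)) = coef g"
    using assms by (simp add: coef_dilate dilate_series_inverse lev_coef_iff)
  then show ?thesis by (simp add: coef_inject)
qed

lemma dilate_0: "(c :: 'a) \<noteq> 0 \<Longrightarrow> dilate i c 0 = 0"
proof -
  assume "c \<noteq> 0"
  then have "coef (dilate i c 0) = (\<lambda>_. 0)"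
    using coef_eq_0_iff[of "0 :: 'a analytic"] by (auto simp: coef_dilate dilate_series_def)
  then show ?thesis by (simp add: coef_eq_0_iff)
qed

lemma dilate_eq_0_iff: "(c :: 'a) \<noteq> 0 \<Longrightarrow> g \<in> analytic_level i \<Longrightarrow> dilate i c g = 0 \<longleftrightarrow> g = 0"
  using dilate_dilate_inverse[of c g i] dilate_0[of c i] dilate_0[of "inverse c" i] by auto

text \<open>A factorisation on the circle through c \<beta> is carried by the dilation to one on the
  circle through \<beta>, with polynomial part G(c Y).\<close>

lemma zero_order_dilate:
  assumes c: "c \<noteq> 0" and g: "g \<in> analytic_level i" "g \<noteq> 0" and \<beta>: "\<beta> \<noteq> 0"
  shows "zero_order i \<beta> (dilate i c g) = zero_order i (to_ac c * \<beta>) g"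
proof -
  let ?N = "residue_char TYPE('a) ^ i"
  let ?t = "w \<beta> ^ ?N" and ?t' = "w (to_ac c * \<beta>) ^ ?N"
  have t: "?t > 0" "?t' > 0" "to_ac c * \<beta> \<noteq> 0" using c \<beta> by auto
  have t': "?t' = absv c ^ ?N * ?t" by (simp add: w_mult power_mult_distrib)
  obtain G u v where G: "G \<noteq> 0" "unit_on ?t' ?t' i u v" "coef g = poly_series i G \<star> u"
    by (rule analytic_factorisation[OF g t(2) order_refl])
  have un: "unit_on ?t ?t i (dilate_series i c u) (dilate_series i c v)"
    unfolding unit_on_def
  proof (intro conjI allI impI)
    show "null_at s (dilate_series i c u)" "null_at s (dilate_series i c v)" if "?t \<le> s" "s \<le> ?t" for s
      using that null_at_dilate_series[OF c t(1)] G(2) t' by (auto simp: unit_on_def)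
    show "dilate_series i c u \<star> dilate_series i c v = const_series 1"
      using dilate_series_mult[OF c, of i u v] G(2) by (simp add: unit_on_def dilate_series_const)
  qed (rule lev_dilate_series)+
  let ?G = "pcompose G [:0, c:]"
  have "?G \<noteq> 0" using G(1) c pcompose_eq_0[of G "[:0, c:]"] by auto
  moreover have "coef (dilate i c g) = poly_series i ?G \<star> dilate_series i c u"
    using G c by (simp add: coef_dilate dilate_series_mult lev_poly_series unit_on_def flip: dilate_poly_series)
  ultimately have "weierstrass_at ?t i (coef (dilate i c g)) ?G" using weierstrass_atI[OF _ un] by simp
  then have "zero_order i \<beta> (dilate i c g) = order \<beta> (ac_poly ?G)" by (rule zero_order_eq[OF \<beta>])
  also have "\<dots> = order (to_ac c * \<beta>) (ac_poly G)"
    using order_pcompose_linear[of "to_ac c" "ac_poly G" \<beta>] c G(1)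
    by (simp add: ac_poly_pcompose map_poly_pCons)
  also have "\<dots> = zero_order i (to_ac c * \<beta>) g"
    by (rule zero_order_eq[OF t(3) weierstrass_atI[OF G], symmetric]) simp_all
  finally show ?thesis .
qed

end

section \<open>Theta functions\<close>

text \<open>The coefficients of the product \<open>\<Prod>m. C (Q\<^sup>m Y)\<close>, where \<open>C = \<Sum> c j Y\<^sup>j\<close> and \<open>c 0 = 1\<close>: the
  recursion is the functional equation \<open>A (Y) = C (Y) A (Q Y)\<close>.\<close>

fun q_product :: "(nat \<Rightarrow> 'a::field) \<Rightarrow> 'a \<Rightarrow> nat \<Rightarrow> 'a" where
  "q_product c Q 0 = 1"
| "q_product c Q (Suc n) = (\<Sum>j\<le>n. c (Suc j) * Q ^ (n - j) * q_product c Q (n - j)) / (1 - Q ^ Suc n)"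

lemma absv_1_minus_power:
  fixes Q :: "'a::nonarch_field"
  assumes "absv Q < 1"
  shows "absv (1 - Q ^ Suc n) = 1"
proof -
  have "absv Q ^ Suc n \<le> absv Q ^ 1" using assms by (intro power_decreasing) auto
  then have "absv (Q ^ Suc n) < 1" using assms unfolding absv_power by simp
  then show ?thesis using absv_add_eq[of "- (Q ^ Suc n)" 1] by simp
qed

text \<open>The summand j = 0 is Q^n times the n-th coefficient itself; moving it to the other side
  produces the denominator 1 - Q^n of the recursion.\<close>

lemma q_product_eq:
  fixes Q :: "'a::nonarch_field"
  assumes Q: "absv Q < 1" and c: "c 0 = 1"
  shows "q_product c Q n = (\<Sum>j\<le>n. c j * Q ^ (n - j) * q_product c Q (n - j))"
proof (cases n)
  case (Suc m)
  have ne: "1 - Q ^ Suc m \<noteq> 0" using absv_1_minus_power[OF Q, of m] by auto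
  have "(\<Sum>j\<le>m. c (Suc j) * Q ^ (m - j) * q_product c Q (m - j)) = (1 - Q ^ Suc m) * q_product c Q (Suc m)"
    using ne by (simp del: power_Suc)
  then have "(\<Sum>j\<le>Suc m. c j * Q ^ (Suc m - j) * q_product c Q (Suc m - j)) =
      Q ^ Suc m * q_product c Q (Suc m) + (1 - Q ^ Suc m) * q_product c Q (Suc m)"
    unfolding sum.atMost_Suc_shift by (simp only: c diff_zero mult_1 diff_Suc_Suc)
  also have "\<dots> = q_product c Q (Suc m)" by (simp add: algebra_simps del: q_product.simps power_Suc)
  finally show ?thesis using Suc by simp
qed (simp add: c)

lemma absv_q_product_term:
  fixes Q :: "'a::nonarch_field"
  assumes s: "s > 0" and j: "j \<le> n"
  shows "absv (c (Suc j) * Q ^ (n - j) * q_product c Q (n - j)) * s ^ Suc n =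
    (absv (c (Suc j)) * s ^ Suc j) * absv Q ^ (n - j) * (absv (q_product c Q (n - j)) * s ^ (n - j))"
proof -
  have "s ^ Suc n = s ^ Suc j * s ^ (n - j)" using j by (simp flip: power_add)
  then show ?thesis by (simp add: absv_mult absv_power mult_ac del: power_Suc)
qed

text \<open>As \<open>C\<close> has degree at most \<open>d\<close>, only the last \<open>d\<close>
  coefficients enter the recursion, with powers of \<open>Q\<close> of exponent at least
  \<open>k0\<close> once n exceeds \<open>n0\<close>. These outweigh the coefficients of
  \<open>C\<close>, so a bound for the first values persists. The radius is arbitrary: the product
  is entire.\<close>

lemma q_product_bounded:
  fixes Q :: "'a::nonarch_field"
  assumes Q: "absv Q < 1" and c: "\<And>j. d < j \<Longrightarrow> c j = 0" and s: "s > 0"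
  obtains B where "\<And>n. absv (q_product c Q n) * s ^ n \<le> B"
proof -
  define C where "C = Max (insert 1 ((\<lambda>j. absv (c j) * s ^ j) ` {..d}))"
  have C: "absv (c j) * s ^ j \<le> C" if "j \<le> d" for j unfolding C_def using that by (intro Max_ge) auto
  have C1: "1 \<le> C" unfolding C_def by (intro Max_ge) auto
  have "(\<lambda>k. C * absv Q ^ k) \<longlonglongrightarrow> C * 0"
    using Q by (intro tendsto_mult tendsto_const LIMSEQ_realpow_zero) auto
  then have "eventually (\<lambda>k. C * absv Q ^ k < 1) sequentially" by (simp add: order_tendsto_iff)
  then obtain k0 where k0: "C * absv Q ^ k0 < 1" by (auto simp: eventually_sequentially)
  define n0 where "n0 = d + k0"
  define B where "B = Max (insert 1 ((\<lambda>n. absv (q_product c Q n) * s ^ n) ` {..n0}))"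
  have B1: "1 \<le> B" unfolding B_def by (intro Max_ge) auto
  have "absv (q_product c Q n) * s ^ n \<le> B" for n
  proof (induction n rule: less_induct)
    case (less n)
    show ?case
    proof (cases "n \<le> n0")
      case True
      then show ?thesis unfolding B_def by (intro Max_ge) auto
    next
      case False
      then obtain m where m: "n = Suc m" "n0 \<le> m" by (cases n) auto
      have "absv (\<Sum>j\<le>m. c (Suc j) * Q ^ (m - j) * q_product c Q (m - j)) \<le> B / s ^ Suc m"
      proof (rule absv_sum_le)
        fix j assume j: "j \<in> {..m}"
        show "absv (c (Suc j) * Q ^ (m - j) * q_product c Q (m - j)) \<le> B / s ^ Suc m"
        proof (cases "Suc j \<le> d")
          case True
          then have "k0 \<le> m - j" using m by (simp add: n0_def)
          have "(absv (c (Suc j)) * s ^ Suc j) * absv Q ^ (m - j) * (absv (q_product c Q (m - j)) * s ^ (m - j))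
              \<le> C * absv Q ^ k0 * B"
          proof (intro mult_mono)
            show "absv (c (Suc j)) * s ^ Suc j \<le> C" by (rule C[OF True])
            show "absv Q ^ (m - j) \<le> absv Q ^ k0" using Q \<open>k0 \<le> m - j\<close> by (intro power_decreasing) auto
            show "absv (q_product c Q (m - j)) * s ^ (m - j) \<le> B" using m by (intro less) auto
          qed (use s C1 in auto)
          also have "\<dots> \<le> 1 * B" using k0 B1 by (intro mult_right_mono) auto
          finally show ?thesis
            using absv_q_product_term[OF s, of j m c Q] j s by (simp add: pos_le_divide_eq del: power_Suc)
        next
          case False
          then have "c (Suc j) = 0" by (intro c) simp
          then show ?thesis using B1 s by simp
        qed
      qed (use B1 s in auto)
      then have "absv (q_product c Q n) \<le> B / s ^ Suc m"
        using absv_1_minus_power[OF Q, of m] by (simp add: m(1) absv_divide del: power_Suc)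
      then show ?thesis using s by (simp add: m(1) pos_le_divide_eq del: power_Suc q_product.simps)
    qed
  qed
  then show ?thesis by (rule that)
qed

lemma absv_sum_less:
  fixes f :: "'b \<Rightarrow> 'a::nonarch_field"
  assumes "finite A" "\<And>x. x \<in> A \<Longrightarrow> absv (f x) < B" "0 < B"
  shows "absv (sum f A) < B"
  using assms
proof (induction A rule: finite_induct)
  case (insert x F)
  have "absv (f x + sum f F) \<le> max (absv (f x)) (absv (sum f F))" by (rule absv_add_le)
  also have "\<dots> < B" using insert by auto
  finally show ?case using insert by simp
qed auto

text \<open>If the constant term 1 of \<open>C\<close> dominates at radius \<open>s\<close>, it does
  so for every factor C(Q^m Y), because |Q^m Y| is at most \<open>s\<close>, and hence for the
  product.\<close>

lemma q_product_small:
  fixes Q :: "'a::nonarch_field"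
  assumes Q: "absv Q < 1" and s: "s > 0" and c: "\<And>j. j > 0 \<Longrightarrow> absv (c j) * s ^ j < 1"
  shows "n > 0 \<Longrightarrow> absv (q_product c Q n) * s ^ n < 1"
proof (induction n rule: less_induct)
  case (less n)
  then obtain m where m: "n = Suc m" by (cases n) auto
  have "absv (\<Sum>j\<le>m. c (Suc j) * Q ^ (m - j) * q_product c Q (m - j)) < 1 / s ^ Suc m"
  proof (rule absv_sum_less)
    fix j assume j: "j \<in> {..m}"
    have "absv (q_product c Q (m - j)) * s ^ (m - j) \<le> 1"
      using less.IH[of "m - j"] m by (cases "m - j = 0") (auto intro: less_imp_le)
    moreover have "absv Q ^ (m - j) \<le> 1" using Q by (intro power_le_one) auto
    ultimately have "absv Q ^ (m - j) * (absv (q_product c Q (m - j)) * s ^ (m - j)) \<le> 1 * 1"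
      using s by (intro mult_mono) auto
    then have "(absv (c (Suc j)) * s ^ Suc j) * (absv Q ^ (m - j) * (absv (q_product c Q (m - j)) * s ^ (m - j)))
        \<le> absv (c (Suc j)) * s ^ Suc j * 1"
      using s by (intro mult_left_mono) auto
    also have "\<dots> < 1" using c[of "Suc j"] by simp
    finally show "absv (c (Suc j) * Q ^ (m - j) * q_product c Q (m - j)) < 1 / s ^ Suc m"
      using absv_q_product_term[OF s, of j m c Q] j s by (simp add: pos_less_divide_eq mult.assoc del: power_Suc)
  qed (use s in auto)
  then have "absv (q_product c Q n) < 1 / s ^ Suc m"
    using absv_1_minus_power[OF Q, of m] by (simp add: m(1) absv_divide del: power_Suc)
  then show ?case using s by (simp add: m(1) pos_less_divide_eq del: power_Suc q_product.simps)
qed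

context abs_extension
begin

text \<open>The sum of f(k) Y^k over all integers k, written as a series in X.\<close>

definition laurent :: "nat \<Rightarrow> (int \<Rightarrow> 'a) \<Rightarrow> rat \<Rightarrow> 'a" where
  "laurent i f n = (if n \<in> exponents_level (residue_char TYPE('a)) i
     then f \<lfloor>n * of_nat (residue_char TYPE('a) ^ i)\<rfloor> else 0)"

lemma laurent_at [simp]: "laurent i f (of_int k / of_nat (residue_char TYPE('a) ^ i)) = f k"
  using of_int_div_in_exponents_level[of k "residue_char TYPE('a)" i] by (simp add: laurent_def)

lemma lev_laurent: "lev i (laurent i f)"
  by (rule levI) (simp add: laurent_def)

lemma lev_series_eqI:
  assumes "lev i a" "lev i b"
    and eq: "\<And>k. a (of_int k / of_nat (residue_char TYPE('a) ^ i)) = b (of_int k / of_nat (residue_char TYPE('a) ^ i))"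
  shows "a = (b :: rat \<Rightarrow> 'a)"
proof
  fix n
  show "a n = b n"
  proof (cases "n \<in> exponents_level (residue_char TYPE('a)) i")
    case True
    then show ?thesis using eq by (metis exponents_levelE)
  next
    case False
    then have "a n = 0" "b n = 0" using assms(1,2) unfolding lev_def by blast+
    then show ?thesis by simp
  qed
qed

lemma dilate_series_at:
  "dilate_series i c a (of_int k / of_nat (residue_char TYPE('a) ^ i)) =
   c powi k * a (of_int k / of_nat (residue_char TYPE('a) ^ i))"
  using of_int_div_in_exponents_level[of k "residue_char TYPE('a)" i] by (simp add: dilate_series_def)

lemma wabs_at:
  assumes "t > 0"
  shows "wabs (t ^ (residue_char TYPE('a) ^ i)) (a :: rat \<Rightarrow> 'a) (of_int k / of_nat (residue_char TYPE('a) ^ i)) =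
    absv (a (of_int k / of_nat (residue_char TYPE('a) ^ i))) * t powi k"
proof -
  let ?N = "residue_char TYPE('a) ^ i"
  have "(t ^ ?N) powr of_rat (of_int k / of_nat ?N) = (t powr real ?N) powr (of_int k / real ?N)"
    by (simp only: powr_realpow[OF assms] of_rat_divide of_rat_of_nat_eq of_rat_of_int_eq)
  also have "\<dots> = t powr of_int k" unfolding powr_powr by simp
  also have "\<dots> = t powi k" using assms powr_real_of_int'[of t k] by simp
  finally show ?thesis by (simp add: wabs_def)
qed

text \<open>Boundedness on all circles suffices: it is applied at radii s/2 and 2s, between which it
  becomes convergence.\<close>

lemma null_at_laurent:
  assumes bd: "\<And>t. t > 0 \<Longrightarrow> \<exists>B. \<forall>k. absv (f k) * t powi k \<le> B" and s: "s > 0"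
  shows "null_at s (laurent i f)"
proof -
  let ?N = "residue_char TYPE('a) ^ i"
  have le: "\<exists>B. \<forall>n. wabs R (laurent i f) n \<le> B" if R: "R > 0" for R
  proof -
    have t: "root ?N R > 0" "root ?N R ^ ?N = R" using R by auto
    obtain B where B: "\<And>k. absv (f k) * root ?N R powi k \<le> B" using bd[OF t(1)] by blast
    have "wabs R (laurent i f) n \<le> max B 0" for n
    proof (cases "n \<in> exponents_level (residue_char TYPE('a)) i")
      case True
      then obtain k where k: "n = of_int k / of_nat ?N" by (metis exponents_levelE)
      have "wabs (root ?N R ^ ?N) (laurent i f) n \<le> B" unfolding k wabs_at[OF t(1)] using B by simp
      then show ?thesis using t by simp
    qed (simp add: laurent_def wabs_def)
    then show ?thesis by blast
  qed
  obtain B1 B2 where "\<And>n. wabs (s / 2) (laurent i f) n \<le> B1" "\<And>n. wabs (2 * s) (laurent i f) n \<le> B2"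
    using le[of "s / 2"] le[of "2 * s"] s by auto
  then show ?thesis
    using s by (intro null_at_between[OF _ _ _ lev_laurent, of "s / 2" s "2 * s" i f "max B1 B2"])
      (auto simp: le_max_iff_disj)
qed

section \<open>Polynomials and monomials in \<open>Y\<close> as analytic functions\<close>

definition apoly :: "nat \<Rightarrow> 'a poly \<Rightarrow> 'a analytic" where
  "apoly i G = Abs_analytic (poly_series i G)"

definition amono :: "nat \<Rightarrow> int \<Rightarrow> 'a \<Rightarrow> 'a analytic" where
  "amono i k c = Abs_analytic (mono_series (of_int k / of_nat (residue_char TYPE('a) ^ i)) c)"

lemma coef_apoly [simp]: "coef (apoly i G) = poly_series i G"
  and apoly_level [simp]: "apoly i G \<in> analytic_level i"
  unfolding apoly_def using coef_Abs[OF lev_poly_series null_at_poly_series] by auto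

lemma coef_amono [simp]: "coef (amono i k c) = mono_series (of_int k / of_nat (residue_char TYPE('a) ^ i)) c"
  and amono_level [simp]: "amono i k c \<in> analytic_level i"
  unfolding amono_def
  using coef_Abs[OF lev_mono[OF of_int_div_in_exponents_level] null_at_mono] by auto

lemma amono_mult: "amono i k c * amono i l d = amono i (k + l) (c * d)"
proof -
  have "coef (amono i k c * amono i l d) = coef (amono i (k + l) (c * d))"
    by (simp add: coef_mult mono_series_mult add_divide_distrib)
  then show ?thesis by (simp only: coef_inject)
qed

lemma amono_0_1: "amono i 0 1 = 1"
proof -
  have "coef (amono i 0 1) = coef 1" by (simp add: mono_series_0 one_analytic.rep_eq)
  then show ?thesis by (simp only: coef_inject)
qed

lemma amono_nonzero: "c \<noteq> 0 \<Longrightarrow> amono i k c \<noteq> 0"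
  using amono_mult[of i k c "- k" "inverse c"] amono_0_1[of i] by auto

lemma dilate_amono: "c \<noteq> 0 \<Longrightarrow> dilate i c (amono i k d) = amono i k (c powi k * d)"
proof -
  assume "c \<noteq> 0"
  then have "coef (dilate i c (amono i k d)) = coef (amono i k (c powi k * d))"
    by (simp add: coef_dilate dilate_series_mono)
  then show ?thesis by (simp only: coef_inject)
qed

lemma sole_term_0:
  assumes t: "t > 0" and a: "lev i a" "a 0 \<noteq> 0"
    and lt: "\<And>k. k \<noteq> 0 \<Longrightarrow> absv (a (of_int k / of_nat (residue_char TYPE('a) ^ i))) * t powi k < absv (a 0)"
  shows "sole_term (t ^ (residue_char TYPE('a) ^ i)) (a :: rat \<Rightarrow> 'a) 0"
  unfolding sole_term_def
proof (intro conjI allI impI)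
  let ?N = "residue_char TYPE('a) ^ i"
  fix n :: rat assume n: "n \<noteq> 0"
  have a0: "wabs (t ^ ?N) a 0 = absv (a 0)" using t by (simp add: wabs_def)
  show "wabs (t ^ ?N) a n < wabs (t ^ ?N) a 0"
  proof (cases "a n = 0")
    case True
    then show ?thesis using a(2) by (simp only: a0) (simp add: wabs_def)
  next
    case False
    then obtain k where k: "n = of_int k / of_nat ?N" using a(1) levD by (metis exponents_levelE)
    then have "k \<noteq> 0" using n by auto
    then show ?thesis unfolding a0 unfolding k wabs_at[OF t] by (rule lt)
  qed
qed (rule a(2))

text \<open>The product over all integers m of R(Q^m Y) has to be normalised differently at its two
  ends. For m \<ge> 0 each factor is divided by R(0); for m < 0 it is divided by its leading term,
  which leaves S(Q^(-m) / Y) with the reversed polynomial S. Then F(Y) = R1(Y) F(Q Y), R(Y) G(Y) =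
  Y^D G(Q Y), and \<theta> = F G.\<close>

lemma theta_exists:
  fixes R :: "'a poly"
  assumes Q: "0 < absv Q" "absv Q < 1" and monic: "lead_coeff R = 1"
    and roots: "\<And>x. poly (ac_poly R) x = 0 \<Longrightarrow> absv Q < w x \<and> w x \<le> 1"
  obtains \<theta> c where "\<theta> \<in> analytic_level i" "\<theta> \<noteq> 0" "c \<noteq> 0"
    "dilate i (inverse Q) \<theta> = amono i (int (degree R)) c * \<theta>"
    "\<And>\<beta>. absv Q < w \<beta> \<Longrightarrow> w \<beta> \<le> 1 \<Longrightarrow> zero_order i \<beta> \<theta> = order \<beta> (ac_poly R)"
proof -
  let ?N = "residue_char TYPE('a) ^ i"
  define D where "D = degree R"
  define r0 where "r0 = coeff R 0"
  have Q0: "Q \<noteq> 0" using Q by auto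
  have R0: "R \<noteq> 0" using monic by auto
  have r0: "r0 \<noteq> 0"
  proof
    assume "r0 = 0"
    then have "poly (ac_poly R) 0 = 0" by (simp add: r0_def poly_0_coeff_0)
    then show False using roots[of 0] Q by simp
  qed
  define R1 where "R1 = smult (inverse r0) R"
  define S where "S = reflect_poly R"
  have R1: "R1 \<noteq> 0" "coeff R1 0 = 1" "degree R1 = D" using r0 R0 by (auto simp: R1_def r0_def D_def)
  have S: "S \<noteq> 0" "coeff S 0 = 1" "degree S = D" using r0 R0 monic by (auto simp: S_def r0_def D_def)
  define a where "a = q_product (coeff R1) Q"
  define b where "b = q_product (coeff S) Q"
  define f where "f = (\<lambda>k::int. if 0 \<le> k then a (nat k) else 0)"
  \<comment> \<open>G(Y) = B(Q/Y), where B is the product of S(Q^m Z) over m \<ge> 0. It starts with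
    the factor S(Q/Y), so that the zeros of \<open>R\<close> itself are counted once, by
    \<open>F\<close>.\<close>
  define g where "g = (\<lambda>k::int. if k \<le> 0 then Q ^ nat (- k) * b (nat (- k)) else 0)"
  define F where "F = Abs_analytic (laurent i f)"
  define G where "G = Abs_analytic (laurent i g)"
  have nf: "null_at s (laurent i f)" if "s > 0" for s
  proof (rule null_at_laurent[OF _ that])
    fix t :: real assume t: "t > 0"
    obtain B where B: "\<And>n. absv (a n) * t ^ n \<le> B"
      unfolding a_def using q_product_bounded[OF Q(2) _ t, of D "coeff R1"] R1(3) by (metis coeff_eq_0)
    have "absv (f k) * t powi k \<le> max B 0" for k
      using B[of "nat k"] by (auto simp: f_def power_int_def)
    then show "\<exists>B. \<forall>k. absv (f k) * t powi k \<le> B" by blast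
  qed
  have ng: "null_at s (laurent i g)" if "s > 0" for s
  proof (rule null_at_laurent[OF _ that])
    fix t :: real assume t: "t > 0"
    have t': "absv Q / t > 0" using t Q by simp
    obtain B where B: "\<And>n. absv (b n) * (absv Q / t) ^ n \<le> B"
      unfolding b_def using q_product_bounded[OF Q(2) _ t', of D "coeff S"] S(3) by (metis coeff_eq_0)
    have "absv (g k) * t powi k \<le> max B 0" for k
      using B[of "nat (- k)"] by (auto simp: g_def power_int_def absv_mult absv_power power_divide field_simps)
    then show "\<exists>B. \<forall>k. absv (g k) * t powi k \<le> B" by blast
  qed
  have F: "coef F = laurent i f" "F \<in> analytic_level i"
    unfolding F_def using coef_Abs[OF lev_laurent nf] by auto
  have G: "coef G = laurent i g" "G \<in> analytic_level i"
    unfolding G_def using coef_Abs[OF lev_laurent ng] by auto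
  have shift: "of_int k / of_nat ?N - of_nat j / of_nat ?N = (of_int (k - int j) / of_nat ?N :: rat)" for k j
    by (simp add: diff_divide_distrib)
  have eqF: "F = apoly i R1 * dilate i Q F"
  proof -
    have "laurent i f = poly_series i R1 \<star> dilate_series i Q (laurent i f)"
    proof (rule lev_series_eqI[OF lev_laurent lev_mult[OF lev_poly_series lev_dilate_series]])
      fix k :: int
      have "(poly_series i R1 \<star> dilate_series i Q (laurent i f)) (of_int k / of_nat ?N) =
          (\<Sum>j\<le>D. coeff R1 j * (Q powi (k - int j) * f (k - int j)))"
        unfolding cauchy_prod_poly_series shift dilate_series_at laurent_at R1(3) ..
      also have "\<dots> = f k"
      proof (cases "0 \<le> k")
        case True
        then obtain n where n: "k = int n" using nonneg_int_cases by blast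
        have "(\<Sum>j\<le>D. coeff R1 j * (Q powi (k - int j) * f (k - int j))) =
            (\<Sum>j\<le>n. coeff R1 j * Q ^ (n - j) * a (n - j))"
        proof (rule sum.mono_neutral_cong)
          fix j assume "j \<in> {..n} - {..D}"
          then show "coeff R1 j * Q ^ (n - j) * a (n - j) = 0" using R1(3) by (simp add: coeff_eq_0)
        next
          fix j assume "j \<in> {..D} \<inter> {..n}"
          then have "k - int j = int (n - j)" using n by auto
          then show "coeff R1 j * (Q powi (k - int j) * f (k - int j)) = coeff R1 j * Q ^ (n - j) * a (n - j)"
            by (simp add: f_def mult.assoc)
        qed (auto simp: f_def n)
        also have "\<dots> = a n" unfolding a_def by (rule q_product_eq[where c = "coeff R1", OF Q(2) R1(2), symmetric])
        finally show ?thesis by (simp add: f_def n)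
      next
        case False
        then show ?thesis by (simp add: f_def)
      qed
      finally show "laurent i f (of_int k / of_nat ?N) =
          (poly_series i R1 \<star> dilate_series i Q (laurent i f)) (of_int k / of_nat ?N)" by simp
    qed
    then have "coef F = coef (apoly i R1 * dilate i Q F)" by (simp add: F(1) coef_mult coef_dilate[OF Q0])
    then show ?thesis by (simp only: coef_inject)
  qed
  have eqG: "apoly i R * G = amono i (int D) 1 * dilate i Q G"
  proof -
    have "poly_series i R \<star> laurent i g = mono_series (of_int (int D) / of_nat ?N) 1 \<star> dilate_series i Q (laurent i g)"
    proof (rule lev_series_eqI)
      fix k :: int
      have l: "(poly_series i R \<star> laurent i g) (of_int k / of_nat ?N) = (\<Sum>j\<le>D. coeff R j * g (k - int j))"
        unfolding cauchy_prod_poly_series shift laurent_at D_def ..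
      have "(mono_series (of_int (int D) / of_nat ?N) 1 \<star> dilate_series i Q (laurent i g)) (of_int k / of_nat ?N) =
          dilate_series i Q (laurent i g) (of_int (k - int D) / of_nat ?N)"
        unfolding cauchy_prod_mono by (simp add: diff_divide_distrib)
      also have "\<dots> = Q powi (k - int D) * g (k - int D)" by (simp only: dilate_series_at laurent_at)
      finally have r: "(mono_series (of_int (int D) / of_nat ?N) 1 \<star> dilate_series i Q (laurent i g)) (of_int k / of_nat ?N) =
          Q powi (k - int D) * g (k - int D)" .
      have "(\<Sum>j\<le>D. coeff R j * g (k - int j)) = Q powi (k - int D) * g (k - int D)"
      proof (cases "k \<le> int D")
        case True
        then obtain n where n: "int D - k = int n" using nonneg_int_cases[of "int D - k"] by auto
        then have kD: "k - int D = - int n" by simp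
        have "(\<Sum>j\<le>D. coeff R j * g (k - int j)) = (\<Sum>l\<le>D. coeff S l * g (int l - int n))"
        proof (rule sum.reindex_bij_witness[of _ "\<lambda>l. D - l" "\<lambda>l. D - l"])
          fix j assume j: "j \<in> {..D}"
          then have kj: "k - int j = int (D - j) - int n" using n by auto
          have "coeff S (D - j) = coeff R j" using j by (simp add: S_def coeff_reflect_poly D_def)
          then show "coeff S (D - j) * g (int (D - j) - int n) = coeff R j * g (k - int j)"
            unfolding kj by simp
        qed auto
        also have "\<dots> = (\<Sum>l\<le>n. coeff S l * Q ^ (n - l) * b (n - l))"
        proof (rule sum.mono_neutral_cong)
          fix j assume "j \<in> {..n} - {..D}"
          then show "coeff S j * Q ^ (n - j) * b (n - j) = 0" using S(3) by (simp add: coeff_eq_0)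
        next
          fix j assume "j \<in> {..D} \<inter> {..n}"
          then have jn: "int j - int n = - int (n - j)" by auto
          show "coeff S j * g (int j - int n) = coeff S j * Q ^ (n - j) * b (n - j)"
            unfolding jn by (simp add: g_def mult.assoc del: of_nat_diff)
        qed (auto simp: g_def)
        also have "\<dots> = b n" unfolding b_def by (rule q_product_eq[where c = "coeff S", OF Q(2) S(2), symmetric])
        also have "\<dots> = Q powi (k - int D) * g (k - int D)"
          unfolding kD using Q0 by (simp add: g_def power_int_minus)
        finally show ?thesis .
      next
        case False
        then show ?thesis by (simp add: g_def)
      qed
      then show "(poly_series i R \<star> laurent i g) (of_int k / of_nat ?N) =
        (mono_series (of_int (int D) / of_nat ?N) 1 \<star> dilate_series i Q (laurent i g)) (of_int k / of_nat ?N)"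
        unfolding l r .
    qed (intro lev_mult lev_poly_series lev_laurent lev_dilate_series lev_mono of_int_div_in_exponents_level)+
    then have "coef (apoly i R * G) = coef (amono i (int D) 1 * dilate i Q G)"
      by (simp add: G(1) coef_mult coef_dilate[OF Q0])
    then show ?thesis by (simp only: coef_inject)
  qed
  have R_R1: "apoly i R = amono i 0 r0 * apoly i R1"
  proof -
    have "R = [:r0:] * R1" using r0 by (simp add: R1_def)
    then have "poly_series i R = const_series r0 \<star> poly_series i R1"
      by (metis poly_series_mult poly_series_const)
    then have "coef (apoly i R) = coef (amono i 0 r0 * apoly i R1)"
      by (simp add: coef_mult mono_series_0)
    then show ?thesis by (simp only: coef_inject)
  qed
  define \<theta> where "\<theta> = F * G"
  have F0: "coef F 0 = 1" using laurent_at[of i f 0] by (simp add: F f_def a_def)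
  have G0: "coef G 0 = 1" using laurent_at[of i g 0] by (simp add: G g_def b_def)
  have ne: "F \<noteq> 0" "G \<noteq> 0" using F0 G0 coef_eq_0_iff[of F] coef_eq_0_iff[of G] by (auto simp: fun_eq_iff)
  have lev\<theta>: "\<theta> \<in> analytic_level i" unfolding \<theta>_def by (rule analytic_level_mult[OF F(2) G(2)])
  have dF: "dilate i Q F \<in> analytic_level i" "dilate i Q G \<in> analytic_level i"
    by (simp_all add: dilate_level[OF Q0])
  have "amono i 0 r0 * \<theta> = dilate i Q F * (apoly i R * G)"
    unfolding \<theta>_def R_R1 by (subst eqF) (simp only: mult_ac)
  also have "\<dots> = amono i (int D) 1 * dilate i Q \<theta>"
    unfolding eqG \<theta>_def dilate_mult[OF Q0 F(2) G(2)] by (simp only: mult_ac)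
  finally have fe: "amono i 0 r0 * \<theta> = amono i (int D) 1 * dilate i Q \<theta>" .
  \<comment> \<open>Replacing Y by Y/Q in R(0) \<theta>(Y) = Y^D \<theta>(Q Y) gives the factor
    (Y/Q)^D / R(0).\<close>
  define c where "c = inverse r0 * inverse Q ^ D"
  have c0: "c \<noteq> 0" using r0 Q0 by (simp add: c_def)
  have iQ: "inverse Q \<noteq> 0" using Q0 by simp
  have "dilate i (inverse Q) (amono i 0 r0 * \<theta>) = amono i 0 r0 * dilate i (inverse Q) \<theta>"
    by (simp add: dilate_mult[OF iQ _ lev\<theta>] dilate_amono[OF iQ])
  moreover have "dilate i (inverse Q) (amono i (int D) 1 * dilate i Q \<theta>) = amono i (int D) (inverse Q ^ D) * \<theta>"
    by (simp add: dilate_mult[OF iQ _ dilate_level[OF Q0]] dilate_amono[OF iQ] dilate_dilate_inverse[OF Q0 lev\<theta>])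
  ultimately have "amono i 0 r0 * dilate i (inverse Q) \<theta> = amono i (int D) (inverse Q ^ D) * \<theta>" using fe by metis
  then have "amono i 0 (inverse r0) * (amono i 0 r0 * dilate i (inverse Q) \<theta>) =
      amono i 0 (inverse r0) * (amono i (int D) (inverse Q ^ D) * \<theta>)" by simp
  then have fe': "dilate i (inverse Q) \<theta> = amono i (int D) c * \<theta>"
    using r0 by (simp add: amono_mult amono_0_1 c_def flip: mult.assoc)
  have zo: "zero_order i \<beta> \<theta> = order \<beta> (ac_poly R)" if \<beta>: "absv Q < w \<beta>" "w \<beta> \<le> 1" for \<beta>
  proof -
    have \<beta>0: "\<beta> \<noteq> 0" using less_trans[OF Q(1) \<beta>(1)] unfolding w_pos .
    let ?t = "w \<beta> ^ ?N"
    have t: "w \<beta> > 0" "?t > 0" using \<beta>0 by auto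
    \<comment> \<open>The roots of \<open>R1\<close> are larger than |Q|, so its constant term
      dominates at radius |Q|. This controls F(Q Y) for |Y| \<le> 1.\<close>
    have R1small: "absv (coeff R1 j) * absv Q ^ j < 1" if "j > 0" for j
    proof -
      have rt: "absv Q < w x" if "poly (ac_poly R1) x = 0" for x
        using that roots[of x] r0 by (simp add: R1_def ac_poly_smult)
      obtain k where "\<And>s j. absv Q \<le> s \<Longrightarrow> s \<le> absv Q \<Longrightarrow> j \<noteq> k \<Longrightarrow> absv (coeff R1 j) * s ^ j < absv (coeff R1 k) * s ^ k" "k = 0"
        using no_root_dominant[OF Q(1) order_refl R1(1)] rt by metis
      then show ?thesis using that R1(2) by fastforce
    qed
    \<comment> \<open>The roots of \<open>S\<close> are the inverses of those of \<open>R\<close>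
      and have absolute value at least 1. The relevant radius |Q/\<beta>| is below 1, as the
      fundamental annulus is open at its inner end.\<close>
    have Ssmall: "absv (coeff S j) * s ^ j < 1" if "j > 0" "0 < s" "s < 1" for j s
    proof -
      have rt: "s < w x" if x: "poly (ac_poly S) x = 0" for x
      proof -
        have x0: "x \<noteq> 0" using x S(2) by (auto simp: poly_0_coeff_0)
        have "ac_poly S = reflect_poly (ac_poly R)"
          by (intro poly_eqI) (simp add: S_def coeff_reflect_poly)
        then have "poly (ac_poly R) (inverse x) = 0" using x x0 by (simp add: poly_reflect_poly_nz)
        then have "w (inverse x) \<le> 1" using roots by blast
        moreover have "w x * w (inverse x) = 1" using x0 by (simp flip: w_mult)
        ultimately have "1 \<le> w x" by (metis mult.right_neutral mult_left_mono w_ge_0)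
        then show ?thesis using \<open>s < 1\<close> by simp
      qed
      obtain k where "\<And>t j. s \<le> t \<Longrightarrow> t \<le> s \<Longrightarrow> j \<noteq> k \<Longrightarrow> absv (coeff S j) * t ^ j < absv (coeff S k) * t ^ k" "k = 0"
        using no_root_dominant[OF \<open>0 < s\<close> order_refl S(1)] rt by metis
      then show ?thesis using that S(2) by fastforce
    qed
    have "sole_term ?t (coef (dilate i Q F)) 0"
    proof (rule sole_term_0[OF t(1)])
      show "lev i (coef (dilate i Q F))" using dF by (simp add: lev_coef_iff)
      have at: "coef (dilate i Q F) (of_int k / of_nat ?N) = Q powi k * f k" for k
        by (simp only: coef_dilate[OF Q0] F(1) dilate_series_at laurent_at)
      have v0: "coef (dilate i Q F) 0 = 1" using at[of 0] by (simp add: f_def a_def)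
      show "coef (dilate i Q F) 0 \<noteq> 0" unfolding v0 by simp
      fix k :: int assume "k \<noteq> 0"
      show "absv (coef (dilate i Q F) (of_int k / of_nat ?N)) * w \<beta> powi k < absv (coef (dilate i Q F) 0)"
      proof (cases "0 \<le> k")
        case True
        then obtain n where n: "k = int n" using nonneg_int_cases by blast
        then have "n > 0" using \<open>k \<noteq> 0\<close> by simp
        have "absv (a n) * absv Q ^ n < 1" unfolding a_def
          by (rule q_product_small[OF Q(2,1) R1small \<open>n > 0\<close>])
        moreover have "absv (a n) * absv Q ^ n * w \<beta> ^ n \<le> absv (a n) * absv Q ^ n * 1"
          using \<beta> t Q by (intro mult_left_mono power_le_one) auto
        ultimately show ?thesis
          unfolding at v0 by (simp add: n f_def absv_mult absv_power mult_ac)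
      next
        case False
        then show ?thesis unfolding at v0 by (simp add: f_def)
      qed
    qed
    then obtain v where v: "unit_on ?t ?t i (coef (dilate i Q F)) v"
      using sole_term_unit[of i "coef (dilate i Q F)" ?t ?t 0] dF t by (auto simp: lev_coef_iff)
    have "sole_term ?t (coef G) 0"
    proof (rule sole_term_0[OF t(1)])
      show "lev i (coef G)" using G(2) by (simp add: lev_coef_iff)
      show "coef G 0 \<noteq> 0" unfolding G0 by simp
      fix k :: int assume "k \<noteq> 0"
      have at: "coef G (of_int k / of_nat ?N) = g k" by (simp add: G)
      show "absv (coef G (of_int k / of_nat ?N)) * w \<beta> powi k < absv (coef G 0)"
      proof (cases "k \<le> 0")
        case True
        then obtain n where n: "k = - int n" using nonpos_int_cases by blast
        then have "n > 0" using \<open>k \<noteq> 0\<close> by simp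
        have s: "0 < absv Q / w \<beta>" "absv Q / w \<beta> < 1" using \<beta> Q t by auto
        have "absv (b n) * (absv Q / w \<beta>) ^ n < 1" unfolding b_def
          by (rule q_product_small[OF Q(2) s(1) Ssmall[OF _ s] \<open>n > 0\<close>])
        then show ?thesis
          unfolding at G0 using t by (simp add: n g_def absv_mult absv_power power_int_minus power_divide field_simps)
      next
        case False
        then show ?thesis unfolding at G0 by (simp add: g_def)
      qed
    qed
    then obtain v' where v': "unit_on ?t ?t i (coef G) v'"
      using sole_term_unit[of i "coef G" ?t ?t 0] G(2) t by (auto simp: lev_coef_iff)
    \<comment> \<open>On the fundamental annulus \<theta> = R1(Y) F(Q Y) G(Y), and the last two
      factors are units by the estimates above.\<close>
    have "coef \<theta> = coef (apoly i R1 * (dilate i Q F * G))" unfolding \<theta>_def by (subst eqF) (simp only: mult.assoc)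
    also have "\<dots> = poly_series i R1 \<star> (coef (dilate i Q F) \<star> coef G)" by (simp add: coef_mult)
    finally have "weierstrass_at ?t i (coef \<theta>) R1"
      using weierstrass_atI[OF R1(1) unit_on_mult[OF v v' t(2) order_refl]] by simp
    then have "zero_order i \<beta> \<theta> = order \<beta> (ac_poly R1)" by (rule zero_order_eq[OF \<beta>0])
    also have "\<dots> = order \<beta> (ac_poly R)" using r0 by (simp add: R1_def ac_poly_smult order_smult)
    finally show ?thesis .
  qed
  show ?thesis
    by (rule that[of \<theta> c]) (use lev\<theta> ne c0 fe' zo in \<open>auto simp: \<theta>_def D_def\<close>)
qed

end

section \<open>Theta quotients with a prescribed divisor\<close>

text \<open>A zero of multiplicity n/N along the class of \<alpha> has to be realised by a
  polynomial in \<open>Y\<close>. In characteristic p the polynomial P(Y^N) is an N-th power, and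
  the n-th power of its root serves; in characteristic 0 the divisibility of \<open>n\<close> allows
  a power of P(Y^N).\<close>

lemma monic_root_of_power:
  fixes \<alpha> :: "'a::perfectoid_field alg_closure" and i n :: nat
  defines "N \<equiv> residue_char TYPE('a) ^ i"
  assumes "CHAR('a) = 0 \<Longrightarrow> N dvd n"
  shows "\<exists>S. lead_coeff S = 1 \<and> S ^ N = pcompose (min_poly \<alpha>) (monom 1 N) ^ n"
proof -
  let ?P = "pcompose (min_poly \<alpha>) (monom 1 N)"
  have N: "N > 0" by (simp add: N_def)
  have lc: "lead_coeff ?P = 1"
    using lead_coeff_comp[of "monom 1 N :: 'a poly" "min_poly \<alpha>"] N by (simp add: degree_monom_eq)
  show ?thesis
  proof (cases "CHAR('a) = 0")
    case True
    then obtain m where "n = N * m" using assms(2) by (auto elim!: dvdE)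
    then have "(?P ^ m) ^ N = ?P ^ n" by (simp add: mult.commute flip: power_mult)
    moreover have "lead_coeff (?P ^ m) = 1" by (simp only: lead_coeff_power lc power_one)
    ultimately show ?thesis by blast
  next
    case False
    obtain R where R: "?P = R ^ N" using pcompose_frobenius[OF False] unfolding N_def by blast
    define c where "c = lead_coeff R"
    have cN: "c ^ N = 1" using lc unfolding R by (simp only: lead_coeff_power c_def)
    have "c \<noteq> 0" using cN N by (auto simp: power_0_left)
    define S where "S = smult (inverse c) R"
    have "S ^ N = ?P" unfolding S_def R smult_power by (simp add: power_inverse cN)
    then have "(S ^ n) ^ N = ?P ^ n" by (metis power_mult mult.commute)
    moreover have "lead_coeff S = 1" using \<open>c \<noteq> 0\<close> by (simp add: S_def c_def)
    then have "lead_coeff (S ^ n) = 1" by (simp only: lead_coeff_power power_one)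
    ultimately show ?thesis by blast
  qed
qed

locale tate_divisor = abs_extension w
  for w :: "'a::perfectoid_field alg_closure \<Rightarrow> real" +
  fixes q Q :: 'a and i :: nat and d :: "'a alg_closure \<Rightarrow> rat" and N :: nat
  assumes N_def: "N = residue_char TYPE('a) ^ i"
    and q: "0 < absv q" "absv q < 1" and Qq: "Q ^ N = q"
    and div: "divisor w d" and per: "periodic_divisor q d"
    and level: "\<And>\<alpha>. \<alpha> \<noteq> 0 \<Longrightarrow> d \<alpha> \<in> exponents_level (residue_char TYPE('a)) i"
    and integral: "CHAR('a) = 0 \<Longrightarrow> \<alpha> \<noteq> 0 \<Longrightarrow> d \<alpha> \<in> \<int>"
begin

lemma N_pos [simp]: "N > 0"
  by (simp add: N_def)

lemma N_nonzero [simp]: "N \<noteq> 0"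
  using N_pos by simp

lemma Q_nonzero [simp]: "Q \<noteq> 0"
  using q Qq by (auto simp: power_0_left)

lemma absv_Q: "0 < absv Q" "absv Q < 1"
proof -
  show "0 < absv Q" by simp
  show "absv Q < 1"
  proof (rule ccontr)
    assume "\<not> ?thesis"
    then have "1 \<le> absv Q ^ N" by (intro one_le_power) simp
    then show False using q Qq by (simp flip: absv_power)
  qed
qed

text \<open>Fundamental annuli correspond: that of \<open>q\<close> in the X-plane is the image of
  that of \<open>Q\<close> in the \<open>Y\<close>-plane.\<close>

lemma annulus_power_iff: "absv q < w (\<beta> ^ N) \<and> w (\<beta> ^ N) \<le> 1 \<longleftrightarrow> absv Q < w \<beta> \<and> w \<beta> \<le> 1"
proof -
  have "w (\<beta> ^ N) \<le> absv q \<longleftrightarrow> w \<beta> \<le> absv Q"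
    using power_mono_iff[of "w \<beta>" "absv Q" N] by (simp add: w_power absv_power flip: Qq)
  moreover have "w (\<beta> ^ N) \<le> 1 \<longleftrightarrow> w \<beta> \<le> 1"
    using power_mono_iff[of "w \<beta>" 1 N] by (simp add: w_power)
  ultimately show ?thesis by (simp add: not_le[symmetric])
qed

definition dmult :: "'a alg_closure \<Rightarrow> int" where
  "dmult \<alpha> = \<lfloor>d \<alpha> * of_nat N\<rfloor>"

lemma dmult: "\<alpha> \<noteq> 0 \<Longrightarrow> d \<alpha> = of_int (dmult \<alpha>) / of_nat N"
proof -
  assume "\<alpha> \<noteq> 0"
  then obtain k where k: "d \<alpha> = of_int k / of_nat N"
    using level[of \<alpha>] unfolding exponents_level_def N_def by auto
  then have "d \<alpha> * of_nat N = of_int k" by simp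
  then show ?thesis using k by (simp add: dmult_def)
qed

lemma dmult_dvd: "CHAR('a) = 0 \<Longrightarrow> \<alpha> \<noteq> 0 \<Longrightarrow> N dvd nat \<bar>dmult \<alpha>\<bar>"
proof -
  assume "CHAR('a) = 0" "\<alpha> \<noteq> 0"
  then obtain z where "d \<alpha> = of_int z" using integral Ints_cases by metis
  then have "dmult \<alpha> = z * int N" unfolding dmult_def by (metis floor_of_int of_int_mult of_int_of_nat_eq)
  then show ?thesis by (simp add: abs_mult nat_mult_distrib)
qed

definition supp_classes :: "'a alg_closure set set" where
  "supp_classes = conj_class ` {\<alpha>. absv q < w \<alpha> \<and> w \<alpha> \<le> 1 \<and> d \<alpha> \<noteq> 0}"

text \<open>The same choice of a representative as in \<open>divisor_degree\<close>, so that the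
  sums can be compared term by term.\<close>

definition rep :: "'a alg_closure set \<Rightarrow> 'a alg_closure" where
  "rep C = (SOME \<alpha>. \<alpha> \<in> C)"

lemma finite_supp_classes: "finite supp_classes"
proof -
  have "finite {\<alpha>. absv q \<le> w \<alpha> \<and> w \<alpha> \<le> 1 \<and> d \<alpha> \<noteq> 0}"
    using div q(1) unfolding divisor_def by blast
  then have "finite {\<alpha>. absv q < w \<alpha> \<and> w \<alpha> \<le> 1 \<and> d \<alpha> \<noteq> 0}"
    by (rule rev_finite_subset) auto
  then show ?thesis unfolding supp_classes_def by (rule finite_imageI)
qed

lemma d_conj: "\<alpha> \<noteq> 0 \<Longrightarrow> \<beta> \<in> conj_class \<alpha> \<Longrightarrow> d \<beta> = d \<alpha>"
  using div unfolding divisor_def by blast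

lemma dmult_conj: "\<alpha> \<noteq> 0 \<Longrightarrow> \<beta> \<in> conj_class \<alpha> \<Longrightarrow> dmult \<beta> = dmult \<alpha>"
  unfolding dmult_def using d_conj[of \<alpha> \<beta>] by simp

lemma w_gt_q_nonzero: "absv q < w \<alpha> \<Longrightarrow> \<alpha> \<noteq> 0"
  using less_trans[OF q(1), of "w \<alpha>"] w_pos[of \<alpha>] by blast

lemma rep:
  assumes "C \<in> supp_classes"
  shows "conj_class (rep C) = C" "rep C \<noteq> 0" "absv q < w (rep C)" "w (rep C) \<le> 1" "d (rep C) \<noteq> 0"
proof -
  obtain \<alpha> where \<alpha>: "C = conj_class \<alpha>" "absv q < w \<alpha>" "w \<alpha> \<le> 1" "d \<alpha> \<noteq> 0"
    using assms unfolding supp_classes_def by auto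
  have r: "rep C \<in> conj_class \<alpha>" unfolding rep_def \<alpha>(1) by (rule someI[of _ \<alpha>]) simp
  have \<alpha>0: "\<alpha> \<noteq> 0" using \<alpha>(2) by (rule w_gt_q_nonzero)
  show "conj_class (rep C) = C" using conj_class_eq[OF r] \<alpha>(1) by simp
  show "rep C \<noteq> 0" by (rule conj_class_nonzero[OF r \<alpha>0])
  show "absv q < w (rep C)" "w (rep C) \<le> 1" using \<alpha> w_conj[OF r] by auto
  show "d (rep C) \<noteq> 0" using \<alpha>(4) d_conj[OF \<alpha>0 r] by simp
qed

text \<open>Formally P(X)^|d|, made a polynomial in \<open>Y\<close>: with |d| = n/N this is an N-th
  root of P(Y^N)^n.\<close>

definition class_poly :: "'a alg_closure set \<Rightarrow> 'a poly" where
  "class_poly C = (SOME S. lead_coeff S = 1 \<and>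
     S ^ N = pcompose (min_poly (rep C)) (monom 1 N) ^ nat \<bar>dmult (rep C)\<bar>)"

lemma class_poly:
  assumes "C \<in> supp_classes"
  shows "lead_coeff (class_poly C) = 1"
    "class_poly C ^ N = pcompose (min_poly (rep C)) (monom 1 N) ^ nat \<bar>dmult (rep C)\<bar>"
proof -
  have "\<exists>S. lead_coeff S = 1 \<and> S ^ N = pcompose (min_poly (rep C)) (monom 1 N) ^ nat \<bar>dmult (rep C)\<bar>"
    using monic_root_of_power[where i = i and \<alpha> = "rep C"] dmult_dvd rep(2)[OF assms]
    unfolding N_def by blast
  from someI_ex[OF this] show "lead_coeff (class_poly C) = 1"
    "class_poly C ^ N = pcompose (min_poly (rep C)) (monom 1 N) ^ nat \<bar>dmult (rep C)\<bar>"
    unfolding class_poly_def by auto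
qed

lemma class_poly_nonzero: "C \<in> supp_classes \<Longrightarrow> class_poly C \<noteq> 0"
  using class_poly(1) by fastforce

lemma degree_class_poly:
  assumes "C \<in> supp_classes"
  shows "degree (class_poly C) = nat \<bar>dmult (rep C)\<bar> * degree (min_poly (rep C))"
proof -
  have "degree (class_poly C ^ N) = N * degree (class_poly C)"
    by (rule degree_power_eq[OF class_poly_nonzero[OF assms]])
  moreover have "degree (pcompose (min_poly (rep C)) (monom 1 N) ^ nat \<bar>dmult (rep C)\<bar>) =
      nat \<bar>dmult (rep C)\<bar> * (degree (min_poly (rep C)) * N)"
    by (subst degree_power_eq) (simp_all add: pcompose_power_nonzero degree_pcompose degree_monom_eq)
  ultimately have "N * degree (class_poly C) = N * (nat \<bar>dmult (rep C)\<bar> * degree (min_poly (rep C)))"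
    using class_poly(2)[OF assms] by (simp add: mult_ac)
  then show ?thesis by simp
qed

lemma order_class_poly:
  assumes "C \<in> supp_classes"
  shows "int N * int (order \<beta> (ac_poly (class_poly C))) =
    (if \<beta> ^ N \<in> C then int (insep_degree TYPE('a) i) * \<bar>dmult (rep C)\<bar> else 0)"
proof -
  have P0: "pcompose (min_poly (rep C)) (monom 1 N) \<noteq> 0" by (simp add: pcompose_power_nonzero)
  have "N * order \<beta> (ac_poly (class_poly C)) = order \<beta> (ac_poly (class_poly C ^ N))"
    using class_poly_nonzero[OF assms] by (simp add: ac_poly_power order_power)
  also have "\<dots> = nat \<bar>dmult (rep C)\<bar> * order \<beta> (ac_poly (pcompose (min_poly (rep C)) (monom 1 N)))"
    unfolding class_poly(2)[OF assms] using P0 by (simp add: ac_poly_power order_power)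
  also have "order \<beta> (ac_poly (pcompose (min_poly (rep C)) (monom 1 N))) =
      (if \<beta> ^ N \<in> C then insep_degree TYPE('a) i else 0)"
    using order_min_poly_power[OF rep(2)[OF assms], of \<beta> i] rep(1)[OF assms] by (simp add: N_def)
  finally have "int (N * order \<beta> (ac_poly (class_poly C))) =
      int (nat \<bar>dmult (rep C)\<bar> * (if \<beta> ^ N \<in> C then insep_degree TYPE('a) i else 0))" by (rule arg_cong)
  then show ?thesis by (cases "\<beta> ^ N \<in> C") (simp_all add: mult.commute)
qed

text \<open>Its roots become the zeros of \<theta>. As \<theta> is the denominator in
  \<theta>'/\<theta>, they are the poles that the divisor permits.\<close>

definition zeros_poly :: "'a poly" where
  "zeros_poly = (\<Prod>C\<in>{C\<in>supp_classes. dmult (rep C) > 0}. class_poly C)"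

definition pole_poly :: "'a poly" where
  "pole_poly = (\<Prod>C\<in>{C\<in>supp_classes. dmult (rep C) < 0}. class_poly C)"

lemma dmult_rep_nonzero: "C \<in> supp_classes \<Longrightarrow> dmult (rep C) \<noteq> 0"
  using rep(2,5)[of C] dmult[of "rep C"] by auto

lemma sum_supp_classes_split:
  fixes f :: "'a alg_closure set \<Rightarrow> int"
  shows "(\<Sum>C\<in>supp_classes. f C) = (\<Sum>C\<in>{C\<in>supp_classes. dmult (rep C) > 0}. f C) + (\<Sum>C\<in>{C\<in>supp_classes. dmult (rep C) < 0}. f C)"
proof -
  have "supp_classes = {C\<in>supp_classes. dmult (rep C) > 0} \<union> {C\<in>supp_classes. dmult (rep C) < 0}"
    using dmult_rep_nonzero by (auto simp: linorder_neq_iff)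
  moreover have "(\<Sum>C\<in>{C\<in>supp_classes. dmult (rep C) > 0} \<union> {C\<in>supp_classes. dmult (rep C) < 0}. f C) =
      (\<Sum>C\<in>{C\<in>supp_classes. dmult (rep C) > 0}. f C) + (\<Sum>C\<in>{C\<in>supp_classes. dmult (rep C) < 0}. f C)"
    using finite_supp_classes by (intro sum.union_disjoint) auto
  ultimately show ?thesis by simp
qed

lemma degree_zeros_poles:
  "int (degree zeros_poly) - int (degree pole_poly) = (\<Sum>C\<in>supp_classes. dmult (rep C) * int (degree (min_poly (rep C))))"
proof -
  have deg: "int (degree (prod class_poly A)) = (\<Sum>C\<in>A. \<bar>dmult (rep C)\<bar> * int (degree (min_poly (rep C))))"
    if "A \<subseteq> supp_classes" for A
  proof -
    have "degree (prod class_poly A) = (\<Sum>C\<in>A. degree (class_poly C))"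
      using that class_poly_nonzero by (intro degree_prod_eq_sum_degree) auto
    also have "int \<dots> = (\<Sum>C\<in>A. \<bar>dmult (rep C)\<bar> * int (degree (min_poly (rep C))))"
      using that degree_class_poly by (simp add: subset_eq)
    finally show ?thesis .
  qed
  have "int (degree zeros_poly) = (\<Sum>C\<in>{C\<in>supp_classes. dmult (rep C) > 0}. dmult (rep C) * int (degree (min_poly (rep C))))"
    unfolding zeros_poly_def by (subst deg) (auto intro: sum.cong)
  moreover have "- int (degree pole_poly) = (\<Sum>C\<in>{C\<in>supp_classes. dmult (rep C) < 0}. dmult (rep C) * int (degree (min_poly (rep C))))"
    unfolding pole_poly_def by (subst deg) (auto simp flip: sum_negf intro: sum.cong)
  ultimately show ?thesis by (simp add: sum_supp_classes_split)
qed

lemma divisor_degree_eq: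
  "divisor_degree w q d * of_nat N = of_int (int (degree zeros_poly) - int (degree pole_poly))"
proof -
  have "divisor_degree w q d = (\<Sum>C\<in>supp_classes. of_nat (degree (min_poly (rep C))) * d (rep C))"
    by (simp add: divisor_degree_def supp_classes_def rep_def Let_def ext_degree_eq)
  also have "\<dots> = (\<Sum>C\<in>supp_classes. of_int (dmult (rep C) * int (degree (min_poly (rep C)))) / of_nat N)"
    by (rule sum.cong) (simp_all add: dmult[OF rep(2)])
  also have "\<dots> = of_int (\<Sum>C\<in>supp_classes. dmult (rep C) * int (degree (min_poly (rep C)))) / of_nat N"
    by (simp add: sum_divide_distrib)
  finally show ?thesis unfolding degree_zeros_poles by simp
qed

lemma lead_coeff_zeros_poles: "lead_coeff zeros_poly = 1" "lead_coeff pole_poly = 1"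
proof -
  have "lead_coeff (prod class_poly A) = 1" if "A \<subseteq> supp_classes" for A
    using that class_poly(1) by (simp add: lead_coeff_prod subset_eq)
  then show "lead_coeff zeros_poly = 1" "lead_coeff pole_poly = 1"
    unfolding zeros_poly_def pole_poly_def by auto
qed

lemma order_prod_class_poly:
  assumes "A \<subseteq> supp_classes"
  shows "int N * int (order \<beta> (ac_poly (prod class_poly A))) =
    (\<Sum>C\<in>A. if \<beta> ^ N \<in> C then int (insep_degree TYPE('a) i) * \<bar>dmult (rep C)\<bar> else 0)"
proof -
  have "order \<beta> (ac_poly (prod class_poly A)) = (\<Sum>C\<in>A. order \<beta> (ac_poly (class_poly C)))"
    unfolding ac_poly_prod using assms class_poly_nonzero by (intro order_prod) auto
  then have "int N * int (order \<beta> (ac_poly (prod class_poly A))) =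
      (\<Sum>C\<in>A. int N * int (order \<beta> (ac_poly (class_poly C))))"
    by (simp add: sum_distrib_left)
  also have "\<dots> = (\<Sum>C\<in>A. if \<beta> ^ N \<in> C then int (insep_degree TYPE('a) i) * \<bar>dmult (rep C)\<bar> else 0)"
    using assms by (intro sum.cong refl order_class_poly) auto
  finally show ?thesis .
qed

lemma roots_prod_class_poly:
  assumes A: "A \<subseteq> supp_classes" and x: "poly (ac_poly (prod class_poly A)) x = 0"
  shows "absv Q < w x \<and> w x \<le> 1"
proof -
  have fA: "finite A" using A finite_supp_classes finite_subset by blast
  then obtain C where C: "C \<in> A" "poly (ac_poly (class_poly C)) x = 0"
    using x by (auto simp: ac_poly_prod poly_prod)
  then have cl: "C \<in> supp_classes" using A by blast
  have "order x (ac_poly (class_poly C)) \<noteq> 0"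
    using C(2) class_poly_nonzero[OF cl] by (simp add: order_root)
  then have "x ^ N \<in> C" using order_class_poly[OF cl, of x] by (auto split: if_splits)
  then have "w (x ^ N) = w (rep C)" using rep(1)[OF cl] w_conj by metis
  then show ?thesis using rep(3,4)[OF cl] annulus_power_iff[of x] by simp
qed

lemma order_zeros_poles:
  assumes "absv Q < w \<beta>" "w \<beta> \<le> 1"
  shows "int N * (int (order \<beta> (ac_poly zeros_poly)) - int (order \<beta> (ac_poly pole_poly))) =
    int (insep_degree TYPE('a) i) * dmult (\<beta> ^ N)"
proof -
  let ?e = "int (insep_degree TYPE('a) i)"
  have in_ann: "absv q < w (\<beta> ^ N)" "w (\<beta> ^ N) \<le> 1" using annulus_power_iff assms by blast+
  have b0: "\<beta> ^ N \<noteq> 0" using in_ann(1) by (rule w_gt_q_nonzero)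
  have "int N * int (order \<beta> (ac_poly zeros_poly)) =
      (\<Sum>C\<in>{C\<in>supp_classes. dmult (rep C) > 0}. if \<beta> ^ N \<in> C then ?e * dmult (rep C) else 0)"
    unfolding zeros_poly_def by (subst order_prod_class_poly) (auto intro: sum.cong)
  moreover have "- (int N * int (order \<beta> (ac_poly pole_poly))) =
      (\<Sum>C\<in>{C\<in>supp_classes. dmult (rep C) < 0}. if \<beta> ^ N \<in> C then ?e * dmult (rep C) else 0)"
    unfolding pole_poly_def by (subst order_prod_class_poly) (auto simp flip: sum_negf intro!: sum.cong)
  ultimately have "int N * (int (order \<beta> (ac_poly zeros_poly)) - int (order \<beta> (ac_poly pole_poly))) =
      (\<Sum>C\<in>supp_classes. if \<beta> ^ N \<in> C then ?e * dmult (rep C) else 0)"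
    unfolding sum_supp_classes_split by (simp add: right_diff_distrib)
  \<comment> \<open>Classes are disjoint, so at most the class of \<beta>^N contributes, and
    \<open>dmult\<close> is constant on it.\<close>
  also have "\<dots> = (\<Sum>C\<in>supp_classes. if conj_class (\<beta> ^ N) = C then ?e * dmult (\<beta> ^ N) else 0)"
  proof (rule sum.cong[OF refl])
    fix C assume C: "C \<in> supp_classes"
    have "\<beta> ^ N \<in> C \<longleftrightarrow> conj_class (\<beta> ^ N) = C"
      using rep(1)[OF C] conj_class_eq conj_class_self by metis
    moreover have "dmult (rep C) = dmult (\<beta> ^ N)" if "\<beta> ^ N \<in> C"
      using dmult_conj[OF rep(2)[OF C], of "\<beta> ^ N"] that rep(1)[OF C] by simp
    ultimately show "(if \<beta> ^ N \<in> C then ?e * dmult (rep C) else 0) =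
        (if conj_class (\<beta> ^ N) = C then ?e * dmult (\<beta> ^ N) else 0)" by auto
  qed
  also have "\<dots> = (if conj_class (\<beta> ^ N) \<in> supp_classes then ?e * dmult (\<beta> ^ N) else 0)"
    using finite_supp_classes by (simp add: sum.delta)
  also have "\<dots> = ?e * dmult (\<beta> ^ N)"
  proof (cases "d (\<beta> ^ N) = 0")
    case True
    then show ?thesis by (simp add: dmult_def)
  next
    case False
    then have "conj_class (\<beta> ^ N) \<in> supp_classes" unfolding supp_classes_def using in_ann by blast
    then show ?thesis by simp
  qed
  finally show ?thesis .
qed

section \<open>Periodicity and reduction to the fundamental annulus\<close>

lemma zero_order_periodic:
  assumes \<theta>: "\<theta> \<in> analytic_level i" "\<theta> \<noteq> 0" and c: "c \<noteq> 0"
    and fe: "dilate i (inverse Q) \<theta> = amono i k c * \<theta>" and \<beta>: "\<beta> \<noteq> 0"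
  shows "zero_order i (to_ac Q * \<beta>) \<theta> = zero_order i \<beta> \<theta>"
proof -
  have iQ: "inverse Q \<noteq> 0" by simp
  let ?\<gamma> = "to_ac Q * \<beta>"
  have \<gamma>: "?\<gamma> \<noteq> 0" using \<beta> by simp
  have "zero_order i ?\<gamma> (amono i k c) + zero_order i ?\<gamma> (amono i (- k) (inverse c)) = zero_order i ?\<gamma> (amono i 0 1)"
    using zero_order_mult[OF \<gamma> amono_level amono_level amono_nonzero amono_nonzero, of c "inverse c" i k "- k"] c
    by (simp add: amono_mult)
  \<comment> \<open>The order of 1 is twice itself and hence 0. The orders of a monomial and its
    inverse are natural numbers adding up to it, so a monomial has no zeros.\<close>
  moreover have "zero_order i ?\<gamma> (amono i 0 1) + zero_order i ?\<gamma> (amono i 0 1) = zero_order i ?\<gamma> (amono i 0 1)"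
    using zero_order_mult[OF \<gamma> amono_level amono_level amono_nonzero amono_nonzero, of 1 1 i 0 0]
    by (simp add: amono_mult)
  ultimately have "zero_order i ?\<gamma> (amono i k c) = 0" by simp
  then have "zero_order i ?\<gamma> (dilate i (inverse Q) \<theta>) = zero_order i ?\<gamma> \<theta>"
    unfolding fe using zero_order_mult[OF \<gamma> amono_level \<theta>(1) amono_nonzero[OF c] \<theta>(2)] by simp
  moreover have "to_ac (inverse Q) * ?\<gamma> = \<beta>" by simp
  ultimately show ?thesis using zero_order_dilate[OF iQ \<theta> \<gamma>] by metis
qed

lemma fundamental_annulus:
  assumes "\<beta> \<noteq> 0"
  obtains m :: int where "absv Q < w (to_ac Q powi m * \<beta>)" "w (to_ac Q powi m * \<beta>) \<le> 1"
proof -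
  \<comment> \<open>The logarithm of |\<beta>| to the base |Q|. Removing its integer part leaves an
    exponent in [0, 1), that is, an absolute value in (|Q|, 1].\<close>
  define y where "y = ln (w \<beta>) / ln (absv Q)"
  have lnQ: "ln (absv Q) < 0" using absv_Q by simp
  have wb: "w \<beta> > 0" using assms by simp
  have "w (to_ac Q powi (- \<lfloor>y\<rfloor>) * \<beta>) = exp (of_int (- \<lfloor>y\<rfloor>) * ln (absv Q)) * exp (ln (w \<beta>))"
    using absv_Q wb powr_real_of_int'[of "absv Q" "- \<lfloor>y\<rfloor>"] by (simp add: w_mult w_power_int powr_def)
  also have "\<dots> = exp ((y - of_int \<lfloor>y\<rfloor>) * ln (absv Q))"
    using lnQ by (simp add: y_def left_diff_distrib flip: exp_add)
  finally have eq: "w (to_ac Q powi (- \<lfloor>y\<rfloor>) * \<beta>) = exp ((y - of_int \<lfloor>y\<rfloor>) * ln (absv Q))" .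
  have fr: "0 \<le> y - of_int \<lfloor>y\<rfloor>" "y - of_int \<lfloor>y\<rfloor> < 1" by linarith+
  have "(y - of_int \<lfloor>y\<rfloor>) * ln (absv Q) \<le> 0" using fr lnQ by (simp add: mult_nonneg_nonpos)
  moreover have "1 * ln (absv Q) < (y - of_int \<lfloor>y\<rfloor>) * ln (absv Q)"
    using fr lnQ by (intro mult_strict_right_mono_neg) auto
  then have "ln (absv Q) < (y - of_int \<lfloor>y\<rfloor>) * ln (absv Q)" by simp
  then have "exp (ln (absv Q)) < exp ((y - of_int \<lfloor>y\<rfloor>) * ln (absv Q))" by (simp only: exp_less_cancel_iff)
  then have "absv Q < exp ((y - of_int \<lfloor>y\<rfloor>) * ln (absv Q))" unfolding exp_ln[OF absv_Q(1)] .
  ultimately show ?thesis using that[of "- \<lfloor>y\<rfloor>"] unfolding eq by simp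
qed

lemma periodic_powi:
  assumes step: "\<And>\<beta>. \<beta> \<noteq> 0 \<Longrightarrow> F (to_ac Q * \<beta>) = F \<beta>" and "\<beta> \<noteq> 0"
  shows "F (to_ac Q powi m * \<beta>) = F \<beta>"
proof -
  have pos: "F (to_ac Q ^ n * \<beta>) = F \<beta>" if "\<beta> \<noteq> 0" for n \<beta>
    using that
  proof (induction n)
    case (Suc n)
    then show ?case using step[of "to_ac Q ^ n * \<beta>"] by (simp add: mult.assoc)
  qed simp
  show ?thesis
  proof (cases "0 \<le> m")
    case True
    then show ?thesis using pos[OF assms(2), of "nat m"] by (simp add: power_int_def)
  next
    case False
    let ?\<gamma> = "to_ac Q powi m * \<beta>"
    have "?\<gamma> \<noteq> 0" using assms(2) by simp
    then have "F (to_ac Q ^ nat (- m) * ?\<gamma>) = F ?\<gamma>" by (rule pos)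
    moreover have "to_ac Q ^ nat (- m) * ?\<gamma> = \<beta>"
      using False by (simp add: power_int_def power_inverse field_simps)
    ultimately show ?thesis by simp
  qed
qed

lemma dmult_periodic: "\<beta> \<noteq> 0 \<Longrightarrow> dmult ((to_ac Q * \<beta>) ^ N) = dmult (\<beta> ^ N)"
proof -
  assume "\<beta> \<noteq> 0"
  have "(to_ac Q * \<beta>) ^ N = to_ac q * \<beta> ^ N" by (simp add: power_mult_distrib flip: Qq)
  then show ?thesis using per \<open>\<beta> \<noteq> 0\<close> unfolding dmult_def periodic_divisor_def by simp
qed

text \<open>The theta functions have known orders only on the fundamental annulus. Both sides of the
  last equation are invariant under \<beta> -> Q \<beta>, which brings every nonzero \<beta> there.
  The factors \<open>N\<close> and \<open>insep_degree\<close> keep the equation in the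
  integers.\<close>

lemma theta_quotient_exists:
  obtains \<theta> \<theta>' c c' where
    "\<theta> \<in> analytic_level i" "\<theta> \<noteq> 0" "c \<noteq> 0" "dilate i (inverse Q) \<theta> = amono i (int (degree zeros_poly)) c * \<theta>"
    "\<theta>' \<in> analytic_level i" "\<theta>' \<noteq> 0" "c' \<noteq> 0" "dilate i (inverse Q) \<theta>' = amono i (int (degree pole_poly)) c' * \<theta>'"
    "\<And>\<beta>. \<beta> \<noteq> 0 \<Longrightarrow> int N * (int (zero_order i \<beta> \<theta>) - int (zero_order i \<beta> \<theta>')) =
       int (insep_degree TYPE('a) i) * dmult (\<beta> ^ N)"
proof -
  obtain \<theta> c where \<theta>: "\<theta> \<in> analytic_level i" "\<theta> \<noteq> 0" "c \<noteq> 0"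
    "dilate i (inverse Q) \<theta> = amono i (int (degree zeros_poly)) c * \<theta>"
    "\<And>\<beta>. absv Q < w \<beta> \<Longrightarrow> w \<beta> \<le> 1 \<Longrightarrow> zero_order i \<beta> \<theta> = order \<beta> (ac_poly zeros_poly)"
  proof (rule theta_exists[OF absv_Q lead_coeff_zeros_poles(1)])
    show "absv Q < w x \<and> w x \<le> 1" if "poly (ac_poly zeros_poly) x = 0" for x
      using roots_prod_class_poly[of "{C\<in>supp_classes. dmult (rep C) > 0}" x] that unfolding zeros_poly_def by auto
  qed blast
  obtain \<theta>' c' where \<theta>': "\<theta>' \<in> analytic_level i" "\<theta>' \<noteq> 0" "c' \<noteq> 0"
    "dilate i (inverse Q) \<theta>' = amono i (int (degree pole_poly)) c' * \<theta>'"
    "\<And>\<beta>. absv Q < w \<beta> \<Longrightarrow> w \<beta> \<le> 1 \<Longrightarrow> zero_order i \<beta> \<theta>' = order \<beta> (ac_poly pole_poly)"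
  proof (rule theta_exists[OF absv_Q lead_coeff_zeros_poles(2)])
    show "absv Q < w x \<and> w x \<le> 1" if "poly (ac_poly pole_poly) x = 0" for x
      using roots_prod_class_poly[of "{C\<in>supp_classes. dmult (rep C) < 0}" x] that unfolding pole_poly_def by auto
  qed blast
  have "int N * (int (zero_order i \<beta> \<theta>) - int (zero_order i \<beta> \<theta>')) =
       int (insep_degree TYPE('a) i) * dmult (\<beta> ^ N)" if \<beta>: "\<beta> \<noteq> 0" for \<beta>
  proof -
    define F where "F = (\<lambda>\<beta>. int N * (int (zero_order i \<beta> \<theta>) - int (zero_order i \<beta> \<theta>')) -
       int (insep_degree TYPE('a) i) * dmult (\<beta> ^ N))"
    have step: "F (to_ac Q * \<beta>) = F \<beta>" if "\<beta> \<noteq> 0" for \<beta>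
      unfolding F_def zero_order_periodic[OF \<theta>(1-4) that] zero_order_periodic[OF \<theta>'(1-4) that]
        dmult_periodic[OF that] ..
    obtain m :: int where m: "absv Q < w (to_ac Q powi m * \<beta>)" "w (to_ac Q powi m * \<beta>) \<le> 1"
      using fundamental_annulus[OF \<beta>] by blast
    have "F \<beta> = F (to_ac Q powi m * \<beta>)" using periodic_powi[of F, OF step \<beta>] by simp
    also have "\<dots> = 0" unfolding F_def \<theta>(5)[OF m] \<theta>'(5)[OF m] order_zeros_poles[OF m] by simp
    finally show ?thesis by (simp add: F_def)
  qed
  with \<theta>(1-4) \<theta>'(1-4) show ?thesis by (rule that)
qed

end

section \<open>The space of theta functions of given type\<close>

text \<open>Completing the square. It makes the quadratic exponents of theta coefficients beat every
  geometric growth.\<close>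

lemma quadratic_bound: "b > 0 \<Longrightarrow> x * c - b * x\<^sup>2 \<le> c\<^sup>2 / (4 * b)" for b c x :: real
proof -
  assume b: "b > 0"
  have "0 \<le> (2 * b * x - c)\<^sup>2" by simp
  then have "(x * c - b * x\<^sup>2) * (4 * b) \<le> c\<^sup>2" by (simp add: power2_eq_square algebra_simps)
  then show ?thesis using b by (simp add: pos_le_divide_eq)
qed

lemma powi_eq_exp: "x > 0 \<Longrightarrow> x powi k = exp (of_int k * ln x)" for x :: real
  using powr_real_of_int'[of x k] by (simp add: powr_def)

lemma coef_add: "coef (g + h) n = coef g n + coef h n"
  by (simp add: plus_analytic.rep_eq)

lemma coef_diff: "coef (g - h) n = coef g n - coef h n"
  by (simp add: minus_analytic.rep_eq)

lemma coef_const_mult: "coef (const a * g) n = a * coef g n"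
  by (simp add: times_analytic.rep_eq const.rep_eq cauchy_prod_const)

lemma coef_sum:
  fixes f :: "'b \<Rightarrow> 'a::perfectoid_field analytic"
  shows "coef (sum f A) n = (\<Sum>x\<in>A. coef (f x) n)"
proof -
  have 0: "coef (0 :: 'a analytic) n = 0" by (simp add: zero_analytic.rep_eq const_series_def)
  show ?thesis
    by (induction A rule: infinite_finite_induct) (simp_all add: coef_add 0)
qed

context tate_divisor
begin

definition ycoef :: "'a analytic \<Rightarrow> int \<Rightarrow> 'a" where
  "ycoef g k = coef g (of_int k / of_nat N)"

lemma ycoef_eq: "ycoef g k = coef g (of_int k / of_nat (residue_char TYPE('a) ^ i))"
  unfolding ycoef_def by (simp add: N_def)

lemma ycoef_eqI: "g \<in> analytic_level i \<Longrightarrow> h \<in> analytic_level i \<Longrightarrow> (\<And>k. ycoef g k = ycoef h k) \<Longrightarrow> g = h"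
  using lev_series_eqI[of i "coef g" "coef h"] by (simp add: ycoef_eq lev_coef_iff coef_inject)

definition theta_space :: "nat \<Rightarrow> 'a \<Rightarrow> 'a analytic set" where
  "theta_space n \<kappa> = {g \<in> analytic_level i. dilate i (inverse Q) g = amono i (int n) \<kappa> * g}"

lemma theta_space_iff:
  assumes g: "g \<in> analytic_level i"
  shows "g \<in> theta_space n \<kappa> \<longleftrightarrow> (\<forall>k. ycoef g k = \<kappa> * Q powi k * ycoef g (k - int n))"
proof -
  have 1: "ycoef (dilate i (inverse Q) g) k = inverse (Q powi k) * ycoef g k" for k
    unfolding ycoef_eq by (simp add: coef_dilate dilate_series_at power_int_inverse)
  have 2: "ycoef (amono i (int n) \<kappa> * g) k = \<kappa> * ycoef g (k - int n)" for k
    unfolding ycoef_eq by (simp add: coef_mult cauchy_prod_mono diff_divide_distrib)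
  have "dilate i (inverse Q) g = amono i (int n) \<kappa> * g \<longleftrightarrow>
      (\<forall>k. ycoef (dilate i (inverse Q) g) k = ycoef (amono i (int n) \<kappa> * g) k)"
    using ycoef_eqI[OF dilate_level[of "inverse Q" i g] analytic_level_mult[OF amono_level g]] by auto
  also have "\<dots> \<longleftrightarrow> (\<forall>k. ycoef g k = \<kappa> * Q powi k * ycoef g (k - int n))"
    unfolding 1 2 by (simp add: field_simps)
  finally show ?thesis using g by (simp add: theta_space_def)
qed

lemma analytic_level_const_mult: "g \<in> analytic_level i \<Longrightarrow> const a * g \<in> analytic_level i"
  unfolding analytic_level_def by (auto simp: coef_const_mult)

lemma analytic_level_diff: "g \<in> analytic_level i \<Longrightarrow> h \<in> analytic_level i \<Longrightarrow> g - h \<in> analytic_level i"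
  unfolding lev_coef_iff[symmetric] minus_analytic.rep_eq by (rule lev_diff)

lemma analytic_level_sum: "(\<And>x. x \<in> A \<Longrightarrow> f x \<in> analytic_level i) \<Longrightarrow> sum f A \<in> analytic_level i"
  unfolding analytic_level_def mem_Collect_eq coef_sum by (metis (no_types, lifting) sum.not_neutral_contains_not_neutral)

text \<open>The recursion links k and k - n by a nonzero factor, so zeros spread in both directions
  through each residue class modulo \<open>n\<close>.\<close>

lemma theta_space_eq_0:
  assumes n: "n > 0" and \<kappa>: "\<kappa> \<noteq> 0" and g: "g \<in> theta_space n \<kappa>"
    and init: "\<And>k. k < n \<Longrightarrow> ycoef g (int k) = 0"
  shows "g = 0"
proof -
  have lg: "g \<in> analytic_level i" using g by (simp add: theta_space_def)
  have rec: "ycoef g k = \<kappa> * Q powi k * ycoef g (k - int n)" for k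
    using g theta_space_iff[OF lg] by blast
  have "ycoef g (int j + int n * l) = 0" if j: "j < n" for j l
  proof (induction l rule: int_induct[where k = 0])
    case base
    then show ?case using init[OF j] by simp
  next
    case (step1 l)
    then show ?case using rec[of "int j + int n * (l + 1)"] by (simp add: algebra_simps)
  next
    case (step2 l)
    have "\<kappa> * Q powi (int j + int n * l) * ycoef g (int j + int n * l - int n) = 0"
      using rec[of "int j + int n * l"] step2 by simp
    then have "ycoef g (int j + int n * l - int n) = 0" using \<kappa> by simp
    then show ?case by (simp add: algebra_simps)
  qed
  note zero = this
  have "ycoef g k = ycoef 0 k" for k
  proof -
    have "k = int (nat (k mod int n)) + int n * (k div int n)" using n by simp
    moreover have "nat (k mod int n) < n" using n by (simp add: nat_less_iff)
    ultimately have "ycoef g k = 0" using zero by metis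
    then show ?thesis by (simp add: ycoef_def zero_analytic.rep_eq const_series_def)
  qed
  moreover have "0 \<in> analytic_level i" by (auto simp: analytic_level_def zero_analytic.rep_eq const_series_def)
  ultimately show ?thesis using ycoef_eqI[OF lg] by blast
qed

text \<open>For fixed \<open>j < n\<close> this solves \<open>u k = \<kappa> Q\<^sup>k u (k - n)\<close> with \<open>u j = 1\<close>, supported on \<open>k \<equiv> j (mod n)\<close>.\<close>

definition theta_coeff :: "nat \<Rightarrow> 'a \<Rightarrow> nat \<Rightarrow> int \<Rightarrow> 'a" where
  "theta_coeff n \<kappa> j k = (if k mod int n = int j then
     \<kappa> powi (k div int n) * Q powi (int j * (k div int n) + int n * ((k div int n) * (k div int n + 1) div 2)) else 0)"

definition theta_basis :: "nat \<Rightarrow> 'a \<Rightarrow> nat \<Rightarrow> 'a analytic" where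
  "theta_basis n \<kappa> j = Abs_analytic (laurent i (theta_coeff n \<kappa> j))"

text \<open>For k = j + n l the power of \<open>Q\<close> has an exponent close to n l^2 / 2, so the
  logarithm of the term is a quadratic polynomial in l with negative leading coefficient.\<close>

lemma theta_coeff_bounded:
  assumes n: "n > 0" and \<kappa>: "\<kappa> \<noteq> 0" and t: "t > 0"
  shows "\<exists>B. \<forall>k. absv (theta_coeff n \<kappa> j k) * t powi k \<le> B"
proof -
  define b where "b = - (real n * ln (absv Q)) / 2"
  have lnQ: "ln (absv Q) < 0" using absv_Q by simp
  have b: "b > 0" unfolding b_def using n lnQ by (simp add: mult_pos_neg)
  \<comment> \<open>The coefficient of l in the logarithm of the l-th term. The summand -b is the
    linear part of n l (l + 1) / 2 times log |Q|.\<close>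
  define c where "c = ln (absv \<kappa>) + real j * ln (absv Q) + real n * ln t - b"
  define B where "B = exp (real j * ln t + c\<^sup>2 / (4 * b))"
  have "absv (theta_coeff n \<kappa> j k) * t powi k \<le> B" for k
  proof (cases "k mod int n = int j")
    case False
    then show ?thesis by (simp add: theta_coeff_def B_def)
  next
    case True
    define l where "l = k div int n"
    define T where "T = l * (l + 1) div 2"
    have k: "k = int j + int n * l" using True unfolding l_def by (metis mod_mult_div_eq)
    have "2 * T = l * (l + 1)" unfolding T_def by simp
    then have T: "of_int T = (real_of_int l ^ 2 + real_of_int l) / 2"
      by (simp add: power2_eq_square algebra_simps flip: of_int_mult of_int_add)
    have "absv (theta_coeff n \<kappa> j k) * t powi k =
        absv \<kappa> powi l * absv Q powi (int j * l + int n * T) * t powi (int j + int n * l)"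
      using True by (simp add: theta_coeff_def absv_mult absv_power_int k[symmetric] flip: l_def T_def)
    also have "\<dots> = exp (of_int l * ln (absv \<kappa>) + of_int (int j * l + int n * T) * ln (absv Q) +
        of_int (int j + int n * l) * ln t)"
      using \<kappa> t by (simp only: powi_eq_exp absv_pos Q_nonzero exp_add not_False_eq_True)
    also have "\<dots> = exp (real j * ln t + (of_int l * c - b * of_int l ^ 2))"
      by (rule arg_cong[of _ _ exp]) (simp add: T c_def b_def field_simps power2_eq_square)
    also have "\<dots> \<le> B" unfolding B_def using quadratic_bound[OF b, of "of_int l" c] by simp
    finally show ?thesis .
  qed
  then show ?thesis by blast
qed

lemma theta_basis:
  assumes n: "n > 0" and \<kappa>: "\<kappa> \<noteq> 0"
  shows "theta_basis n \<kappa> j \<in> analytic_level i" "ycoef (theta_basis n \<kappa> j) k = theta_coeff n \<kappa> j k"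
proof -
  have c: "coef (theta_basis n \<kappa> j) = laurent i (theta_coeff n \<kappa> j)" "theta_basis n \<kappa> j \<in> analytic_level i"
    unfolding theta_basis_def
    using coef_Abs[OF lev_laurent null_at_laurent[OF theta_coeff_bounded[OF n \<kappa>]]] by auto
  then show "theta_basis n \<kappa> j \<in> analytic_level i" "ycoef (theta_basis n \<kappa> j) k = theta_coeff n \<kappa> j k"
    by (simp_all add: ycoef_eq)
qed

lemma theta_coeff_init:
  assumes "k < n"
  shows "theta_coeff n \<kappa> j (int k) = (if k = j then 1 else 0)"
  using assms by (simp add: theta_coeff_def)

lemma theta_basis_mem:
  assumes n: "n > 0" and \<kappa>: "\<kappa> \<noteq> 0"
  shows "theta_basis n \<kappa> j \<in> theta_space n \<kappa>"
  unfolding theta_space_iff[OF theta_basis(1)[OF n \<kappa>]] theta_basis(2)[OF n \<kappa>]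
proof
  fix k
  show "theta_coeff n \<kappa> j k = \<kappa> * Q powi k * theta_coeff n \<kappa> j (k - int n)"
  proof (cases "k mod int n = int j")
    case False
    then show ?thesis by (simp add: theta_coeff_def)
  next
    case True
    define l where "l = k div int n"
    have k: "k = int j + int n * l" using True unfolding l_def by (metis mod_mult_div_eq)
    have l': "(k - int n) div int n = l - 1" 
      using div_mult_self1[of "int n" k "- 1"] n by (simp add: l_def)
    have m': "(k - int n) mod int n = int j" using True by simp
    \<comment> \<open>Triangular numbers grow by l from l - 1 to l, so the exponent of
      \<open>Q\<close> grows by j + n l = k, as the recursion demands.\<close>
    have "l * (l + 1) = (l - 1) * l + 2 * l" by (simp add: algebra_simps)
    then have T: "l * (l + 1) div 2 = (l - 1) * (l - 1 + 1) div 2 + l" by simp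
    have e: "int j * l + int n * (l * (l + 1) div 2) =
        k + (int j * (l - 1) + int n * ((l - 1) * (l - 1 + 1) div 2))"
      unfolding T k by (simp add: algebra_simps)
    have "theta_coeff n \<kappa> j k = \<kappa> powi l * Q powi (int j * l + int n * (l * (l + 1) div 2))"
      using True by (simp add: theta_coeff_def l_def)
    also have "\<dots> = \<kappa> powi (1 + (l - 1)) *
        (Q powi k * Q powi (int j * (l - 1) + int n * ((l - 1) * (l - 1 + 1) div 2)))"
      unfolding e by (simp add: power_int_add)
    also have "\<kappa> powi (1 + (l - 1)) = \<kappa> * \<kappa> powi (l - 1)"
      using \<kappa> by (subst power_int_add) simp_all
    finally show ?thesis unfolding theta_coeff_def[of n \<kappa> j "k - int n"] l' m' by (simp add: mult_ac)
  qed
qed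

text \<open>The difference of both sides satisfies the same recursion and has zero initial
  coefficients.\<close>

lemma theta_space_expansion:
  assumes n: "n > 0" and \<kappa>: "\<kappa> \<noteq> 0" and g: "g \<in> theta_space n \<kappa>"
  shows "g = (\<Sum>j<n. const (ycoef g (int j)) * theta_basis n \<kappa> j)"
proof -
  define h where "h = (\<Sum>j<n. const (ycoef g (int j)) * theta_basis n \<kappa> j)"
  have lg: "g \<in> analytic_level i" using g by (simp add: theta_space_def)
  have lh: "h \<in> analytic_level i"
    unfolding h_def by (intro analytic_level_sum analytic_level_const_mult theta_basis(1)[OF n \<kappa>])
  have yh: "ycoef h k = (\<Sum>j<n. ycoef g (int j) * theta_coeff n \<kappa> j k)" for k
    unfolding h_def theta_basis(2)[OF n \<kappa>, symmetric] by (simp add: ycoef_def coef_sum coef_const_mult)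
  have rec: "theta_coeff n \<kappa> j k = \<kappa> * Q powi k * theta_coeff n \<kappa> j (k - int n)" for j k
    using theta_basis_mem[OF n \<kappa>, of j]
    unfolding theta_space_iff[OF theta_basis(1)[OF n \<kappa>]] theta_basis(2)[OF n \<kappa>] by blast
  have gh: "g - h \<in> theta_space n \<kappa>"
    unfolding theta_space_iff[OF analytic_level_diff[OF lg lh]]
  proof
    fix k
    have "ycoef h k = \<kappa> * Q powi k * ycoef h (k - int n)"
      unfolding yh sum_distrib_left by (subst rec) (simp add: mult_ac)
    moreover have "ycoef g k = \<kappa> * Q powi k * ycoef g (k - int n)" using g theta_space_iff[OF lg] by blast
    moreover have "ycoef (g - h) k = ycoef g k - ycoef h k" for k by (simp add: ycoef_def coef_diff)
    ultimately show "ycoef (g - h) k = \<kappa> * Q powi k * ycoef (g - h) (k - int n)"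
      by (simp add: right_diff_distrib)
  qed
  have "g - h = 0"
  proof (rule theta_space_eq_0[OF n \<kappa> gh])
    fix k assume k: "k < n"
    have "ycoef h (int k) = (\<Sum>j<n. if k = j then ycoef g (int j) else 0)"
      unfolding yh by (rule sum.cong) (simp_all add: theta_coeff_init[OF k])
    also have "\<dots> = ycoef g (int k)" using k by simp
    finally show "ycoef (g - h) (int k) = 0" by (simp add: ycoef_def coef_diff)
  qed
  then show ?thesis by (simp add: h_def)
qed

section \<open>The dimension of the divisor space\<close>

lemma Fract_mult_const: "scale_merom a (Fract x y) = Fract (const a * x) y"
  by (simp add: scale_merom_def)

lemma divisor_dim_eq:
  assumes deg: "degree pole_poly < degree zeros_poly"
  shows "divisor_dim w i Q d = degree zeros_poly - degree pole_poly"
proof -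
  let ?e = "insep_degree TYPE('a) i"
  obtain \<theta> \<theta>' c c' where \<theta>: "\<theta> \<in> analytic_level i" "\<theta> \<noteq> 0" "c \<noteq> 0"
      "dilate i (inverse Q) \<theta> = amono i (int (degree zeros_poly)) c * \<theta>"
    and \<theta>': "\<theta>' \<in> analytic_level i" "\<theta>' \<noteq> 0" "c' \<noteq> 0"
      "dilate i (inverse Q) \<theta>' = amono i (int (degree pole_poly)) c' * \<theta>'"
    and ord: "\<And>\<beta>. \<beta> \<noteq> 0 \<Longrightarrow> int N * (int (zero_order i \<beta> \<theta>) - int (zero_order i \<beta> \<theta>')) = int ?e * dmult (\<beta> ^ N)"
    by (rule theta_quotient_exists) blast
  define n where "n = degree zeros_poly - degree pole_poly"
  \<comment> \<open>Dilation multiplies f \<theta> / \<theta>', for invariant f, by the quotient of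
    the factors belonging to \<theta> and \<theta>'; this is \<kappa> Y^n.\<close>
  define \<kappa> where "\<kappa> = c / c'"
  define M where "M = amono i (int n) \<kappa>"
  define M1 where "M1 = amono i (int (degree zeros_poly)) c"
  define M2 where "M2 = amono i (int (degree pole_poly)) c'"
  have n: "n > 0" using deg by (simp add: n_def)
  have \<kappa>: "\<kappa> \<noteq> 0" using \<theta>(3) \<theta>'(3) by (simp add: \<kappa>_def)
  have M12: "M2 * M = M1"
    unfolding M_def M1_def M2_def amono_mult using deg \<theta>'(3) by (simp add: n_def \<kappa>_def)
  have M_ne: "M1 \<noteq> 0" "M2 \<noteq> 0" unfolding M1_def M2_def using amono_nonzero \<theta>(3) \<theta>'(3) by blast+
  have iQ: "inverse Q \<noteq> 0" by simp
  let ?dil = "dilate i (inverse Q)"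
  have d\<theta>: "?dil \<theta> = M1 * \<theta>" "?dil \<theta>' = M2 * \<theta>'" using \<theta>(4) \<theta>'(4) by (simp_all add: M1_def M2_def)

  have e0: "?e > 0" by simp
  have diff: "rat_of_int (int (zero_order i \<beta> \<theta>) - int (zero_order i \<beta> \<theta>')) = d (\<beta> ^ N) * of_nat ?e"
    if \<beta>: "\<beta> \<noteq> 0" for \<beta>
  proof -
    have "of_int (int N * (int (zero_order i \<beta> \<theta>) - int (zero_order i \<beta> \<theta>'))) = (of_int (int ?e * dmult (\<beta> ^ N)) :: rat)"
      unfolding ord[OF \<beta>] ..
    then have "of_nat N * rat_of_int (int (zero_order i \<beta> \<theta>) - int (zero_order i \<beta> \<theta>')) = of_nat ?e * of_int (dmult (\<beta> ^ N))"
      by (simp only: of_int_mult of_int_of_nat_eq)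
    moreover have "d (\<beta> ^ N) = of_int (dmult (\<beta> ^ N)) / of_nat N" using \<beta> by (intro dmult) simp
    moreover have "x = y / of_nat N * z" if "of_nat N * x = z * y" for x y z :: rat
      using that by (simp add: field_simps)
    ultimately show ?thesis by simp
  qed
  \<comment> \<open>Each nonzero \<beta> lies above the class of \<beta>^N. As \<open>ord_at\<close>
    is a minimum over the points above a class and \<open>d\<close> is constant on it, bounds at all
    classes and bounds at all \<beta> say the same.\<close>
  have cond: "(\<forall>\<alpha>. \<alpha> \<noteq> 0 \<longrightarrow> - d \<alpha> \<le> ord_at w \<alpha> (Fract g h)) \<longleftrightarrow>
      (\<forall>\<beta>. \<beta> \<noteq> 0 \<longrightarrow> zero_order i \<beta> h + zero_order i \<beta> \<theta>' \<le> zero_order i \<beta> g + zero_order i \<beta> \<theta>)"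
    if g: "g \<in> analytic_level i" "g \<noteq> 0" and h: "h \<in> analytic_level i" "h \<noteq> 0" for g h
  proof -
    define v where "v = (\<lambda>\<beta>. int (zero_order i \<beta> g) - int (zero_order i \<beta> h))"
    define V where "V = (\<lambda>\<alpha>. {v \<beta> | \<beta>. \<beta> ^ N \<in> conj_class \<alpha>})"
    have V: "finite (V \<alpha>)" "V \<alpha> \<noteq> {}" "ord_at w \<alpha> (Fract g h) = of_int (Min (V \<alpha>)) / of_nat ?e" if "\<alpha> \<noteq> 0" for \<alpha>
      unfolding V_def v_def N_def using ord_at_Fract[OF that g h] by blast+
    have key: "- d (\<beta> ^ N) \<le> of_int (v \<beta>) / of_nat ?e \<longleftrightarrow>
        zero_order i \<beta> h + zero_order i \<beta> \<theta>' \<le> zero_order i \<beta> g + zero_order i \<beta> \<theta>" if \<beta>: "\<beta> \<noteq> 0" for \<beta>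
    proof -
      have "- d (\<beta> ^ N) \<le> of_int (v \<beta>) / of_nat ?e \<longleftrightarrow> - (d (\<beta> ^ N) * of_nat ?e) \<le> of_int (v \<beta>)"
        using e0 by (simp add: pos_le_divide_eq del: insep_degree_pos)
      also have "\<dots> \<longleftrightarrow> rat_of_int (- (int (zero_order i \<beta> \<theta>) - int (zero_order i \<beta> \<theta>'))) \<le> of_int (v \<beta>)"
        unfolding diff[OF \<beta>, symmetric] by (simp only: of_int_minus)
      also have "\<dots> \<longleftrightarrow> - (int (zero_order i \<beta> \<theta>) - int (zero_order i \<beta> \<theta>')) \<le> v \<beta>"
        by (rule of_int_le_iff)
      finally show ?thesis unfolding v_def by linarith
    qed
    show ?thesis
    proof (intro iffI allI impI)
      fix \<beta> assume *: "\<forall>\<alpha>. \<alpha> \<noteq> 0 \<longrightarrow> - d \<alpha> \<le> ord_at w \<alpha> (Fract g h)" and \<beta>: "\<beta> \<noteq> (0 :: 'a alg_closure)"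
      then have b0: "\<beta> ^ N \<noteq> 0" by simp
      have "v \<beta> \<in> V (\<beta> ^ N)" unfolding V_def using conj_class_self by blast
      then have "Min (V (\<beta> ^ N)) \<le> v \<beta>" using V(1)[OF b0] by simp
      then have "rat_of_int (Min (V (\<beta> ^ N))) / of_nat ?e \<le> of_int (v \<beta>) / of_nat ?e"
        by (intro divide_right_mono) auto
      moreover have "- d (\<beta> ^ N) \<le> of_int (Min (V (\<beta> ^ N))) / of_nat ?e" using * b0 V(3)[OF b0] by metis
      ultimately show "zero_order i \<beta> h + zero_order i \<beta> \<theta>' \<le> zero_order i \<beta> g + zero_order i \<beta> \<theta>"
        using key[OF \<beta>] by linarith
    next
      fix \<alpha> assume *: "\<forall>\<beta>. \<beta> \<noteq> 0 \<longrightarrow> zero_order i \<beta> h + zero_order i \<beta> \<theta>' \<le> zero_order i \<beta> g + zero_order i \<beta> \<theta>"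
        and \<alpha>: "\<alpha> \<noteq> (0 :: 'a alg_closure)"
      have "Min (V \<alpha>) \<in> V \<alpha>" using V(1,2)[OF \<alpha>] by (rule Min_in)
      then obtain \<beta> where \<beta>: "\<beta> ^ N \<in> conj_class \<alpha>" "Min (V \<alpha>) = v \<beta>" unfolding V_def by blast
      have "\<beta> \<noteq> 0" using conj_class_nonzero[OF \<beta>(1) \<alpha>] by (auto simp: power_0_left)
      then have "- d (\<beta> ^ N) \<le> of_int (v \<beta>) / of_nat ?e" using key * by blast
      \<comment> \<open>The \<beta> attaining the minimum lies above some conjugate of \<alpha>, not
        necessarily \<alpha> itself; \<open>d\<close> has the same value there.\<close>
      then show "- d \<alpha> \<le> ord_at w \<alpha> (Fract g h)"
        unfolding V(3)[OF \<alpha>] \<beta>(2) using d_conj[OF \<alpha> \<beta>(1)] by simp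
    qed
  qed

  define \<phi> where "\<phi> = (\<lambda>x. Fract (x * \<theta>') \<theta>)"
  have level: "x * \<theta>' \<in> analytic_level i" if "x \<in> analytic_level i" for x
    by (rule analytic_level_mult[OF that \<theta>'(1)])

  have sub1: "\<exists>x\<in>theta_space n \<kappa>. f = \<phi> x" if f: "f \<in> divisor_space w i Q d" for f
  proof -
    obtain g h where gh: "g \<in> analytic_level i" "h \<in> analytic_level i" "h \<noteq> 0" "f = Fract g h"
      "Fract (?dil g) (?dil h) = Fract g h"
      using f unfolding divisor_space_def periodic_merom_def by blast
    show ?thesis
    proof (cases "g = 0")
      case True
      have "0 \<in> theta_space n \<kappa>"
        unfolding theta_space_def using dilate_0[OF iQ, of i]
        by (auto simp: analytic_level_def zero_analytic.rep_eq const_series_def)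
      moreover have "f = \<phi> 0" using True gh(3) \<theta>(2) by (simp add: gh(4) \<phi>_def eq_fract)
      ultimately show ?thesis by blast
    next
      case False
      have "f \<noteq> 0" using False gh(3) by (simp add: gh(4) Zero_fract_def eq_fract)
      then have "\<forall>\<alpha>. \<alpha> \<noteq> 0 \<longrightarrow> - d \<alpha> \<le> ord_at w \<alpha> (Fract g h)"
        using f unfolding divisor_space_def gh(4) by blast
      then have le: "\<forall>\<beta>. \<beta> \<noteq> 0 \<longrightarrow> zero_order i \<beta> h + zero_order i \<beta> \<theta>' \<le> zero_order i \<beta> g + zero_order i \<beta> \<theta>"
        using cond[OF gh(1) False gh(2,3)] by blast
      \<comment> \<open>The pointwise bound says exactly that h \<theta>' divides g \<theta>; the
        quotient is the theta function belonging to f.\<close>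
      obtain x where x: "x \<in> analytic_level i" "g * \<theta> = h * \<theta>' * x"
      proof (rule analytic_divides[of "g * \<theta>" i "h * \<theta>'"])
        show "g * \<theta> \<in> analytic_level i" "h * \<theta>' \<in> analytic_level i"
          using gh \<theta> \<theta>' by (auto intro: analytic_level_mult)
        show "g * \<theta> \<noteq> 0" "h * \<theta>' \<noteq> 0" using False gh \<theta> \<theta>' by auto
        show "zero_order i \<beta> (h * \<theta>') \<le> zero_order i \<beta> (g * \<theta>)" if "\<beta> \<noteq> 0" for \<beta>
          using le that zero_order_mult[OF that gh(1) \<theta>(1) False \<theta>(2)]
            zero_order_mult[OF that gh(2) \<theta>'(1) gh(3) \<theta>'(2)] by simp
      qed blast
      have "f = \<phi> x" using x(2) gh(3) \<theta>(2) by (simp add: gh(4) \<phi>_def eq_fract mult_ac)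
      moreover have "x \<in> theta_space n \<kappa>"
      proof -
        have dh: "?dil h \<noteq> 0" using dilate_eq_0_iff[OF iQ gh(2)] gh(3) by simp
        have per: "?dil g * h = g * ?dil h" using gh(5) dh gh(3) by (simp add: eq_fract)
        have "?dil (g * \<theta>) = ?dil (h * \<theta>' * x)" unfolding x(2) ..
        then have "?dil g * (M1 * \<theta>) = ?dil h * (M2 * \<theta>') * ?dil x"
          using dilate_mult[OF iQ gh(1) \<theta>(1)] dilate_mult[OF iQ analytic_level_mult[OF gh(2) \<theta>'(1)] x(1)]
            dilate_mult[OF iQ gh(2) \<theta>'(1)] by (simp add: d\<theta>)
        then have "?dil g * (M1 * \<theta>) * h = ?dil h * (M2 * \<theta>') * ?dil x * h" by simp
        moreover have "?dil g * (M1 * \<theta>) * h = (?dil g * h) * (M1 * \<theta>)" by (simp only: mult_ac)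
        moreover have "\<dots> = ?dil h * M1 * (g * \<theta>)" unfolding per by (simp only: mult_ac)
        ultimately have "?dil h * M1 * (h * \<theta>' * x) = ?dil h * (M2 * \<theta>') * ?dil x * h" unfolding x(2) by simp
        \<comment> \<open>Both sides now contain the dilate of \<theta>' and the factor h, and what
          remains after cancelling is the functional equation of x.\<close>
        then have "(?dil h * M2 * h * \<theta>') * (M * x) = (?dil h * M2 * h * \<theta>') * ?dil x"
          unfolding M12[symmetric] by (simp only: mult_ac)
        moreover have "?dil h * M2 * h * \<theta>' \<noteq> 0" using dh M_ne gh(3) \<theta>'(2) by simp
        ultimately have "?dil x = M * x" by (metis mult_left_cancel)
        then show ?thesis using x(1) by (simp add: theta_space_def M_def)
      qed
      ultimately show ?thesis by blast
    qed
  qed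

  have sub2: "\<phi> x \<in> divisor_space w i Q d" if x: "x \<in> theta_space n \<kappa>" for x
  proof -
    have lx: "x \<in> analytic_level i" and dx: "?dil x = M * x" using x by (auto simp: theta_space_def M_def)
    have dt0: "?dil \<theta> \<noteq> 0" using dilate_eq_0_iff[OF iQ \<theta>(1)] \<theta>(2) by simp
    have "?dil (x * \<theta>') * \<theta> = x * \<theta>' * ?dil \<theta>"
      unfolding dilate_mult[OF iQ lx \<theta>'(1)] d\<theta> dx M12[symmetric] by (simp only: mult_ac)
    then have "Fract (?dil (x * \<theta>')) (?dil \<theta>) = \<phi> x" using dt0 \<theta>(2) by (simp add: \<phi>_def eq_fract)
    then have "\<phi> x \<in> periodic_merom i Q"
      unfolding periodic_merom_def using level[OF lx] \<theta>(1,2) by (auto simp: \<phi>_def)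
    moreover have "\<phi> x = 0 \<or> (\<forall>\<alpha>. \<alpha> \<noteq> 0 \<longrightarrow> - d \<alpha> \<le> ord_at w \<alpha> (\<phi> x))"
    proof (cases "x = 0")
      case True
      then show ?thesis using \<theta>(2) by (simp add: \<phi>_def Zero_fract_def eq_fract)
    next
      case False
      have "x * \<theta>' \<noteq> 0" using False \<theta>'(2) by simp
      moreover have "zero_order i \<beta> \<theta> + zero_order i \<beta> \<theta>' \<le> zero_order i \<beta> (x * \<theta>') + zero_order i \<beta> \<theta>" if "\<beta> \<noteq> 0" for \<beta>
        using zero_order_mult[OF that lx \<theta>'(1) False \<theta>'(2)] by simp
      ultimately show ?thesis using cond[OF level[OF lx] _ \<theta>(1,2)] unfolding \<phi>_def by blast
    qed
    ultimately show ?thesis by (simp add: divisor_space_def)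
  qed

  have comb: "(\<Sum>j<n. scale_merom (u j) (\<phi> (theta_basis n \<kappa> j))) =
      \<phi> (\<Sum>j<n. const (u j) * theta_basis n \<kappa> j)" for u
  proof -
    have "(\<Sum>j\<in>A. scale_merom (u j) (\<phi> (theta_basis n \<kappa> j))) = \<phi> (\<Sum>j\<in>A. const (u j) * theta_basis n \<kappa> j)"
      if "finite A" for A
      using that
    proof (induction A rule: finite_induct)
      case empty
      then show ?case using \<theta>(2) by (simp add: \<phi>_def Zero_fract_def eq_fract)
    next
      case (insert j A)
      have add: "\<phi> (x + y) = \<phi> x + \<phi> y" for x y
        using \<theta>(2) by (simp add: \<phi>_def eq_fract algebra_simps)
      show ?case using insert by (simp add: add) (simp add: \<phi>_def Fract_mult_const mult.assoc)
    qed
    then show ?thesis by simp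
  qed
  have indep: "u k = 0" if sum: "(\<Sum>j<n. scale_merom (u j) (\<phi> (theta_basis n \<kappa> j))) = 0" and k: "k < n" for u k
  proof -
    define x where "x = (\<Sum>j<n. const (u j) * theta_basis n \<kappa> j)"
    have "\<phi> x = 0" using sum unfolding comb x_def .
    then have "x = 0" using \<theta>(2) \<theta>'(2) by (simp add: \<phi>_def Zero_fract_def eq_fract)
    then have "ycoef x (int k) = 0" by (simp add: ycoef_def zero_analytic.rep_eq const_series_def)
    moreover have "ycoef x (int k) = (\<Sum>j<n. u j * ycoef (theta_basis n \<kappa> j) (int k))"
      by (simp add: x_def ycoef_def coef_sum coef_const_mult)
    moreover have "\<dots> = (\<Sum>j<n. if k = j then u j else 0)"
      by (rule sum.cong) (simp_all add: theta_basis(2)[OF n \<kappa>] theta_coeff_init[OF k])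
    moreover have "\<dots> = u k" using k by simp
    ultimately show ?thesis by simp
  qed
  define b where "b = (\<lambda>j. \<phi> (theta_basis n \<kappa> j))"
  have inj: "inj_on b {..<n}"
  proof (rule inj_onI, rule ccontr)
    fix j k assume jk: "j \<in> {..<n}" "k \<in> {..<n}" "b j = b k" "j \<noteq> k"
    \<comment> \<open>Independence was proved for families indexed by j < n. Coefficients 1 and -1
      at two equal members contradict it, so the basis has \<open>n\<close> distinct
      elements.\<close>
    define u where "u = (\<lambda>l. if l = j then 1 else if l = k then - 1 else 0 :: 'a)"
    have "(\<Sum>l<n. scale_merom (u l) (b l)) = (\<Sum>l\<in>{j, k}. scale_merom (u l) (b l))"
      using jk by (intro sum.mono_neutral_right) (auto simp: u_def)
    also have "\<dots> = 0" using jk by (simp add: u_def)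
    finally have "u j = 0" using indep[of u j] jk by (simp add: b_def)
    then show False by (simp add: u_def)
  qed
  have "merom.independent (b ` {..<n})"
  proof (rule merom.independent_if_scalars_zero)
    fix u x assume s: "(\<Sum>x\<in>b ` {..<n}. scale_merom (u x) x) = 0" and "x \<in> b ` {..<n}"
    then obtain k where k: "k < n" "x = b k" by auto
    have "(\<Sum>j<n. scale_merom (u (b j)) (b j)) = 0" using s by (simp add: sum.reindex[OF inj])
    then show "u x = 0" using indep[of "\<lambda>j. u (b j)" k] k by (simp add: b_def)
  qed simp
  moreover have "b ` {..<n} \<subseteq> divisor_space w i Q d"
    unfolding b_def using sub2 theta_basis_mem[OF n \<kappa>] by blast
  moreover have "divisor_space w i Q d \<subseteq> merom.span (b ` {..<n})"
  proof
    fix f assume "f \<in> divisor_space w i Q d"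
    then obtain x where x: "x \<in> theta_space n \<kappa>" "f = \<phi> x" using sub1 by blast
    have "f = (\<Sum>j<n. scale_merom (ycoef x (int j)) (b j))"
      unfolding b_def comb x(2) using theta_space_expansion[OF n \<kappa> x(1)] by simp
    also have "\<dots> \<in> merom.span (b ` {..<n})"
      by (intro merom.span_sum merom.span_scale merom.span_base) simp
    finally show "f \<in> merom.span (b ` {..<n})" .
  qed
  ultimately have "card (b ` {..<n}) = merom.dim (divisor_space w i Q d)"
    by (intro merom.basis_card_eq_dim)
  then have "merom.dim (divisor_space w i Q d) = n" by (simp add: card_image[OF inj])
  then show ?thesis by (simp add: divisor_dim_def n_def)
qed

end

no_notation cauchy_prod (infixl "\<star>" 70)

theorem theorem2:
  fixes q Q :: "'a::perfectoid_field" and p i :: nat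
    and w :: "'a alg_closure \<Rightarrow> real" and d :: "'a alg_closure \<Rightarrow> rat"
  assumes "residue_char TYPE('a) = p"
    and "extends_absv w"
    and "0 < absv q" and "absv q < 1"
    and "Q ^ (p ^ i) = q"
    and "divisor w d"
    and "periodic_divisor q d"
    and "\<And>\<alpha>. \<alpha> \<noteq> 0 \<Longrightarrow> d \<alpha> \<in> exponents_level p i"
    and "CHAR('a) = 0 \<Longrightarrow> (\<And>\<alpha>. \<alpha> \<noteq> 0 \<Longrightarrow> d \<alpha> \<in> \<int>)"
    and "divisor_degree w q d > 0"
  shows "of_nat (divisor_dim w i Q d) = divisor_degree w q d * of_nat (p ^ i)"
proof -
  interpret tate_divisor w q Q i d "p ^ i"
  proof
    show "p ^ i = residue_char TYPE('a) ^ i" using assms(1) by simp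
  qed (use assms in auto)
  \<comment> \<open>Positivity of the degree becomes n > 0, the sign for which the theta
    coefficients decay like |Q|^(n l^2 / 2) in both directions.\<close>
  have "(0 :: rat) < of_nat (p ^ i)" using N_pos by (simp only: of_nat_0_less_iff)
  then have "0 < divisor_degree w q d * of_nat (p ^ i)" using assms(10) by (rule mult_pos_pos[rotated])
  then have "0 < int (degree zeros_poly) - int (degree pole_poly)"
    unfolding divisor_degree_eq by (simp only: of_int_0_less_iff)
  then have deg: "degree pole_poly < degree zeros_poly" by simp
  then have "int (degree zeros_poly) - int (degree pole_poly) = int (degree zeros_poly - degree pole_poly)" by simp
  then show ?thesis unfolding divisor_degree_eq divisor_dim_eq[OF deg] by (simp only: of_int_of_nat_eq)
qed

end
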